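(* Let $\alpha$ be an endomorphism of a unital $C^*$-algebra $A$, and let $L$ be a transfer operator for $(A,\alpha)$. Suppose $B$ is a $C^*$-algebra and $(\rho,V)$ is a covariant representation of $(A,\alpha,L)$ in $B$ satisfying: (1) for $a\in A$, $\rho(a)=0$ implies $j_A(a)=0$; (2) for $a\in A$, if $\rho(a)\in(\psi_V,\rho)^{(1)}(\mathcal{K}(M_L))$, then $j_A(a)\in j_A(K_\alpha)$; (3) there exists a strongly continuous action $\beta:\mathbb{T}\to\operatorname{Aut}\big(\tau_{\rho,V}(A\rtimes_{\alpha,L}\mathbb{N})\big)$ such that $\beta_z\circ\tau_{\rho,V}=\tau_{\rho,V}\circ\delta_z$ for all $z\in\mathbb{T}$. Then the corresponding representation $\tau_{\rho,V}:A\rtimes_{\alpha,L}\mathbb{N}\to B$ is faithful.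
   Context: Endomorphisms are $*$-homomorphisms $\alpha:A\to A$, not assumed unital or injective. A transfer operator for $(A,\alpha)$ is a continuous linear map $L:A\to A$ that is positive ($a\ge 0\Rightarrow L(a)\ge 0$) and satisfies $L(\alpha(a)b)=aL(b)$ for all $a,b\in A$. A Toeplitz-covariant representation $(\rho,V)$ of $(A,\alpha,L)$ in a $C^*$-algebra $B$ is a unital homomorphism $\rho:A\to B$ and an element $V\in B$ with $V\rho(a)=\rho(\alpha(a))V$ and $V^*\rho(a)V=\rho(L(a))$ for all $a\in A$. $\mathcal{T}(A,\alpha,L)$ is the universal unital $C^*$-algebra generated by a Toeplitz-covariant representation $(i_A,S)$; $i_A$ is injective. The bimodule $M_L$: let $A_L$ be a copy of the vector space $A$ with right action $m\cdot a=m\alpha(a)$ and $A$-valued form $\langle m,n\rangle_L=L(m^*n)$; let $N=\{a\in A_L:\langle a,a\rangle_L=0\}$, let $q:A_L\to A_L/N$ be the quotient map, and let $M_L$ be the right Hilbert $A$-module obtained by completing $A_L/N$, with left action $\phi:A\to\mathcal{L}(M_L)$, $\phi(a)q(b)=q(ab)$. Let $\Theta_{x,y}(z)=x\cdot\langle y,z\rangle_L$, let $\mathcal{K}(M_L)$ be the closed span of the $\Theta_{x,y}$, let $J(M_L):=\phi^{-1}(\mathcal{K}(M_L))$, and let $K_\alpha:=\overline{A\alpha(A)A}\cap J(M_L)$, where $\overline{A\alpha(A)A}$ is the closed linear span of the products $a\alpha(b)c$. A Toeplitz representation $(\psi,\pi)$ of $M_L$ in $B$ is a linear map $\psi:M_L\to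 B$ and a homomorphism $\pi:A\to B$ with $\psi(x\cdot a)=\psi(x)\pi(a)$, $\psi(x)^*\psi(y)=\pi(\langle x,y\rangle_L)$, $\psi(\phi(a)x)=\pi(a)\psi(x)$; it induces a homomorphism $(\psi,\pi)^{(1)}:\mathcal{K}(M_L)\to B$ with $(\psi,\pi)^{(1)}(\Theta_{x,y})=\psi(x)\psi(y)^*$. Every Toeplitz-covariant representation $(\rho,V)$ gives a Toeplitz representation $(\psi_V,\rho)$ of $M_L$, where $\psi_V$ is the bounded linear map with $\psi_V(q(a))=\rho(a)V$. A covariant representation of $(A,\alpha,L)$ is a Toeplitz-covariant representation $(\rho,V)$ which in addition satisfies $\rho(a)=(\psi_V,\rho)^{(1)}(\phi(a))$ for all $a\in K_\alpha$. Crossed product: a redundancy is a pair $(i_A(a),k)$ with $a\in A$, $k\in\overline{i_A(A)SS^*i_A(A)}$ (closed linear span) and $i_A(a)i_A(b)S=k\,i_A(b)S$ for all $b\in A$. Exel's crossed product $A\rtimes_{\alpha,L}\mathbb{N}$ is the quotient of $\mathcal{T}(A,\alpha,L)$ by the closed two-sided ideal generated by $\{i_A(a)-k: (i_A(a),k)\text{ is a redundancy with } a\in\overline{A\alpha(A)A}\}$; $Q$ is the quotient map, $j_A:=Q\circ i_A$ and $T:=Q(S)$. The pair $(j_A,T)$ is universal for covariant representations: for each covariant representation $(\rho,V)$ in $B$, $\tau_{\rho,V}:A\rtimes_{\alpha,L}\mathbb{N}\to B$ denotes the homomorphism with $\tau_{\rho,V}\circ j_A=\rho$ and $\tau_{\rho,V}(T)=V$.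 The gauge action $\delta:\mathbb{T}\to\operatorname{Aut}(A\rtimes_{\alpha,L}\mathbb{N})$ is the strongly continuous action with $\delta_z(j_A(a))=j_A(a)$ and $\delta_z(T)=zT$. *)

theory Defs
  imports "HOL-Analysis.Analysis" "HOL-Algebra.Ring"
begin

section \<open>C*-algebras\<close>

class scaleC =
  fixes scaleC :: "complex \<Rightarrow> 'a \<Rightarrow> 'a"  (infixr "*\<^sub>C" 75)

class complex_banach = banach + scaleC +
  assumes scaleC_add_right: "c *\<^sub>C (x + y) = c *\<^sub>C x + c *\<^sub>C y"
    and scaleC_add_left: "(c + d) *\<^sub>C x = c *\<^sub>C x + d *\<^sub>C x"
    and scaleC_scaleC: "c *\<^sub>C (d *\<^sub>C x) = (c * d) *\<^sub>C x"
    and scaleC_of_real: "complex_of_real r *\<^sub>C x = r *\<^sub>R x"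
    and norm_scaleC: "norm (c *\<^sub>C x) = cmod c * norm x"

text \<open>The unit comes from \<open>monoid_mult\<close> rather than \<open>ring_1\<close>, because \<open>ring_1\<close> demands
  \<open>0 \<noteq> 1\<close> and the crossed product defined below can be the zero algebra
  (for instance when \<open>L = 0\<close> and \<open>\<alpha>\<close> is unital).\<close>

class unital_cstar_algebra = complex_banach + real_normed_algebra + monoid_mult +
  fixes star :: "'a \<Rightarrow> 'a"
  assumes mult_scaleC_left: "(c *\<^sub>C x) * y = c *\<^sub>C (x * y)"
    and mult_scaleC_right: "x * (c *\<^sub>C y) = c *\<^sub>C (x * y)"
    and star_add: "star (x + y) = star x + star y"
    and star_scaleC: "star (c *\<^sub>C x) = cnj c *\<^sub>C star x"
    and star_mult: "star (x * y) = star y * star x"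
    and star_star: "star (star x) = x"
    and cstar_identity: "norm (star x * x) = (norm x)\<^sup>2"

definition positive :: "'a::unital_cstar_algebra \<Rightarrow> bool" where
  "positive a \<longleftrightarrow> (\<exists>b. a = star b * b)"

definition clinear :: "('x::complex_banach \<Rightarrow> 'y::complex_banach) \<Rightarrow> bool" where
  "clinear f \<longleftrightarrow> (\<forall>x y. f (x + y) = f x + f y) \<and> (\<forall>c x. f (c *\<^sub>C x) = c *\<^sub>C f x)"

text \<open>Here \<open>X\<close> is meant to be a *-subalgebra; homomorphisms are not assumed to be unital.\<close>

definition star_hom_on ::
  "'x set \<Rightarrow> ('x::unital_cstar_algebra \<Rightarrow> 'y::unital_cstar_algebra) \<Rightarrow> bool" where
  "star_hom_on X f \<longleftrightarrow>
     (\<forall>x\<in>X. \<forall>y\<in>X. f (x + y) = f x + f y) \<and>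
     (\<forall>c. \<forall>x\<in>X. f (c *\<^sub>C x) = c *\<^sub>C f x) \<and>
     (\<forall>x\<in>X. \<forall>y\<in>X. f (x * y) = f x * f y) \<and>
     (\<forall>x\<in>X. f (star x) = star (f x))"

abbreviation star_hom :: "('x::unital_cstar_algebra \<Rightarrow> 'y::unital_cstar_algebra) \<Rightarrow> bool" where
  "star_hom \<equiv> star_hom_on UNIV"

definition cstar_subalgebra :: "'x::unital_cstar_algebra set \<Rightarrow> bool" where
  "cstar_subalgebra X \<longleftrightarrow> closed X \<and> 0 \<in> X \<and>
     (\<forall>x\<in>X. \<forall>y\<in>X. x + y \<in> X \<and> x * y \<in> X) \<and>
     (\<forall>c. \<forall>x\<in>X. c *\<^sub>C x \<in> X) \<and> (\<forall>x\<in>X. star x \<in> X)"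

definition cstar_generated :: "'x::unital_cstar_algebra set \<Rightarrow> 'x set" where
  "cstar_generated G = \<Inter>{X. cstar_subalgebra X \<and> G \<subseteq> X}"

definition closed_ideal :: "'x::unital_cstar_algebra set \<Rightarrow> bool" where
  "closed_ideal I \<longleftrightarrow> closed I \<and> 0 \<in> I \<and>
     (\<forall>x\<in>I. \<forall>y\<in>I. x + y \<in> I) \<and> (\<forall>c. \<forall>x\<in>I. c *\<^sub>C x \<in> I) \<and>
     (\<forall>x\<in>I. \<forall>y. x * y \<in> I \<and> y * x \<in> I)"

definition ideal_generated :: "'x::unital_cstar_algebra set \<Rightarrow> 'x set" where
  "ideal_generated G = \<Inter>{I. closed_ideal I \<and> G \<subseteq> I}"

definition cstar_quotient_map ::
  "('x::unital_cstar_algebra \<Rightarrow> 'y::unital_cstar_algebra) \<Rightarrow> 'x set \<Rightarrow> bool" where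
  "cstar_quotient_map Q I \<longleftrightarrow>
     star_hom Q \<and> surj Q \<and> {x. Q x = 0} = I \<and> (\<forall>x. norm (Q x) = infdist x I)"

definition circle_action ::
  "'x::unital_cstar_algebra set \<Rightarrow> (complex \<Rightarrow> 'x \<Rightarrow> 'x) \<Rightarrow> bool" where
  "circle_action X \<beta> \<longleftrightarrow>
     (\<forall>z\<in>sphere 0 1. bij_betw (\<beta> z) X X \<and> star_hom_on X (\<beta> z)) \<and>
     (\<forall>x\<in>X. \<beta> 1 x = x) \<and>
     (\<forall>z\<in>sphere 0 1. \<forall>w\<in>sphere 0 1. \<forall>x\<in>X. \<beta> (z * w) x = \<beta> z (\<beta> w x)) \<and>
     (\<forall>x\<in>X. continuous_on (sphere 0 1) (\<lambda>z. \<beta> z x))"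

section \<open>Transfer operators and Toeplitz-covariant representations\<close>

definition transfer_operator ::
  "('a::unital_cstar_algebra \<Rightarrow> 'a) \<Rightarrow> ('a \<Rightarrow> 'a) \<Rightarrow> bool" where
  "transfer_operator \<alpha> L \<longleftrightarrow>
     continuous_on UNIV L \<and> clinear L \<and> (\<forall>a. positive a \<longrightarrow> positive (L a)) \<and>
     (\<forall>a b. L (\<alpha> a * b) = a * L b)"

definition toeplitz_covariant ::
  "('a::unital_cstar_algebra \<Rightarrow> 'a) \<Rightarrow> ('a \<Rightarrow> 'a) \<Rightarrow>
   ('a \<Rightarrow> 'b::unital_cstar_algebra) \<Rightarrow> 'b \<Rightarrow> bool" where
  "toeplitz_covariant \<alpha> L \<rho> V \<longleftrightarrow>
     star_hom \<rho> \<and> \<rho> 1 = 1 \<and>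
     (\<forall>a. V * \<rho> a = \<rho> (\<alpha> a) * V) \<and> (\<forall>a. star V * \<rho> a * V = \<rho> (L a))"

section \<open>The Toeplitz algebra\<close>

text \<open>The universal property quantifies over C*-algebras, and a formula cannot quantify over types;
  so C*-algebras are also rendered as structures on a subset of a fixed type.\<close>

record 'u cstar_structure = "'u ring" +
  sc :: "complex \<Rightarrow> 'u \<Rightarrow> 'u"
  adj :: "'u \<Rightarrow> 'u"
  nrm :: "'u \<Rightarrow> real"

definition unital_cstar_structure :: "'u cstar_structure \<Rightarrow> bool" where
  "unital_cstar_structure D \<longleftrightarrow>
     ring D \<and>
     (\<forall>c. \<forall>x\<in>carrier D. sc D c x \<in> carrier D) \<and>
     (\<forall>x\<in>carrier D. adj D x \<in> carrier D) \<and>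
     (\<forall>c. \<forall>x\<in>carrier D. \<forall>y\<in>carrier D.
        sc D c (x \<oplus>\<^bsub>D\<^esub> y) = sc D c x \<oplus>\<^bsub>D\<^esub> sc D c y) \<and>
     (\<forall>c d. \<forall>x\<in>carrier D. sc D (c + d) x = sc D c x \<oplus>\<^bsub>D\<^esub> sc D d x) \<and>
     (\<forall>c d. \<forall>x\<in>carrier D. sc D c (sc D d x) = sc D (c * d) x) \<and>
     (\<forall>x\<in>carrier D. sc D 1 x = x) \<and>
     (\<forall>c. \<forall>x\<in>carrier D. \<forall>y\<in>carrier D.
        sc D c x \<otimes>\<^bsub>D\<^esub> y = sc D c (x \<otimes>\<^bsub>D\<^esub> y) \<and>
        x \<otimes>\<^bsub>D\<^esub> sc D c y = sc D c (x \<otimes>\<^bsub>D\<^esub> y)) \<and>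
     (\<forall>x\<in>carrier D. \<forall>y\<in>carrier D.
        adj D (x \<oplus>\<^bsub>D\<^esub> y) = adj D x \<oplus>\<^bsub>D\<^esub> adj D y \<and>
        adj D (x \<otimes>\<^bsub>D\<^esub> y) = adj D y \<otimes>\<^bsub>D\<^esub> adj D x) \<and>
     (\<forall>c. \<forall>x\<in>carrier D. adj D (sc D c x) = sc D (cnj c) (adj D x)) \<and>
     (\<forall>x\<in>carrier D. adj D (adj D x) = x) \<and>
     (\<forall>x\<in>carrier D. nrm D x \<ge> 0 \<and> (nrm D x = 0 \<longrightarrow> x = \<zero>\<^bsub>D\<^esub>)) \<and>
     (\<forall>c. \<forall>x\<in>carrier D. nrm D (sc D c x) = cmod c * nrm D x) \<and>
     (\<forall>x\<in>carrier D. \<forall>y\<in>carrier D. nrm D (x \<oplus>\<^bsub>D\<^esub> y) \<le> nrm D x + nrm D y) \<and>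
     (\<forall>x\<in>carrier D. \<forall>y\<in>carrier D. nrm D (x \<otimes>\<^bsub>D\<^esub> y) \<le> nrm D x * nrm D y) \<and>
     (\<forall>x\<in>carrier D. nrm D (adj D x \<otimes>\<^bsub>D\<^esub> x) = (nrm D x)\<^sup>2) \<and>
     (\<forall>X. range X \<subseteq> carrier D \<and>
          (\<forall>e>0. \<exists>k. \<forall>m\<ge>k. \<forall>n\<ge>k. nrm D (X m \<ominus>\<^bsub>D\<^esub> X n) < e) \<longrightarrow>
          (\<exists>x\<in>carrier D. (\<lambda>n. nrm D (X n \<ominus>\<^bsub>D\<^esub> x)) \<longlonglongrightarrow> 0))"

definition unital_hom_into ::
  "'u cstar_structure \<Rightarrow> ('x::unital_cstar_algebra \<Rightarrow> 'u) \<Rightarrow> bool" where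
  "unital_hom_into D f \<longleftrightarrow>
     range f \<subseteq> carrier D \<and>
     (\<forall>x y. f (x + y) = f x \<oplus>\<^bsub>D\<^esub> f y) \<and>
     (\<forall>c x. f (c *\<^sub>C x) = sc D c (f x)) \<and>
     (\<forall>x y. f (x * y) = f x \<otimes>\<^bsub>D\<^esub> f y) \<and>
     (\<forall>x. f (star x) = adj D (f x)) \<and>
     f 1 = \<one>\<^bsub>D\<^esub>"

definition toeplitz_covariant_into ::
  "('a::unital_cstar_algebra \<Rightarrow> 'a) \<Rightarrow> ('a \<Rightarrow> 'a) \<Rightarrow>
   'u cstar_structure \<Rightarrow> ('a \<Rightarrow> 'u) \<Rightarrow> 'u \<Rightarrow> bool" where
  "toeplitz_covariant_into \<alpha> L D \<rho> V \<longleftrightarrow>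
     unital_hom_into D \<rho> \<and> V \<in> carrier D \<and>
     (\<forall>a. V \<otimes>\<^bsub>D\<^esub> \<rho> a = \<rho> (\<alpha> a) \<otimes>\<^bsub>D\<^esub> V) \<and>
     (\<forall>a. adj D V \<otimes>\<^bsub>D\<^esub> \<rho> a \<otimes>\<^bsub>D\<^esub> V = \<rho> (L a))"

text \<open>Targets \<open>D\<close> carried by subsets of \<open>nat \<Rightarrow> 'a\<close> suffice for universality among all unital
  C*-algebras: a representation takes values in the C*-algebra generated by its range and \<open>V\<close>,
  which has a dense subset of cardinality at most that of \<open>'a\<close> (if \<open>1 \<noteq> 0\<close> in \<open>'a\<close>; otherwise
  it is zero) and is therefore isomorphic to such a \<open>D\<close>. Uniqueness of \<open>f\<close> holds
  because \<open>i\<^sub>A\<close> and \<open>S\<close> generate.\<close>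

definition toeplitz_algebra ::
  "('a::unital_cstar_algebra \<Rightarrow> 'a) \<Rightarrow> ('a \<Rightarrow> 'a) \<Rightarrow>
   ('a \<Rightarrow> 't::unital_cstar_algebra) \<Rightarrow> 't \<Rightarrow> bool" where
  "toeplitz_algebra \<alpha> L i\<^sub>A S \<longleftrightarrow>
     toeplitz_covariant \<alpha> L i\<^sub>A S \<and>
     cstar_generated (insert S (range i\<^sub>A)) = UNIV \<and>
     (\<forall>(D :: (nat \<Rightarrow> 'a) cstar_structure) \<rho> V.
        unital_cstar_structure D \<and> toeplitz_covariant_into \<alpha> L D \<rho> V \<longrightarrow>
        (\<exists>f. unital_hom_into D f \<and> f \<circ> i\<^sub>A = \<rho> \<and> f S = V))"

section \<open>The bimodule\<close>

record (overloaded) ('a, 'm) bimodule =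
  quo :: "'a \<Rightarrow> 'm"
  ract :: "'m \<Rightarrow> 'a \<Rightarrow> 'm"
  ip :: "'m \<Rightarrow> 'm \<Rightarrow> 'a"
  lact :: "'a \<Rightarrow> 'm \<Rightarrow>\<^sub>L 'm"

definition hilbert_module ::
  "('a::unital_cstar_algebra, 'm::complex_banach) bimodule \<Rightarrow> bool" where
  "hilbert_module M \<longleftrightarrow>
     (\<forall>a. clinear (\<lambda>x. ract M x a)) \<and> (\<forall>x. clinear (ract M x)) \<and>
     (\<forall>x a b. ract M x (a * b) = ract M (ract M x a) b) \<and>
     (\<forall>x. clinear (ip M x)) \<and>
     (\<forall>x y a. ip M x (ract M y a) = ip M x y * a) \<and>
     (\<forall>x y. star (ip M x y) = ip M y x) \<and>
     (\<forall>x. positive (ip M x x)) \<and> (\<forall>x. ip M x x = 0 \<longrightarrow> x = 0) \<and>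
     (\<forall>x. norm x = sqrt (norm (ip M x x)))"

definition adjoint_of ::
  "('a::unital_cstar_algebra, 'm::complex_banach) bimodule \<Rightarrow>
   ('m \<Rightarrow>\<^sub>L 'm) \<Rightarrow> ('m \<Rightarrow>\<^sub>L 'm) \<Rightarrow> bool" where
  "adjoint_of M k k' \<longleftrightarrow> (\<forall>x y. ip M (k x) y = ip M x (k' y))"

text \<open>\<open>M\<close> is the bimodule \<open>M\<^sub>L\<close>; its underlying Banach space, the completion of \<open>A\<^sub>L/N\<close>, is a type,
  and \<open>quo M\<close> is the quotient map followed by the inclusion of \<open>A\<^sub>L/N\<close> in the completion.\<close>

definition exel_bimodule ::
  "('a::unital_cstar_algebra \<Rightarrow> 'a) \<Rightarrow> ('a \<Rightarrow> 'a) \<Rightarrow>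
   ('a, 'm::complex_banach) bimodule \<Rightarrow> bool" where
  "exel_bimodule \<alpha> L M \<longleftrightarrow>
     hilbert_module M \<and>
     clinear (quo M) \<and> {a. quo M a = 0} = {a. L (star a * a) = 0} \<and>
     closure (range (quo M)) = UNIV \<and>
     (\<forall>m a. ract M (quo M m) a = quo M (m * \<alpha> a)) \<and>
     (\<forall>m n. ip M (quo M m) (quo M n) = L (star m * n)) \<and>
     (\<forall>a. \<exists>k. adjoint_of M (lact M a) k) \<and>
     (\<forall>a b. lact M a (quo M b) = quo M (a * b))"

definition theta ::
  "('a::unital_cstar_algebra, 'm::complex_banach) bimodule \<Rightarrow> 'm \<Rightarrow> 'm \<Rightarrow> 'm \<Rightarrow>\<^sub>L 'm" where
  "theta M x y = Blinfun (\<lambda>z. ract M x (ip M y z))"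

text \<open>The real span is the complex span here, since scalars can be moved into \<open>x\<close>. The same
  holds for the two spans of products below.\<close>

definition compacts ::
  "('a::unital_cstar_algebra, 'm::complex_banach) bimodule \<Rightarrow> ('m \<Rightarrow>\<^sub>L 'm) set" where
  "compacts M = closure (span {theta M x y | x y. True})"

definition alpha_ideal :: "('a::unital_cstar_algebra \<Rightarrow> 'a) \<Rightarrow> 'a set" where
  "alpha_ideal \<alpha> = closure (span {a * \<alpha> b * c | a b c. True})"

definition J_ideal :: "('a::unital_cstar_algebra, 'm::complex_banach) bimodule \<Rightarrow> 'a set" where
  "J_ideal M = {a. lact M a \<in> compacts M}"

definition K_alpha ::
  "('a::unital_cstar_algebra \<Rightarrow> 'a) \<Rightarrow> ('a, 'm::complex_banach) bimodule \<Rightarrow> 'a set" where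
  "K_alpha \<alpha> M = alpha_ideal \<alpha> \<inter> J_ideal M"

section \<open>Covariant representations\<close>

definition psi ::
  "('a::unital_cstar_algebra, 'm::complex_banach) bimodule \<Rightarrow>
   ('a \<Rightarrow> 'b::unital_cstar_algebra) \<Rightarrow> 'b \<Rightarrow> 'm \<Rightarrow> 'b" where
  "psi M \<rho> V =
     (THE \<psi>. bounded_linear \<psi> \<and> clinear \<psi> \<and> (\<forall>a. \<psi> (quo M a) = \<rho> a * V))"

text \<open>\<open>\<kappa>\<close> is the homomorphism \<open>(\<psi>,\<pi>)\<^sup>(\<^sup>1\<^sup>)\<close>, which depends on \<open>\<psi>\<close> only. Continuity is automatic
  for a *-homomorphism of C*-algebras. The third and fifth clauses are complex homogeneity and
  *-preservation, \<open>'m \<Rightarrow>\<^sub>L 'm\<close> having no complex scalar multiplication or adjoint of its own.\<close>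

definition is_induced_hom ::
  "('a::unital_cstar_algebra, 'm::complex_banach) bimodule \<Rightarrow>
   ('m \<Rightarrow> 'b::unital_cstar_algebra) \<Rightarrow> (('m \<Rightarrow>\<^sub>L 'm) \<Rightarrow> 'b) \<Rightarrow> bool" where
  "is_induced_hom M \<psi> \<kappa> \<longleftrightarrow>
     continuous_on (compacts M) \<kappa> \<and>
     (\<forall>k\<in>compacts M. \<forall>l\<in>compacts M. \<kappa> (k + l) = \<kappa> k + \<kappa> l) \<and>
     (\<forall>c. \<forall>k\<in>compacts M. \<forall>l\<in>compacts M. (\<forall>x. blinfun_apply l x = c *\<^sub>C blinfun_apply k x) \<longrightarrow> \<kappa> l = c *\<^sub>C \<kappa> k) \<and>
     (\<forall>k\<in>compacts M. \<forall>l\<in>compacts M. \<kappa> (k o\<^sub>L l) = \<kappa> k * \<kappa> l) \<and>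
     (\<forall>k\<in>compacts M. \<forall>l\<in>compacts M. adjoint_of M k l \<longrightarrow> \<kappa> l = star (\<kappa> k)) \<and>
     (\<forall>x y. \<kappa> (theta M x y) = \<psi> x * star (\<psi> y))"

text \<open>The conditions determine the homomorphism on \<open>compacts M\<close> only, hence \<open>SOME\<close>.\<close>

definition induced_hom ::
  "('a::unital_cstar_algebra, 'm::complex_banach) bimodule \<Rightarrow>
   ('m \<Rightarrow> 'b::unital_cstar_algebra) \<Rightarrow> ('m \<Rightarrow>\<^sub>L 'm) \<Rightarrow> 'b" where
  "induced_hom M \<psi> = (SOME \<kappa>. is_induced_hom M \<psi> \<kappa>)"

definition covariant_representation ::
  "('a::unital_cstar_algebra \<Rightarrow> 'a) \<Rightarrow> ('a \<Rightarrow> 'a) \<Rightarrow> ('a, 'm::complex_banach) bimodule \<Rightarrow>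
   ('a \<Rightarrow> 'b::unital_cstar_algebra) \<Rightarrow> 'b \<Rightarrow> bool" where
  "covariant_representation \<alpha> L M \<rho> V \<longleftrightarrow>
     toeplitz_covariant \<alpha> L \<rho> V \<and>
     (\<forall>a\<in>K_alpha \<alpha> M. \<rho> a = induced_hom M (psi M \<rho> V) (lact M a))"

section \<open>Exel's crossed product\<close>

definition redundancy ::
  "('a::unital_cstar_algebra \<Rightarrow> 't::unital_cstar_algebra) \<Rightarrow> 't \<Rightarrow> 'a \<Rightarrow> 't \<Rightarrow> bool" where
  "redundancy i\<^sub>A S a k \<longleftrightarrow>
     k \<in> closure (span {i\<^sub>A b * S * star S * i\<^sub>A c | b c. True}) \<and>
     (\<forall>b. i\<^sub>A a * i\<^sub>A b * S = k * i\<^sub>A b * S)"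

definition redundancy_ideal ::
  "('a::unital_cstar_algebra \<Rightarrow> 'a) \<Rightarrow> ('a \<Rightarrow> 't::unital_cstar_algebra) \<Rightarrow> 't \<Rightarrow> 't set" where
  "redundancy_ideal \<alpha> i\<^sub>A S =
     ideal_generated {i\<^sub>A a - k | a k. redundancy i\<^sub>A S a k \<and> a \<in> alpha_ideal \<alpha>}"

definition crossed_product ::
  "('a::unital_cstar_algebra \<Rightarrow> 'a) \<Rightarrow> ('a \<Rightarrow> 'a) \<Rightarrow> ('a \<Rightarrow> 't::unital_cstar_algebra) \<Rightarrow> 't \<Rightarrow>
   ('t \<Rightarrow> 'c::unital_cstar_algebra) \<Rightarrow> bool" where
  "crossed_product \<alpha> L i\<^sub>A S Q \<longleftrightarrow>
     toeplitz_algebra \<alpha> L i\<^sub>A S \<and> cstar_quotient_map Q (redundancy_ideal \<alpha> i\<^sub>A S)"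

definition gauge_action ::
  "('a \<Rightarrow> 'c::unital_cstar_algebra) \<Rightarrow> 'c \<Rightarrow> (complex \<Rightarrow> 'c \<Rightarrow> 'c) \<Rightarrow> bool" where
  "gauge_action j\<^sub>A T \<delta> \<longleftrightarrow>
     circle_action UNIV \<delta> \<and>
     (\<forall>z\<in>sphere 0 1. (\<forall>a. \<delta> z (j\<^sub>A a) = j\<^sub>A a) \<and> \<delta> z T = z *\<^sub>C T)"

end

theory Submission
  imports Defs
begin

text \<open>Write \<open>B\<^sub>k\<close> for the closed span of the elements \<open>j(a)T\<^sup>kT\<^sup>*\<^sup>kj(b)\<close>. First \<open>\<tau>\<close> is shown to be
  injective on the closure of \<open>B\<^sub>0 + \<dots> + B\<^sub>m\<close>, by induction on \<open>m\<close>. If \<open>\<tau>(x) = 0\<close>, then all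
  compressions \<open>T\<^sup>*j(b)xj(c)T\<close> lie one step lower and vanish, so \<open>x\<close> is annihilated by the ideal
  \<open>Y\<close> generated by \<open>B\<^sub>1, \<dots>, B\<^sub>m\<close>; it remains to see that \<open>x \<in> Y\<close>. Modulo \<open>Y\<close> the element \<open>x\<close> comes
  from \<open>A\<close>, and if \<open>\<rho>(a) \<in> \<tau>(Y)\<close>, then an approximate unit of \<open>B\<^sub>1\<close> gives \<open>\<rho>(a) \<in> \<tau>(B\<^sub>1)\<close>, which is
  the range of the homomorphism induced on the compact operators. Hence \<open>j(a) \<in> j(K\<^sub>\<alpha>) \<subseteq> B\<^sub>1\<close> by
  hypothesis (2) and covariance.

  The hypothesis on \<open>\<beta>\<close> bounds the homogeneous components of an element of degree at most \<open>N\<close> by a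
  multiple of the norm of its image, which gives \<open>\<parallel>c\<parallel> \<le> C(N + 1)\<parallel>\<tau>(c)\<parallel>\<close>. Applying this to the powers
  of \<open>c\<^sup>*c\<close> removes the constant. The same power argument, with \<open>x(1 + (x\<^sup>*x)\<^sup>2)\<^sup>-\<^sup>1\<close> as a bounded
  approximate lift, replaces spectral theory throughout.\<close>

section \<open>Closed subspaces\<close>

text \<open>The C*-identity is the main analytic tool, so a first estimate usually carries a
  constant (3, 4, 6, 30 below). Most of these numbers mean nothing: under x -> (star x * x)^(2^n)
  the norms are raised to powers while the constant stays fixed, or grows linearly with the exponent
  as it does for averages over the circle, and it disappears in the limit. The resolvent (1 +
  h^2)^-1, found by a fixed-point argument, does the work of a cut-off function. The second obstacle
  is closedness. Images of ideals and the range of the induced homomorphism are not closed a priori,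
  and small distance to an ideal is not membership. Distances to subspaces therefore serve as
  quotient seminorms, \<open>cstar_lift\<close> corrects an element by one of controlled norm so
  that the distance becomes exactly 0, and maps given on dense subspaces are handled as closures of
  graphs. Elements of the dense *-subalgebra have finitely many degrees, so finite averages over
  roots of unity take the place of integrals over the circle.\<close>

lemma eq_if_eq_on_dense:
  fixes f g :: "'x::topological_space \<Rightarrow> 'y::t2_space"
  assumes "closure S = UNIV" "continuous_on UNIV f" "continuous_on UNIV g" "\<And>x. x \<in> S \<Longrightarrow> f x = g x"
  shows "f x = g x"
proof -
  have "closed {x. f x = g x}" using assms by (intro closed_Collect_eq)
  then have "closure S \<subseteq> {x. f x = g x}" using assms by (intro closure_minimal) auto
  then show ?thesis using assms(1) by auto
qed

lemma closure_span_subset: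
  assumes "closed X" "subspace X" "S \<subseteq> X"
  shows "closure (span S) \<subseteq> X"
  by (intro closure_minimal span_minimal assms)

lemma subspace_closure:
  fixes S :: "'x::real_normed_vector set"
  assumes "subspace S"
  shows "subspace (closure S)"
proof (rule subspaceI)
  show "0 \<in> closure S" using subspace_0[OF assms] closure_subset by blast
  fix x y assume "x \<in> closure S" "y \<in> closure S"
  then obtain X Y where *: "\<And>n. X n \<in> S" "X \<longlonglongrightarrow> x" "\<And>n. Y n \<in> S" "Y \<longlonglongrightarrow> y"
    unfolding closure_sequential by blast
  then show "x + y \<in> closure S" unfolding closure_sequential
    by (intro exI[of _ "\<lambda>n. X n + Y n"]) (auto intro: tendsto_add subspace_add[OF assms])
next
  fix c x assume "x \<in> closure S"
  then obtain X where *: "\<And>n. X n \<in> S" "X \<longlonglongrightarrow> x" unfolding closure_sequential by blast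
  then show "c *\<^sub>R x \<in> closure S" unfolding closure_sequential
    by (intro exI[of _ "\<lambda>n. c *\<^sub>R X n"]) (auto intro: tendsto_scaleR subspace_scale[OF assms])
qed

lemma closed_subspace_vimage:
  assumes "bounded_linear f" "closed Z" "subspace Z"
  shows "closed (f -` Z)" "subspace (f -` Z)"
proof -
  interpret bounded_linear f by fact
  show "closed (f -` Z)" using assms(2) by (intro closed_vimage continuous_on continuous_on_id)
  show "subspace (f -` Z)"
    using assms(3) by (auto simp: subspace_def zero add scaleR)
qed

lemma bounded_linear_closure_span:
  assumes "bounded_linear f" "closed Z" "subspace Z" "\<And>x. x \<in> S \<Longrightarrow> f x \<in> Z" "x \<in> closure (span S)"
  shows "f x \<in> Z"
proof -
  have "closure (span S) \<subseteq> f -` Z"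
    by (intro closure_span_subset closed_subspace_vimage assms) (use assms(4) in auto)
  then show ?thesis using assms(5) by auto
qed

lemma bounded_bilinear_closure_span:
  assumes "\<And>y. bounded_linear (\<lambda>x. b x y)" "\<And>x. bounded_linear (b x)" "closed Z" "subspace Z"
    "\<And>x y. x \<in> S \<Longrightarrow> y \<in> T \<Longrightarrow> b x y \<in> Z" "x \<in> closure (span S)" "y \<in> closure (span T)"
  shows "b x y \<in> Z"
proof (rule bounded_linear_closure_span[OF assms(2,3,4) _ assms(7)])
  fix y assume y: "y \<in> T"
  show "b x y \<in> Z"
    by (rule bounded_linear_closure_span[OF assms(1,3,4) _ assms(6)]) (use assms(5) y in auto)
qed

text \<open>With the next two lemmas this extends a bounded map from a dense subspace. The map is
  stored as its graph \<open>G\<close>: the bound forces \<open>d = 0\<close> whenever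
  \<open>(0, d) \<in> closure G\<close>, so well-definedness comes with the estimate. Both
  \<open>psi\<close> and the homomorphism on \<open>compacts M\<close> are obtained in this
  way.\<close>

lemma graph_closure_bound:
  fixes G :: "('e::real_normed_vector \<times> 'f::real_normed_vector) set"
  assumes "\<And>x z. (x, z) \<in> G \<Longrightarrow> norm z \<le> K * norm x" "(x, z) \<in> closure G"
  shows "norm z \<le> K * norm x"
proof -
  have "closed {p::'e \<times> 'f. norm (snd p) \<le> K * norm (fst p)}"
    by (intro closed_Collect_le continuous_intros)
  then have "closure G \<subseteq> {p. norm (snd p) \<le> K * norm (fst p)}"
    using assms(1) by (intro closure_minimal) auto
  then show ?thesis using assms(2) by auto
qed

lemma graph_closure_unique:
  fixes G :: "('e::real_normed_vector \<times> 'f::real_normed_vector) set"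
  assumes "subspace G" "\<And>x z. (x, z) \<in> G \<Longrightarrow> norm z \<le> K * norm x"
    "(x, z) \<in> closure G" "(x, z') \<in> closure G"
  shows "z = z'"
proof -
  have "(x, z) - (x, z') \<in> closure G"
    using assms by (intro subspace_diff subspace_closure)
  then have "(0, z - z') \<in> closure G" by simp
  from graph_closure_bound[OF assms(2) this] show ?thesis by simp
qed

lemma graph_closure_total:
  fixes G :: "('e::real_normed_vector \<times> 'f::banach) set"
  assumes G: "subspace G" and K: "K \<ge> 0" "\<And>x z. (x, z) \<in> G \<Longrightarrow> norm z \<le> K * norm x"
    and x: "x \<in> closure (fst ` G)"
  shows "\<exists>z. (x, z) \<in> closure G"
proof -
  obtain X where X: "\<And>n. X n \<in> fst ` G" "X \<longlonglongrightarrow> x"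
    using x unfolding closure_sequential by blast
  then have "\<forall>n. \<exists>z. (X n, z) \<in> G" by force
  then obtain Z where Z: "\<And>n. (X n, Z n) \<in> G" by metis
  have d: "norm (Z m - Z n) \<le> K * norm (X m - X n)" for m n
    using subspace_diff[OF G Z[of m] Z[of n]] K(2) by simp
  have "Cauchy Z"
  proof (rule CauchyI)
    fix e :: real assume e: "e > 0"
    have "Cauchy X" using X(2) LIMSEQ_imp_Cauchy by blast
    then obtain N where N: "\<And>m n. m \<ge> N \<Longrightarrow> n \<ge> N \<Longrightarrow> norm (X m - X n) < e / (K + 1)"
      using CauchyD[of X "e / (K + 1)"] e K(1) by (auto simp: divide_pos_pos add_nonneg_pos)
    have "norm (Z m - Z n) < e" if "m \<ge> N" "n \<ge> N" for m n
    proof -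
      have "norm (Z m - Z n) \<le> K * norm (X m - X n)" by (rule d)
      also have "\<dots> \<le> (K + 1) * norm (X m - X n)" by (intro mult_right_mono) auto
      also have "\<dots> < e" using N[OF that] K(1) by (simp add: field_simps)
      finally show ?thesis .
    qed
    then show "\<exists>M. \<forall>m\<ge>M. \<forall>n\<ge>M. norm (Z m - Z n) < e" by blast
  qed
  then obtain z where "Z \<longlonglongrightarrow> z" using Cauchy_convergent convergent_def by blast
  then have "(\<lambda>n. (X n, Z n)) \<longlonglongrightarrow> (x, z)" using X(2) by (intro tendsto_Pair)
  then have "(x, z) \<in> closure G" unfolding closure_sequential
    using Z by (intro exI[of _ "\<lambda>n. (X n, Z n)"]) simp
  then show ?thesis by blast
qed

section \<open>Distance to a subspace as a quotient seminorm\<close>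

lemma infdist_approx:
  assumes "S \<noteq> {}" "e > 0"
  obtains s where "s \<in> S" "dist x s < infdist x S + e"
proof -
  have "Inf (dist x ` S) < infdist x S + e" using assms by (simp add: infdist_def)
  then show thesis using cInf_lessD[of "dist x ` S"] assms(1) that by blast
qed

text \<open>This lemma and the next two, with \<open>infdist_star\<close>, verify the hypotheses of
  \<open>cstar_lift\<close> for the norm modulo \<open>S\<close> without forming a quotient
  algebra.\<close>

lemma infdist_add_le:
  fixes S :: "'x::real_normed_vector set"
  assumes "subspace S"
  shows "infdist (x + y) S \<le> infdist x S + infdist y S"
proof (rule field_le_epsilon)
  fix e :: real assume "e > 0"
  have ne: "S \<noteq> {}" using subspace_0[OF assms] by blast
  obtain s where s: "s \<in> S" "dist x s < infdist x S + e / 2"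
    using infdist_approx[of S "e / 2" x] ne \<open>e > 0\<close> by auto
  obtain t where t: "t \<in> S" "dist y t < infdist y S + e / 2"
    using infdist_approx[of S "e / 2" y] ne \<open>e > 0\<close> by auto
  have "infdist (x + y) S \<le> dist (x + y) (s + t)" by (intro infdist_le subspace_add assms s t)
  also have "\<dots> \<le> dist x s + dist y t" by (rule dist_triangle_add)
  finally show "infdist (x + y) S \<le> infdist x S + infdist y S + e" using s t by simp
qed

lemma infdist_scaleR:
  fixes S :: "'x::real_normed_vector set"
  assumes "subspace S"
  shows "infdist (c *\<^sub>R x) S = \<bar>c\<bar> * infdist x S"
proof (cases "c = 0")
  case True
  then show ?thesis using subspace_0[OF assms] by simp
next
  case False
  have le: "infdist (c *\<^sub>R x) S \<le> \<bar>c\<bar> * infdist x S" if "c \<noteq> 0" for c x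
  proof -
    have "infdist (c *\<^sub>R x) S / \<bar>c\<bar> \<le> infdist x S"
    proof (rule field_le_epsilon)
      fix e :: real assume "e > 0"
      have ne: "S \<noteq> {}" using subspace_0[OF assms] by blast
      obtain s where s: "s \<in> S" "dist x s < infdist x S + e"
        using infdist_approx[of S "e" x] ne \<open>e > 0\<close> by auto
      have "infdist (c *\<^sub>R x) S \<le> dist (c *\<^sub>R x) (c *\<^sub>R s)" by (intro infdist_le subspace_scale assms s)
      also have "\<dots> = \<bar>c\<bar> * dist x s" by (simp add: dist_norm scaleR_diff_right[symmetric])
      finally show "infdist (c *\<^sub>R x) S / \<bar>c\<bar> \<le> infdist x S + e"
        using s(2) that by (simp add: divide_le_eq mult.commute) (smt (verit) mult_left_mono abs_ge_zero)
    qed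
    then show ?thesis using that by (simp add: divide_le_eq mult.commute)
  qed
  have "infdist x S \<le> \<bar>1 / c\<bar> * infdist (c *\<^sub>R x) S" using le[of "1 / c" "c *\<^sub>R x"] False by simp
  then have "\<bar>c\<bar> * infdist x S \<le> infdist (c *\<^sub>R x) S" using False by (simp add: field_simps)
  then show ?thesis using le[OF False, of x] by simp
qed

text \<open>\<open>(x - s) * (y - t)\<close> differs from \<open>x * y\<close> by
  \<open>x * t + s * y - s * t\<close>, which lies in \<open>S\<close>. Distances need not be
  attained, hence the limit in \<open>e\<close>.\<close>

lemma infdist_mult_le:
  fixes S :: "'x::real_normed_algebra set"
  assumes S: "subspace S" and ST: "\<And>s t. s \<in> S \<Longrightarrow> t \<in> S \<Longrightarrow> s * t \<in> S"
    "\<And>s. s \<in> S \<Longrightarrow> x * s \<in> S" "\<And>s. s \<in> S \<Longrightarrow> s * y \<in> S"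
  shows "infdist (x * y) S \<le> infdist x S * infdist y S"
proof -
  let ?g = "\<lambda>e. (infdist x S + e) * (infdist y S + e)"
  have "infdist (x * y) S \<le> ?g e" if "0 < e" for e :: real
  proof -
    have ne: "S \<noteq> {}" using subspace_0[OF S] by blast
    obtain s where s: "s \<in> S" "dist x s < infdist x S + e"
      using infdist_approx[of S "e" x] ne \<open>e > 0\<close> by auto
    obtain t where t: "t \<in> S" "dist y t < infdist y S + e"
      using infdist_approx[of S "e" y] ne \<open>e > 0\<close> by auto
    have "infdist (x * y) S \<le> dist (x * y) (x * t + s * y - s * t)"
      using S s t ST by (intro infdist_le subspace_diff subspace_add) auto
    also have "\<dots> = norm ((x - s) * (y - t))" by (simp add: dist_norm algebra_simps)
    also have "\<dots> \<le> norm (x - s) * norm (y - t)" by (rule norm_mult_ineq)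
    also have "\<dots> \<le> ?g e" using s t that by (intro mult_mono) (auto simp: dist_norm infdist_nonneg add_nonneg_nonneg)
    finally show ?thesis .
  qed
  then have ev: "\<forall>\<^sub>F e in at_right 0. infdist (x * y) S \<le> ?g e"
    by (auto intro!: eventually_at_right_less[THEN eventually_mono])
  have "(?g \<longlongrightarrow> (infdist x S + 0) * (infdist y S + 0)) (at_right 0)"
    by (intro tendsto_intros)
  from tendsto_lowerbound[OF this ev] show ?thesis by simp
qed

section \<open>C*-algebras\<close>

lemma scaleC_zero_left [simp]: "0 *\<^sub>C x = (0::'x::complex_banach)"
  using scaleC_of_real[of 0 x] by simp

lemma scaleC_one [simp]: "1 *\<^sub>C x = (x::'x::complex_banach)"
  using scaleC_of_real[of 1 x] by simp

lemma scaleC_zero_right [simp]: "c *\<^sub>C 0 = (0::'x::complex_banach)"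
  by (metis norm_scaleC norm_zero mult_zero_right norm_eq_zero)

lemma scaleC_minus_right: "c *\<^sub>C (- x) = - (c *\<^sub>C (x::'x::complex_banach))"
  using scaleC_add_right[of c x "- x"] by (simp add: eq_neg_iff_add_eq_0 add.commute)

lemma scaleC_minus_left: "(- c) *\<^sub>C x = - (c *\<^sub>C (x::'x::complex_banach))"
  using scaleC_add_left[of c "- c" x] by (simp add: eq_neg_iff_add_eq_0 add.commute)

lemma scaleC_diff_right: "c *\<^sub>C (x - y) = c *\<^sub>C x - c *\<^sub>C (y::'x::complex_banach)"
  using scaleC_add_right[of c x "- y"] by (simp add: scaleC_minus_right)

lemma scaleC_scaleR_commute: "c *\<^sub>C (r *\<^sub>R x) = r *\<^sub>R (c *\<^sub>C (x::'x::complex_banach))"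
  by (simp add: scaleC_of_real[symmetric] scaleC_scaleC mult.commute)

lemma scaleC_sum_right: "c *\<^sub>C (\<Sum>i\<in>I. f i) = (\<Sum>i\<in>I. c *\<^sub>C (f i :: 'x::complex_banach))"
  by (induction I rule: infinite_finite_induct) (simp_all add: scaleC_add_right)

lemma scaleC_sum_left: "(\<Sum>i\<in>I. f i) *\<^sub>C x = (\<Sum>i\<in>I. f i *\<^sub>C (x :: 'x::complex_banach))"
  by (induction I rule: infinite_finite_induct) (simp_all add: scaleC_add_left)

lemma bounded_linear_scaleC: "bounded_linear (\<lambda>x::'x::complex_banach. c *\<^sub>C x)"
  by (rule bounded_linear_intro[where K = "cmod c"])
    (simp_all add: scaleC_add_right scaleC_scaleR_commute norm_scaleC mult.commute)

lemma clinear_linear: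
  assumes "clinear f"
  shows "linear f"
proof (rule linearI)
  fix r x
  show "f (r *\<^sub>R x) = r *\<^sub>R f x"
    using assms unfolding clinear_def by (metis scaleC_of_real)
qed (use assms in \<open>simp add: clinear_def\<close>)

lemma star_zero [simp]: "star 0 = (0::'x::unital_cstar_algebra)"
  by (metis add_cancel_right_right star_add)

lemma star_minus: "star (- x) = - star (x::'x::unital_cstar_algebra)"
  by (metis add.right_inverse minus_unique star_add star_zero)

lemma star_diff: "star (x - y) = star x - star (y::'x::unital_cstar_algebra)"
  by (metis add_uminus_conv_diff star_add star_minus)

lemma star_one [simp]: "star 1 = (1::'x::unital_cstar_algebra)"
  by (metis mult_1_right star_mult star_star)

lemma star_scaleR: "star (r *\<^sub>R x) = r *\<^sub>R star (x::'x::unital_cstar_algebra)"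
  by (metis complex_cnj_complex_of_real scaleC_of_real star_scaleC)

lemma star_power: "star (x ^ n) = star (x::'x::unital_cstar_algebra) ^ n"
  by (induction n) (simp_all add: star_mult power_commutes)

lemma norm_star [simp]: "norm (star x) = norm (x::'x::unital_cstar_algebra)"
proof -
  have *: "norm y \<le> norm (star y)" for y :: 'x
  proof (cases "y = 0")
    case False
    have "norm y * norm y \<le> norm (star y) * norm y"
      using norm_mult_ineq[of "star y" y] cstar_identity[of y] by (simp add: power2_eq_square)
    then show ?thesis using False by simp
  qed simp
  show ?thesis using *[of x] *[of "star x"] by (simp add: star_star)
qed

lemma norm_one_le: "norm (1::'x::unital_cstar_algebra) \<le> 1"
proof -
  have "norm (1::'x) * norm (1::'x) = norm (1::'x)"
    using cstar_identity[of "1::'x"] by (simp add: power2_eq_square)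
  then show ?thesis by (metis mult_cancel_right2 order.refl zero_le_one)
qed

lemma bounded_linear_star: "bounded_linear (star :: 'x::unital_cstar_algebra \<Rightarrow> 'x)"
  by (rule bounded_linear_intro[where K = 1]) (simp_all add: star_add star_scaleR)

lemma star_mult_self_eq_zero: "star x * x = 0 \<longleftrightarrow> (x::'x::unital_cstar_algebra) = 0"
  by (metis cstar_identity mult_zero_right norm_eq_zero power2_eq_square mult_eq_0_iff)

lemma infdist_star:
  fixes S :: "'x::unital_cstar_algebra set"
  assumes "\<And>s. s \<in> S \<Longrightarrow> star s \<in> S" "S \<noteq> {}"
  shows "infdist (star x) S = infdist x S"
proof -
  have "infdist (star x) S \<le> infdist x S" for x
  proof (rule field_le_epsilon)
    fix e :: real assume "e > 0"
    note ne = assms(2)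
    obtain s where s: "s \<in> S" "dist x s < infdist x S + e"
      using infdist_approx[of S "e" x] ne \<open>e > 0\<close> by auto
    have "infdist (star x) S \<le> dist (star x) (star s)" by (intro infdist_le assms s)
    also have "\<dots> = dist x s" by (simp add: dist_norm star_diff[symmetric])
    finally show "infdist (star x) S \<le> infdist x S + e" using s by simp
  qed
  from this[of x] this[of "star x"] show ?thesis by (simp add: star_star)
qed

text \<open>Iterating the C*-identity along powers of two replaces the spectral radius
  formula.\<close>

lemma norm_power_two_power_selfadjoint:
  fixes h :: "'x::unital_cstar_algebra"
  assumes "star h = h"
  shows "norm (h ^ (2 ^ n)) = norm h ^ (2 ^ n)"
proof (induction n)
  case (Suc n)
  have "h ^ (2 ^ Suc n) = star (h ^ (2 ^ n)) * h ^ (2 ^ n)"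
    by (simp add: star_power assms power_add[symmetric] mult_2)
  then show ?case
    using Suc by (simp add: cstar_identity power_mult[symmetric] mult.commute)
qed simp

lemma norm_power_two_power_star_mult:
  fixes x :: "'x::unital_cstar_algebra"
  shows "norm ((star x * x) ^ (2 ^ n)) = (norm x)\<^sup>2 ^ (2 ^ n)"
  by (simp add: norm_power_two_power_selfadjoint star_mult star_star cstar_identity)

text \<open>Together with the previous lemma this turns estimates with constants that grow slowly
  under taking powers into contractivity.\<close>

lemma le_if_power_two_power_le:
  fixes a b :: real
  assumes "0 \<le> a" "0 \<le> b" and le: "\<And>n::nat. a ^ (2 ^ n) \<le> (A * 2 ^ n + B) * b ^ (2 ^ n)"
  shows "a \<le> b"
proof (rule ccontr)
  assume "\<not> a \<le> b"
  then have a: "a > 0" "b < a" using assms by auto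
  define x where "x = b / a"
  have x: "0 \<le> x" "x < 1" using a assms by (auto simp: x_def)
  have one: "1 \<le> A * (real (2 ^ n) * x ^ (2 ^ n)) + B * x ^ (2 ^ n)" for n
  proof -
    have "a ^ (2 ^ n) * 1 \<le> a ^ (2 ^ n) * (A * (real (2 ^ n) * x ^ (2 ^ n)) + B * x ^ (2 ^ n))"
    proof -
      have "a ^ (2 ^ n) * x ^ (2 ^ n) = b ^ (2 ^ n)" using a by (simp add: x_def power_divide)
      then have "a ^ (2 ^ n) * (A * (real (2 ^ n) * x ^ (2 ^ n)) + B * x ^ (2 ^ n)) = (A * 2 ^ n + B) * b ^ (2 ^ n)"
        by (simp add: algebra_simps)
      then show ?thesis using le[of n] by simp
    qed
    then show ?thesis using a by (simp only: mult_le_cancel_left_pos zero_less_power)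
  qed
  \<comment> \<open>\<open>N * x ^ N\<close> and \<open>x ^ N\<close> tend to 0 for
    \<open>x < 1\<close>; this is used along \<open>N = 2 ^ n\<close>.\<close>
  have sub: "filterlim (\<lambda>n::nat. 2 ^ n :: nat) sequentially sequentially"
    by (rule filterlim_subseq) (simp add: strict_mono_def)
  have "(\<lambda>n. real n * x ^ n) \<longlonglongrightarrow> 0" using powser_times_n_limit_0[of x] x by simp
  from filterlim_compose[OF this sub] have l1: "(\<lambda>n. real (2 ^ n) * x ^ (2 ^ n)) \<longlonglongrightarrow> 0" .
  have "(\<lambda>n. x ^ n) \<longlonglongrightarrow> 0" using x by (simp add: LIMSEQ_power_zero)
  from filterlim_compose[OF this sub] have l2: "(\<lambda>n. x ^ (2 ^ n)) \<longlonglongrightarrow> 0" .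
  have "(\<lambda>n. A * (real (2 ^ n) * x ^ (2 ^ n)) + B * x ^ (2 ^ n)) \<longlonglongrightarrow> A * 0 + B * 0"
    by (intro tendsto_intros l1 l2)
  then have "1 \<le> A * 0 + B * (0::real)"
    by (rule LIMSEQ_le_const) (use one in auto)
  then show False by simp
qed

subsection \<open>Square roots and contractivity of homomorphisms\<close>

text \<open>Iteration for \<open>2 q = x + q * q\<close>, equivalently
  \<open>(1 - q)^2 = 1 - x\<close>. The iterates are polynomials in \<open>x\<close> with
  nonnegative coefficients and no constant term, so the case \<open>x = 1\<close> majorises every
  \<open>x\<close> of norm at most 1.\<close>

fun sqrt_step :: "'x::real_normed_algebra \<Rightarrow> nat \<Rightarrow> 'x" where
  "sqrt_step x 0 = 0"
| "sqrt_step x (Suc n) = (1/2) *\<^sub>R (x + sqrt_step x n * sqrt_step x n)"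

lemma sqrt_step_commute:
  assumes "y * x = x * y"
  shows "y * sqrt_step x n = sqrt_step x n * y"
proof (induction n)
  case (Suc n)
  have "y * (sqrt_step x n * sqrt_step x n) = sqrt_step x n * sqrt_step x n * y"
    by (metis Suc mult.assoc)
  then show ?case using assms by (simp add: distrib_left distrib_right)
qed simp

lemma sqrt_step_real:
  "0 \<le> sqrt_step (1::real) n \<and> sqrt_step (1::real) n \<le> 1"
proof (induction n)
  case (Suc n)
  then have "sqrt_step (1::real) n * sqrt_step (1::real) n \<le> 1" by (intro mult_le_one) auto
  with Suc show ?case by simp
qed simp

text \<open>Both estimates are proved together: the next difference is half a difference of squares,
  whose factorization needs commutation and whose second factor needs the norm bounds.\<close>

lemma sqrt_step_bounds:
  fixes x :: "'x::real_normed_algebra"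
  assumes "norm x \<le> 1"
  shows "norm (sqrt_step x n) \<le> sqrt_step (1::real) n \<and>
    norm (sqrt_step x (Suc n) - sqrt_step x n) \<le> sqrt_step (1::real) (Suc n) - sqrt_step 1 n"
proof (induction n)
  case 0
  then show ?case using assms by simp
next
  case (Suc n)
  let ?q = "sqrt_step x" and ?t = "sqrt_step (1::real)"
  have c: "?q (Suc n) * ?q n = ?q n * ?q (Suc n)"
    by (rule sqrt_step_commute, rule sqrt_step_commute[symmetric], simp)
  have 1: "norm (?q (Suc n)) \<le> ?t (Suc n)"
  proof -
    have "norm (?q n * ?q n) \<le> ?t n * ?t n"
      using Suc sqrt_step_real[of n] by (intro order_trans[OF norm_mult_ineq] mult_mono) auto
    then have "norm (x + ?q n * ?q n) \<le> 1 + ?t n * ?t n"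
      using assms norm_triangle_ineq[of x "?q n * ?q n"] by linarith
    then show ?thesis by simp
  qed
  have "?q (Suc (Suc n)) - ?q (Suc n) =
      (1/2) *\<^sub>R (?q (Suc n) * ?q (Suc n) - ?q n * ?q n)"
    by (simp only: sqrt_step.simps scaleR_diff_right[symmetric]) (simp add: algebra_simps)
  also have "?q (Suc n) * ?q (Suc n) - ?q n * ?q n = (?q (Suc n) - ?q n) * (?q (Suc n) + ?q n)"
    using c by (simp only: algebra_simps)
  finally have "norm (?q (Suc (Suc n)) - ?q (Suc n)) =
      1/2 * norm ((?q (Suc n) - ?q n) * (?q (Suc n) + ?q n))" by simp
  also have "\<dots> \<le> 1/2 * ((?t (Suc n) - ?t n) * (?t (Suc n) + ?t n))"
  proof -
    have "norm (?q (Suc n) + ?q n) \<le> ?t (Suc n) + ?t n"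
      using 1 Suc norm_triangle_ineq[of "?q (Suc n)" "?q n"] by linarith
    moreover have "norm (?q (Suc n) - ?q n) \<le> ?t (Suc n) - ?t n" using Suc by blast
    ultimately have "norm ((?q (Suc n) - ?q n) * (?q (Suc n) + ?q n))
        \<le> (?t (Suc n) - ?t n) * (?t (Suc n) + ?t n)"
      by (meson mult_mono norm_ge_zero norm_mult_ineq order_trans)
    then show ?thesis by simp
  qed
  also have "\<dots> = ?t (Suc (Suc n)) - ?t (Suc n)"
    by (simp add: algebra_simps)
  finally show ?case using 1 by blast
qed

lemma sqrt_exists:
  fixes x :: "'x::unital_cstar_algebra"
  assumes "norm x \<le> 1" "star x = x"
  obtains c where "star c = c" "c * c = 1 - x" "\<And>y. y * x = x * y \<Longrightarrow> y * c = c * y"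
proof -
  let ?q = "sqrt_step x" and ?t = "sqrt_step (1::real)"
  have "mono ?t" unfolding mono_iff_le_Suc
    using sqrt_step_bounds[of "1::real"] by (auto intro: order_trans[OF norm_ge_zero])
  then have "incseq ?t" by simp
  then obtain l where "?t \<longlonglongrightarrow> l" using sqrt_step_real incseq_convergent by blast
  then have "convergent ?t" by (rule convergentI)
  then have Ct: "Cauchy ?t" by (rule convergent_Cauchy)
  have d: "norm (?q (n + k) - ?q n) \<le> ?t (n + k) - ?t n" for n k
  proof (induction k)
    case (Suc k)
    have "norm (?q (n + Suc k) - ?q n) \<le>
        norm (?q (Suc (n + k)) - ?q (n + k)) + norm (?q (n + k) - ?q n)"
      using norm_triangle_ineq[of "?q (Suc (n + k)) - ?q (n + k)" "?q (n + k) - ?q n"] by simp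
    also have "\<dots> \<le> (?t (Suc (n + k)) - ?t (n + k)) + (?t (n + k) - ?t n)"
      using Suc sqrt_step_bounds[OF assms(1), of "n + k"] by linarith
    finally show ?case by simp
  qed simp
  have "Cauchy ?q"
  proof (rule CauchyI)
    fix e :: real assume "e > 0"
    then obtain N where N: "\<And>m n. m \<ge> N \<Longrightarrow> n \<ge> N \<Longrightarrow> norm (?t m - ?t n) < e"
      using CauchyD[OF Ct] by blast
    have "norm (?q m - ?q n) < e" if "m \<ge> N" "n \<ge> N" for m n
    proof (cases "m \<le> n")
      case True
      then have "norm (?q m - ?q n) \<le> ?t n - ?t m" using d[of m "n - m"] by (simp add: norm_minus_commute)
      then show ?thesis using N[OF that(2,1)] by simp
    next
      case False
      then have "norm (?q m - ?q n) \<le> ?t m - ?t n" using d[of n "m - n"] by simp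
      then show ?thesis using N[OF that] by simp
    qed
    then show "\<exists>M. \<forall>m\<ge>M. \<forall>n\<ge>M. norm (?q m - ?q n) < e" by blast
  qed
  then obtain q where q: "?q \<longlonglongrightarrow> q" using Cauchy_convergent convergent_def by blast
  have "(\<lambda>n. ?q (Suc n)) \<longlonglongrightarrow> (1/2) *\<^sub>R (x + q * q)"
    unfolding sqrt_step.simps by (intro tendsto_intros q)
  then have "q = (1/2) *\<^sub>R (x + q * q)" using q LIMSEQ_Suc LIMSEQ_unique by blast
  then have "2 *\<^sub>R q = 2 *\<^sub>R ((1/2) *\<^sub>R (x + q * q))" by simp
  then have qq: "q + q = x + q * q" by (simp add: scaleR_2)
  have sa: "star (?q n) = ?q n" for n
    by (induction n) (simp_all add: star_scaleR star_add star_mult assms)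
  have "(\<lambda>n. star (?q n)) \<longlonglongrightarrow> star q" by (rule bounded_linear.tendsto[OF bounded_linear_star q])
  then have sq: "star q = q" using sa q LIMSEQ_unique by simp
  show thesis
  proof (rule that[of "1 - q"])
    show "star (1 - q) = 1 - q" by (simp add: star_diff sq)
    show "(1 - q) * (1 - q) = 1 - x" using qq by (simp add: algebra_simps)
    fix y assume y: "y * x = x * y"
    have "(\<lambda>n. y * ?q n) \<longlonglongrightarrow> y * q" "(\<lambda>n. ?q n * y) \<longlonglongrightarrow> q * y" by (intro tendsto_intros q)+
    then have "y * q = q * y" using sqrt_step_commute[OF y] LIMSEQ_unique by simp
    then show "y * (1 - q) = (1 - q) * y" by (simp add: algebra_simps)
  qed
qed

lemma star_homD:
  assumes "star_hom f"
  shows "f (x + y) = f x + f y" "f (c *\<^sub>C x) = c *\<^sub>C f x" "f (x * y) = f x * f y"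
    "f (star x) = star (f x)"
  using assms by (simp_all add: star_hom_on_def)

lemma star_hom_linear:
  assumes "star_hom f"
  shows "linear f"
  by (rule clinear_linear) (use assms in \<open>simp add: clinear_def star_hom_on_def\<close>)

lemma star_hom_zero: "star_hom f \<Longrightarrow> f 0 = 0"
  by (rule linear_0[OF star_hom_linear])

lemma star_hom_diff: "star_hom f \<Longrightarrow> f (x - y) = f x - f y"
  by (rule linear_diff[OF star_hom_linear])

lemma star_hom_scaleR: "star_hom f \<Longrightarrow> f (r *\<^sub>R x) = r *\<^sub>R f x"
  by (rule linear_scale[OF star_hom_linear])

text \<open>After scaling, a self-adjoint \<open>h\<close> is the real part of
  \<open>u = h + i c\<close> with \<open>c * c = 1 - h * h\<close> and
  \<open>star u * u = 1\<close>. As \<open>f 1\<close> is a projection, \<open>f u\<close> has norm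
  at most 1. The C*-identity gives the general case.\<close>

lemma star_hom_norm_le:
  fixes f :: "'x::unital_cstar_algebra \<Rightarrow> 'y::unital_cstar_algebra"
  assumes f: "star_hom f"
  shows "norm (f x) \<le> norm x"
proof -
  note F = star_homD[OF f]
  have one: "norm (f 1) \<le> 1"
  proof -
    have "star (f 1) * f 1 = f 1" using F(3,4)[of 1] by (metis F(3,4) mult_1_right star_one)
    then have "norm (f 1) * norm (f 1) = norm (f 1)"
      using cstar_identity[of "f 1"] by (simp add: power2_eq_square)
    then show ?thesis by (metis mult_cancel_right2 order.refl zero_le_one)
  qed
  have unit: "norm (f h) \<le> 1" if h: "star h = h" "norm h \<le> 1" for h
  proof -
    have "norm (h * h) \<le> 1"
      using norm_mult_ineq[of h h] h by (meson mult_le_one norm_ge_zero order_trans)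
    then obtain c where c: "star c = c" "c * c = 1 - h * h" "\<And>y. y * (h * h) = (h * h) * y \<Longrightarrow> y * c = c * y"
      using sqrt_exists[of "h * h"] h by (metis star_mult)
    have hc: "h * c = c * h" using c(3)[of h] by (simp add: mult.assoc)
    define u where "u = h + \<i> *\<^sub>C c"
    have su: "star u = h - \<i> *\<^sub>C c"
      by (simp add: u_def star_add star_scaleC h c scaleC_minus_left)
    have "star u * u = 1"
      unfolding su unfolding u_def
      using hc by (simp add: distrib_left distrib_right left_diff_distrib right_diff_distrib mult_scaleC_left
          mult_scaleC_right scaleC_scaleC c scaleC_minus_left scaleC_diff_right)
    then have "star (f u) * f u = f 1" using F(3,4) by metis
    then have "(norm (f u))\<^sup>2 \<le> 1" using one by (metis cstar_identity)
    then have fu: "norm (f u) \<le> 1" by (simp add: power2_le_iff_abs_le[of 1, simplified])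
    have "u + star u = 2 *\<^sub>R h" unfolding su unfolding u_def by (simp add: scaleR_2)
    then have "2 *\<^sub>R f h = f u + star (f u)" using F(1,4) star_hom_scaleR[OF f] by metis
    then have "2 * norm (f h) \<le> norm (f u) + norm (star (f u))"
      by (metis norm_triangle_ineq norm_scaleR abs_numeral)
    then show ?thesis using fu by simp
  qed
  have sa: "norm (f h) \<le> norm h" if h: "star h = h" for h
  proof (cases "h = 0")
    case True then show ?thesis using f by (simp add: star_hom_zero)
  next
    case False
    have "norm (f ((1 / norm h) *\<^sub>R h)) \<le> 1"
      by (rule unit) (simp_all add: star_scaleR h False)
    then show ?thesis using False by (simp add: star_hom_scaleR[OF f] field_simps)
  qed
  have "norm (f (star x * x)) \<le> norm (star x * x)"
    by (rule sa) (simp add: star_mult star_star)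
  then have "(norm (f x))\<^sup>2 \<le> (norm x)\<^sup>2" by (simp add: F cstar_identity)
  then show ?thesis by (simp add: power2_le_iff_abs_le)
qed

lemma scaleC_power: "(z *\<^sub>C x) ^ k = z ^ k *\<^sub>C (x::'x::unital_cstar_algebra) ^ k"
  by (induction k) (simp_all add: mult_scaleC_left mult_scaleC_right scaleC_scaleC mult.commute)

lemma star_hom_power: "star_hom f \<Longrightarrow> f 1 = 1 \<Longrightarrow> f (x ^ k) = f x ^ k"
  by (induction k) (simp_all add: star_homD)

lemma star_hom_bounded_linear: "star_hom f \<Longrightarrow> bounded_linear f"
  by (rule bounded_linear_intro[where K = 1])
    (simp_all add: star_homD star_hom_scaleR star_hom_norm_le)

text \<open>The same \<open>K\<close> serves for all powers \<open>(star x * x) ^ (2 ^ n)\<close>,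
  which stay in \<open>X\<close>; hence it can be replaced by 1.\<close>

lemma star_hom_norm_le_if_bounded_below:
  fixes f :: "'x::unital_cstar_algebra \<Rightarrow> 'y::unital_cstar_algebra"
  assumes f: "star_hom f"
    and X: "\<And>x y. x \<in> X \<Longrightarrow> y \<in> X \<Longrightarrow> x * y \<in> X" "\<And>x. x \<in> X \<Longrightarrow> star x \<in> X"
    and below: "\<And>x. x \<in> X \<Longrightarrow> norm x \<le> K * norm (f x)" and x: "x \<in> X"
  shows "norm x \<le> norm (f x)"
proof -
  have pw: "(star x * x) ^ (2 ^ n) \<in> X \<and> f ((star x * x) ^ (2 ^ n)) = (star (f x) * f x) ^ (2 ^ n)" for n
  proof (induction n)
    case 0 show ?case using X x by (simp add: star_homD[OF f])
  next
    case (Suc n)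
    show ?case
      using Suc X by (simp add: mult_2 power_add star_homD(3)[OF f])
  qed
  have "(norm x)\<^sup>2 \<le> (norm (f x))\<^sup>2"
  proof (rule le_if_power_two_power_le[where A = 0 and B = K])
    fix n
    have "norm ((star x * x) ^ (2 ^ n)) \<le> K * norm ((star (f x) * f x) ^ (2 ^ n))"
      using pw[of n] below by metis
    then show "((norm x)\<^sup>2) ^ (2 ^ n) \<le> (0 * 2 ^ n + K) * ((norm (f x))\<^sup>2) ^ (2 ^ n)"
      by (simp add: norm_power_two_power_star_mult)
  qed auto
  then show ?thesis by (simp add: power2_le_iff_abs_le)
qed

subsection \<open>Resolvents and lifting\<close>

text \<open>For self-adjoint \<open>f\<close> the hypothesis says that the Cayley transform
  \<open>(1 - \<i>f)(1 + \<i>f)\<^sup>-\<^sup>1\<close> is isometric. It holds by the C*-identity and avoids order arguments.\<close>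

lemma cayley_bounds:
  fixes f :: "'x::complex_banach \<Rightarrow> 'x"
  assumes f: "clinear f" and iso: "\<And>v. norm (v + \<i> *\<^sub>C f v) = norm (v - \<i> *\<^sub>C f v)"
  shows "norm v \<le> norm (v + f (f v))" and "norm (f v) \<le> norm (v + f (f v))"
proof -
  let ?u = "v + \<i> *\<^sub>C f v"
  have "2 *\<^sub>R w = (w + \<i> *\<^sub>C f w) + (w - \<i> *\<^sub>C f w)" for w by (simp add: scaleR_2)
  then have "norm (2 *\<^sub>R w) \<le> norm (w + \<i> *\<^sub>C f w) + norm (w - \<i> *\<^sub>C f w)" for w
    by (metis norm_triangle_ineq)
  then have "2 * norm w \<le> norm (w + \<i> *\<^sub>C f w) + norm (w - \<i> *\<^sub>C f w)" for w by simp
  then have 1: "norm w \<le> norm (w + \<i> *\<^sub>C f w)" for w using iso[of w] by (smt (verit))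
  have "2 *\<^sub>R (\<i> *\<^sub>C f w) = (w + \<i> *\<^sub>C f w) - (w - \<i> *\<^sub>C f w)" for w by (simp add: scaleR_2)
  then have "norm (2 *\<^sub>R (\<i> *\<^sub>C f w)) \<le> norm (w + \<i> *\<^sub>C f w) + norm (w - \<i> *\<^sub>C f w)" for w
    by (metis norm_triangle_ineq4)
  then have "2 * norm (f w) \<le> norm (w + \<i> *\<^sub>C f w) + norm (w - \<i> *\<^sub>C f w)" for w
    by (simp add: norm_scaleC)
  then have 2: "norm (f w) \<le> norm (w + \<i> *\<^sub>C f w)" for w using iso[of w] by (smt (verit))
  \<comment> \<open>The factorization 1 + f^2 = (1 - i f)(1 + i f); neither factor decreases
    norms.\<close>
  have "?u - \<i> *\<^sub>C f ?u = v + f (f v)"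
    using f by (simp add: clinear_def scaleC_add_right scaleC_scaleC scaleC_minus_left)
  then have 3: "norm ?u \<le> norm (v + f (f v))" using 1[of ?u] iso[of ?u] by metis
  show "norm v \<le> norm (v + f (f v))" "norm (f v) \<le> norm (v + f (f v))"
    using 1[of v] 2[of v] 3 by linarith+
qed

text \<open>Continuity method: \<open>v + s f (f v) = m\<close> is solved for
  \<open>s = n / N\<close> by induction on \<open>n\<close>. At each stage \<open>below\<close>
  bounds the inverse by 1, so passing to \<open>s + 1 / N\<close> is a fixed-point problem with
  contraction constant \<open>B * B / N < 1/2\<close>. Running it inside \<open>X\<close> puts the
  solution there.\<close>

lemma square_resolvent:
  fixes f :: "'x::complex_banach \<Rightarrow> 'x"
  assumes f: "clinear f" "bounded_linear f"
    and iso: "\<And>v s. norm (v + (\<i> * of_real s) *\<^sub>C f v) = norm (v - (\<i> * of_real s) *\<^sub>C f v)"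
    and X: "closed X" "subspace X" "\<And>v. v \<in> X \<Longrightarrow> f v \<in> X" and m: "m \<in> X"
  shows "\<exists>v\<in>X. v + f (f v) = m"
proof -
  have lin: "linear f" using f(1) by (rule clinear_linear)
  have below: "norm v \<le> norm (v + s *\<^sub>R f (f v))" if "s \<ge> 0" for s v
  proof -
    let ?g = "\<lambda>v. sqrt s *\<^sub>R f v"
    have "clinear ?g" using f(1) by (simp add: clinear_def scaleR_add_right scaleC_scaleR_commute)
    moreover have "norm (v + \<i> *\<^sub>C ?g v) = norm (v - \<i> *\<^sub>C ?g v)" for v
      using iso[of v "sqrt s"] by (simp add: scaleC_scaleC[symmetric] scaleC_of_real)
    ultimately have "norm v \<le> norm (v + ?g (?g v))" by (rule cayley_bounds(1))
    then show ?thesis using that by (simp add: linear_scale[OF lin])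
  qed
  obtain B where B: "B > 0" "\<And>v. norm (f v) \<le> norm v * B"
    using bounded_linear.pos_bounded[OF f(2)] by blast
  obtain N :: nat where N: "N > 0" "2 * (B * B) < real N"
    by (metis gr0I not_less_zero of_nat_0_less_iff reals_Archimedean2 less_trans mult_pos_pos B(1) zero_less_numeral)
  have "\<forall>m\<in>X. \<exists>v\<in>X. v + (real n / N) *\<^sub>R f (f v) = m" for n :: nat
  proof (induction n)
    case (Suc n)
    let ?s = "real n / real N"
    obtain g where g: "\<And>m. m \<in> X \<Longrightarrow> g m \<in> X" "\<And>m. m \<in> X \<Longrightarrow> g m + ?s *\<^sub>R f (f (g m)) = m"
      using Suc by metis
    show ?case
    proof
      fix m assume m: "m \<in> X"
      let ?r = "\<lambda>v. m - (1 / N) *\<^sub>R f (f v)"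
      have r: "?r v \<in> X" if "v \<in> X" for v
        using X m that by (intro subspace_diff subspace_scale) auto
      have "\<exists>!v\<in>X. g (?r v) = v"
      proof (rule Banach_fix[where c = "1/2"])
        show "complete X" using X(1) by (simp add: complete_eq_closed)
        show "X \<noteq> {}" using m by auto
        show "(\<lambda>v. g (?r v)) ` X \<subseteq> X" using g r by auto
        show "dist (g (?r v)) (g (?r w)) \<le> 1 / 2 * dist v w" if v: "v \<in> X" and w: "w \<in> X" for v w
        proof -
          let ?d = "g (?r v) - g (?r w)"
          have "?d + ?s *\<^sub>R f (f ?d) =
              (g (?r v) + ?s *\<^sub>R f (f (g (?r v)))) - (g (?r w) + ?s *\<^sub>R f (f (g (?r w))))"
            by (simp add: linear_diff[OF lin] scaleR_diff_right)
          also have "\<dots> = ?r v - ?r w" using g(2) r v w by simp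
          also have "\<dots> = (1 / N) *\<^sub>R f (f (w - v))"
            by (simp add: linear_diff[OF lin] scaleR_diff_right)
          finally have "norm ?d \<le> norm ((1 / N) *\<^sub>R f (f (w - v)))"
            using below[of ?s ?d] by simp
          also have "\<dots> \<le> 1 / N * (norm (w - v) * B * B)"
            using order_trans[OF B(2)[of "f (w - v)"] mult_right_mono[OF B(2)[of "w - v"]]] B(1) N
            by (simp add: divide_right_mono)
          also have "\<dots> = (B * B / N) * norm (w - v)" by simp
          also have "\<dots> \<le> 1/2 * norm (w - v)"
            using N by (intro mult_right_mono) (auto simp: field_simps)
          finally show ?thesis
            by (simp add: dist_norm norm_minus_commute)
        qed
      qed auto
      then obtain v where v: "v \<in> X" "g (?r v) = v" by blast
      have "v + ?s *\<^sub>R f (f v) = ?r v" using g(2)[OF r[OF v(1)]] v(2) by simp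
      moreover have "real (Suc n) / real N = ?s + 1 / N" by (simp add: add_divide_distrib)
      ultimately have "v + (real (Suc n) / N) *\<^sub>R f (f v) = m"
        by (simp add: scaleR_add_left algebra_simps)
      then show "\<exists>v\<in>X. v + (real (Suc n) / N) *\<^sub>R f (f v) = m" using v by blast
    qed
  qed auto
  from this[of N] show ?thesis using N m by simp
qed

lemma norm_add_eq_norm_diff:
  fixes v w :: "'x::unital_cstar_algebra"
  assumes "star v * w + star w * v = 0"
  shows "norm (v + w) = norm (v - w)"
proof -
  have "star w * v = - (star v * w)" using assms by (simp add: eq_neg_iff_add_eq_0 add.commute)
  then have "star (v + w) * (v + w) = star (v - w) * (v - w)"
    by (simp add: star_add star_diff algebra_simps)
  then have "(norm (v + w))\<^sup>2 = (norm (v - w))\<^sup>2" by (metis cstar_identity)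
  then show ?thesis by simp
qed

lemma selfadjoint_resolvent:
  fixes h :: "'x::unital_cstar_algebra"
  assumes h: "star h = h" and X: "closed X" "subspace X" "\<And>v. v \<in> X \<Longrightarrow> h * v \<in> X"
    and m: "m \<in> X"
  shows "\<exists>v\<in>X. v + h * (h * v) = m"
    and "norm v \<le> norm (v + h * (h * v))" and "norm (h * v) \<le> norm (v + h * (h * v))"
proof -
  have cl: "clinear (\<lambda>v. h * v)" by (simp add: clinear_def distrib_left mult_scaleC_right)
  have iso: "norm (v + (\<i> * of_real s) *\<^sub>C (h * v)) = norm (v - (\<i> * of_real s) *\<^sub>C (h * v))" for v s
    by (rule norm_add_eq_norm_diff)
      (simp add: star_scaleC star_mult h mult_scaleC_right mult_scaleC_left mult.assoc scaleC_minus_left)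
  show "\<exists>v\<in>X. v + h * (h * v) = m"
    by (rule square_resolvent[OF cl bounded_linear_mult_right iso X m])
  show "norm v \<le> norm (v + h * (h * v))" "norm (h * v) \<le> norm (v + h * (h * v))"
    using cayley_bounds[OF cl, of v] iso[of _ 1] by simp_all
qed

text \<open>\<open>c = (1 + h\<^sup>2)\<^sup>-\<^sup>1\<close>.\<close>

lemma selfadjoint_inverse:
  fixes h :: "'x::unital_cstar_algebra"
  assumes h: "star h = h" "h \<in> X" and X: "closed X" "subspace X" "\<And>x y. x \<in> X \<Longrightarrow> y \<in> X \<Longrightarrow> x * y \<in> X"
  obtains c where "star c = c" "1 - c \<in> X" "1 - c = c * (h * h)" "norm c \<le> 1" "norm (h * c) \<le> 1"
proof -
  have hh: "h * h \<in> X" using h X by blast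
  \<comment> \<open>\<open>X\<close> may fail to contain 1, so the equation is solved for
    \<open>e = 1 - c\<close>, which is \<open>h^2\<close> times the resolvent.\<close>
  obtain e where e: "e \<in> X" "e + h * (h * e) = h * h"
    using selfadjoint_resolvent(1)[OF h(1) X(1,2) _ hh] h X by blast
  define c where "c = 1 - e"
  have c1: "c + h * (h * c) = 1" using e(2) by (simp add: c_def algebra_simps)
  then have "star (c + h * (h * c)) = 1" by simp
  then have c2: "star c + star c * (h * h) = 1" by (simp add: star_add star_mult h mult.assoc)
  \<comment> \<open>\<open>star c\<close> is a left inverse and \<open>c\<close> a right inverse of
    \<open>1 + h * h\<close>, so they coincide.\<close>
  have "star c = star c * (c + h * (h * c))" by (simp add: c1)
  also have "\<dots> = (star c + star c * (h * h)) * c" by (simp add: algebra_simps)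
  also have "\<dots> = c" by (simp add: c2)
  finally have sc: "star c = c" .
  show thesis
  proof (rule that[of c])
    show "1 - c = c * (h * h)" using c2 sc by (simp add: algebra_simps)
    show "norm c \<le> 1" "norm (h * c) \<le> 1"
      using selfadjoint_resolvent(2,3)[OF h(1) X(1,2) _ hh, of c] h X c1 norm_one_le[where 'x = 'x]
      by simp_all
  qed (use e sc in \<open>simp_all add: c_def\<close>)
qed

text \<open>Successive approximation as in the open mapping theorem: each step halves the remainder,
  and the lifts add up to at most \<open>C (1 + 1/2 + 1/4 + ...) p z\<close>. \<open>Z\<close> is
  where the remainders must stay for \<open>step\<close> to apply.\<close>

lemma lift_iterate:
  fixes f :: "'x::banach \<Rightarrow> 'y::real_normed_vector" and p :: "'y \<Rightarrow> real"
  assumes f: "bounded_linear f" and W: "subspace W" and Z: "subspace Z"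
    and p_add: "\<And>x y. p (x + y) \<le> p x + p y" and p_scale: "\<And>c x. p (c *\<^sub>R x) = \<bar>c\<bar> * p x"
    and p_le: "\<And>x. p x \<le> K * norm x" and C: "C \<ge> 0"
    and step: "\<And>z. z \<in> Z \<Longrightarrow> p z \<le> 1 \<Longrightarrow> \<exists>x\<in>W. f x \<in> Z \<and> norm x \<le> C \<and> p (z - f x) \<le> 1/2"
    and z: "z \<in> Z"
  shows "\<exists>x\<in>closure W. p (z - f x) = 0 \<and> norm x \<le> 2 * C * p z"
proof -
  interpret f: bounded_linear f by fact
  have p0: "p 0 = 0" using p_scale[of 0 0] by simp
  have p_minus: "p (- x) = p x" for x using p_scale[of "-1" x] by simp
  have p_pos: "p x \<ge> 0" for x using p_add[of x "- x"] p0 p_minus[of x] by simp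
  show ?thesis
  proof (cases "p z = 0")
    case True
    have "0 \<in> closure W" using subspace_0[OF W] closure_subset by blast
    then show ?thesis using True by (intro bexI[of _ 0]) (simp_all add: f.zero)
  next
    case False
    then have pz: "p z > 0" using p_pos[of z] by simp
    have "\<exists>x\<in>W. f x \<in> Z \<and> norm x \<le> C * (p z * (1/2) ^ n) \<and> p (y - f x) \<le> p z * (1/2) ^ Suc n"
      if y: "y \<in> Z" "p y \<le> p z * (1/2) ^ n" for y n
    proof -
      define r where "r = p z * (1/2) ^ n"
      have r: "r > 0" using pz by (simp add: r_def)
      have "(1 / r) *\<^sub>R y \<in> Z" using y Z by (simp add: subspace_scale)
      moreover have "p ((1 / r) *\<^sub>R y) \<le> 1" using r y by (simp add: p_scale r_def[symmetric])
      ultimately obtain x where x: "x \<in> W" "f x \<in> Z" "norm x \<le> C" "p ((1 / r) *\<^sub>R y - f x) \<le> 1/2"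
        using step by blast
      have "y - f (r *\<^sub>R x) = r *\<^sub>R ((1 / r) *\<^sub>R y - f x)"
        using r by (simp add: f.scaleR scaleR_diff_right)
      then have "p (y - f (r *\<^sub>R x)) = r * p ((1 / r) *\<^sub>R y - f x)" using r by (simp add: p_scale)
      also have "\<dots> \<le> r * (1/2)" using r x(4) by (intro mult_left_mono) auto
      finally have *: "p (y - f (r *\<^sub>R x)) \<le> p z * (1/2) ^ Suc n" by (simp add: r_def)
      have "norm (r *\<^sub>R x) \<le> C * r" using r x(3) by (simp add: mult.commute mult_right_mono)
      with * show ?thesis
        using x W Z by (intro bexI[of _ "r *\<^sub>R x"]) (auto simp: r_def[symmetric] f.scaleR subspace_scale)
    qed
    note ex = this
    define g where "g = (\<lambda>n y. SOME x. x \<in> W \<and> f x \<in> Z \<and> norm x \<le> C * (p z * (1/2) ^ n) \<and>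
        p (y - f x) \<le> p z * (1/2) ^ Suc n)"
    have g: "g n y \<in> W \<and> f (g n y) \<in> Z \<and> norm (g n y) \<le> C * (p z * (1/2) ^ n) \<and>
        p (y - f (g n y)) \<le> p z * (1/2) ^ Suc n" if "y \<in> Z" "p y \<le> p z * (1/2) ^ n" for y n
      unfolding g_def by (rule someI_ex) (use ex[OF that] in blast)
    define y where "y = rec_nat z (\<lambda>n y. y - f (g n y))"
    have yS: "y 0 = z" "y (Suc n) = y n - f (g n (y n))" for n by (simp_all add: y_def)
    define x where "x = (\<lambda>n. g n (y n))"
    have y: "y n \<in> Z \<and> p (y n) \<le> p z * (1/2) ^ n" for n
    proof (induction n)
      case (Suc n)
      then show ?case using g[of "y n" n] yS(2)[of n] Z by (auto intro: subspace_diff)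
    qed (simp add: yS z)
    then have x: "x n \<in> W" "norm (x n) \<le> C * (p z * (1/2) ^ n)" for n
      using g[of "y n" n] by (auto simp: x_def)
    have sm: "summable (\<lambda>n. C * (p z * (1/2::real) ^ n))" by (intro summable_mult) simp
    have sn: "summable (\<lambda>n. norm (x n))"
      by (rule summable_comparison_test'[OF sm]) (use x in auto)
    then have sx: "summable x" by (rule summable_norm_cancel)
    let ?s = "suminf x"
    have part: "z - f (sum x {..<n}) = y n" for n
      by (induction n) (simp_all add: f.zero f.add yS x_def algebra_simps)
    have lim: "(\<lambda>n. sum x {..<n}) \<longlonglongrightarrow> ?s" using sx summable_LIMSEQ by blast
    have "?s \<in> closure W"
      unfolding closure_sequential using lim x W
      by (intro exI[of _ "\<lambda>n. sum x {..<n}"]) (auto intro: subspace_sum)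
    moreover have "p (z - f ?s) = 0"
    proof -
      have b: "p (z - f ?s) \<le> p z * (1/2) ^ n + K * norm (f (sum x {..<n}) - f ?s)" for n
      proof -
        have "z - f ?s = y n + (f (sum x {..<n}) - f ?s)" using part[of n] by (simp add: algebra_simps)
        then have "p (z - f ?s) \<le> p (y n) + p (f (sum x {..<n}) - f ?s)" using p_add by metis
        then show ?thesis using y[of n] p_le[of "f (sum x {..<n}) - f ?s"] by linarith
      qed
      have "(\<lambda>n. p z * (1/2) ^ n + K * norm (f (sum x {..<n}) - f ?s)) \<longlonglongrightarrow> p z * 0 + K * norm (f ?s - f ?s)"
        by (intro tendsto_intros f.tendsto lim LIMSEQ_power_zero) simp
      then have "p (z - f ?s) \<le> p z * 0 + K * norm (f ?s - f ?s)"
        by (rule LIMSEQ_le_const) (use b in auto)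
      then show ?thesis using p_pos[of "z - f ?s"] by simp
    qed
    moreover have "norm ?s \<le> 2 * C * p z"
    proof -
      have "norm ?s \<le> (\<Sum>n. norm (x n))" by (rule summable_norm[OF sn])
      also have "\<dots> \<le> (\<Sum>n. C * (p z * (1/2) ^ n))" by (rule suminf_le[OF x(2) sn sm])
      also have "\<dots> = C * (p z * 2)"
        by (subst suminf_mult, simp, subst suminf_mult) (simp_all add: suminf_geometric)
      finally show ?thesis by (simp add: mult_ac)
    qed
    ultimately show ?thesis by blast
  qed
qed

text \<open>An approximate lift of \<open>x\<close> is \<open>x(1 + h\<^sup>2)\<^sup>-\<^sup>1\<close> with \<open>h = x\<^sup>*x\<close>: its norm is at most 1,
  and it is close to \<open>x\<close> in the seminorm if \<open>x\<close> is small there.\<close>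

lemma cstar_lift:
  fixes X :: "'x::unital_cstar_algebra set" and p :: "'x \<Rightarrow> real"
  assumes X: "closed X" "subspace X" "\<And>x y. x \<in> X \<Longrightarrow> y \<in> X \<Longrightarrow> x * y \<in> X" "\<And>x. x \<in> X \<Longrightarrow> star x \<in> X"
    and p_add: "\<And>x y. p (x + y) \<le> p x + p y" and p_scale: "\<And>c x. p (c *\<^sub>R x) = \<bar>c\<bar> * p x"
    and p_mult: "\<And>x y. p (x * y) \<le> p x * p y" and p_star: "\<And>x. p (star x) = p x"
    and p_le: "\<And>x. p x \<le> K * norm x" and x: "x \<in> X"
  shows "\<exists>x'\<in>X. p (x - x') = 0 \<and> norm x' \<le> 4 * p x"
proof -
  have p_pos: "p x \<ge> 0" for x
    using p_add[of x "- x"] p_scale[of 0 0] p_scale[of "-1" x] by simp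
  have "\<exists>x\<in>X. x \<in> X \<and> norm x \<le> 2 \<and> p (z - x) \<le> 1/2" if z: "z \<in> X" "p z \<le> 1" for z
  proof -
    \<comment> \<open>Halving gives \<open>p y \<le> 1/2\<close> and so
      \<open>p (h * h) \<le> 1/16\<close>; the approximate lift \<open>y * c\<close> is doubled at
      the end.\<close>
    define y where "y = (1/2) *\<^sub>R z"
    have y: "y \<in> X" "p y \<le> 1/2" using z X by (auto simp: y_def subspace_scale p_scale)
    define h where "h = star y * y"
    have h: "star h = h" "h \<in> X" using y X by (auto simp: h_def star_mult star_star)
    obtain c where c: "star c = c" "1 - c \<in> X" "1 - c = c * (h * h)" "norm c \<le> 1" "norm (h * c) \<le> 1"
      using selfadjoint_inverse[OF h X(1-3)] by blast
    have yc: "y * c = y - y * (1 - c)" by (simp add: algebra_simps)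
    have ycX: "y * c \<in> X" unfolding yc using y c X by (auto intro: subspace_diff)
    have "(norm (y * c))\<^sup>2 = norm (star (y * c) * (y * c))" by (simp only: cstar_identity)
    also have "star (y * c) * (y * c) = c * (h * c)" by (simp add: star_mult c h_def mult.assoc)
    also have "norm \<dots> \<le> norm c * norm (h * c)" by (rule norm_mult_ineq)
    also have "\<dots> \<le> 1" using c by (intro mult_le_one) auto
    finally have n: "norm (y * c) \<le> 1" by (simp add: power2_le_iff_abs_le[of 1, simplified])
    let ?l = "y * (1 - c)"
    have ph: "p h \<le> 1/4"
      using p_mult[of "star y" y] y mult_mono[of "p y" "1/2" "p y" "1/2"] p_pos[of y] by (simp add: h_def p_star)
    have phh: "p (h * h) \<le> 1/16"
      using p_mult[of h h] mult_mono[of "p h" "1/4" "p h" "1/4"] p_pos[of h] ph by simp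
    \<comment> \<open>Since \<open>y * c = y - ?l\<close>, the defect satisfies
      \<open>?l = y h^2 - ?l h^2\<close>. The resulting inequality for \<open>p ?l\<close> can be
      solved because \<open>p (h * h) < 1\<close>.\<close>
    have "?l = y * c * (h * h)" using c(3) by (simp add: mult.assoc)
    also have "\<dots> = y * (h * h) + (- 1) *\<^sub>R (?l * (h * h))" by (simp add: algebra_simps)
    finally have "p ?l \<le> p (y * (h * h)) + p (?l * (h * h))"
      using p_add[of "y * (h * h)" "(- 1) *\<^sub>R (?l * (h * h))"] p_scale[of "-1"] by simp
    also have "\<dots> \<le> p y * p (h * h) + p ?l * p (h * h)" using p_mult by (intro add_mono) auto
    also have "\<dots> \<le> 1/2 * (1/16) + p ?l * (1/16)"
      using y phh p_pos by (intro add_mono mult_mono) auto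
    finally have pl: "p ?l \<le> 1/4" by simp
    have "z - 2 *\<^sub>R (y * c) = 2 *\<^sub>R ?l" by (simp add: yc y_def scaleR_diff_right right_diff_distrib)
    then have "p (z - 2 *\<^sub>R (y * c)) \<le> 1/2" using pl by (simp add: p_scale)
    then show ?thesis using ycX n X by (intro bexI[of _ "2 *\<^sub>R (y * c)"]) (auto simp: subspace_scale)
  qed
  from lift_iterate[of "\<lambda>x. x" X X p K 2 x, OF bounded_linear_ident X(2,2) p_add p_scale p_le _ this x]
  show ?thesis using X(1) by simp
qed

text \<open>The seminorm is the norm of the image. If \<open>f\<close> is injective on
  \<open>X\<close>, the lift is \<open>x\<close> itself, which yields the lower bound
  \<open>norm x \<le> 4 * norm (f x)\<close>.\<close>

lemma star_hom_lift:
  assumes f: "star_hom f"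
    and X: "closed X" "subspace X" "\<And>x y. x \<in> X \<Longrightarrow> y \<in> X \<Longrightarrow> x * y \<in> X" "\<And>x. x \<in> X \<Longrightarrow> star x \<in> X"
    and x: "x \<in> X"
  shows "\<exists>x'\<in>X. f x' = f x \<and> norm x' \<le> 4 * norm (f x)"
proof -
  have "\<exists>x'\<in>X. norm (f (x - x')) = 0 \<and> norm x' \<le> 4 * norm (f x)"
    by (rule cstar_lift[OF X, where p = "\<lambda>x. norm (f x)" and K = 1])
      (simp_all add: star_homD[OF f] star_hom_scaleR[OF f] norm_triangle_ineq norm_mult_ineq
        star_hom_norm_le[OF f] x)
  then show ?thesis by (auto simp: star_hom_diff[OF f])
qed

section \<open>Hilbert modules\<close>

locale cstar_module =
  fixes M :: "('a::unital_cstar_algebra, 'm::complex_banach) bimodule"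
  assumes hilbert: "hilbert_module M"
begin

lemma hilbert_moduleD:
  "clinear (\<lambda>x. ract M x a)" "clinear (ract M x)" "clinear (ip M x)"
  "ract M x (b * c) = ract M (ract M x b) c" "ip M x (ract M y b) = ip M x y * b"
  "star (ip M x y) = ip M y x" "ip M x x = 0 \<Longrightarrow> x = 0"
  using hilbert unfolding hilbert_module_def by (elim conjE, fast)+

lemma ract_add_left: "ract M (x + y) a = ract M x a + ract M y a"
  and ract_scaleC_left: "ract M (c *\<^sub>C x) a = c *\<^sub>C ract M x a"
  using hilbert_moduleD(1)[of a] unfolding clinear_def by fast+

lemma ract_add_right: "ract M x (a + b) = ract M x a + ract M x b"
  and ract_scaleC_right: "ract M x (c *\<^sub>C a) = c *\<^sub>C ract M x a"
  using hilbert_moduleD(2)[of x] unfolding clinear_def by fast+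

lemma ip_add_right: "ip M x (y + z) = ip M x y + ip M x z"
  and ip_scaleC_right: "ip M x (c *\<^sub>C y) = c *\<^sub>C ip M x y"
  using hilbert_moduleD(3)[of x] unfolding clinear_def by fast+

lemmas ract_mult = hilbert_moduleD(4) and ip_ract_right = hilbert_moduleD(5)
  and star_ip = hilbert_moduleD(6) and ip_self_eq_zero = hilbert_moduleD(7)

lemma norm_square: "(norm x)\<^sup>2 = norm (ip M x x)"
proof -
  have "norm x = sqrt (norm (ip M x x))" using hilbert unfolding hilbert_module_def by (elim conjE) fast
  then show ?thesis by simp
qed

lemma ip_add_left: "ip M (x + y) z = ip M x z + ip M y z"
  by (metis ip_add_right star_add star_ip)

lemma ip_scaleC_left: "ip M (c *\<^sub>C x) y = cnj c *\<^sub>C ip M x y"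
  by (metis ip_scaleC_right star_scaleC star_ip)

lemma ip_ract_left: "ip M (ract M x a) y = star a * ip M x y"
  by (metis ip_ract_right star_mult star_ip)

lemma ip_scaleR_right: "ip M x (r *\<^sub>R y) = r *\<^sub>R ip M x y"
  by (metis ip_scaleC_right scaleC_of_real)

lemma ip_scaleR_left: "ip M (r *\<^sub>R x) y = r *\<^sub>R ip M x y"
  by (metis ip_scaleC_left scaleC_of_real complex_cnj_complex_of_real)

lemma ip_diff_right: "ip M x (y - z) = ip M x y - ip M x z"
  using ip_add_right[of x "y - z" z] by simp

lemma ip_diff_left: "ip M (x - y) z = ip M x z - ip M y z"
  using ip_add_left[of "x - y" y z] by simp

lemma eq_if_ip_eq: "(\<And>z. ip M z x = ip M z y) \<Longrightarrow> x = y"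
  using ip_self_eq_zero[of "x - y"] by (simp add: ip_diff_right)

lemma norm_ract: "norm (ract M x a) \<le> norm x * norm a"
proof -
  have "(norm (ract M x a))\<^sup>2 = norm (star a * ip M x x * a)"
    by (simp add: norm_square ip_ract_left ip_ract_right mult.assoc)
  also have "\<dots> \<le> norm (star a) * norm (ip M x x) * norm a"
    by (meson mult_right_mono norm_ge_zero norm_mult_ineq order_trans)
  also have "\<dots> = (norm x * norm a)\<^sup>2" by (simp add: norm_square[symmetric] power2_eq_square)
  finally show ?thesis by (simp add: power2_le_iff_abs_le)
qed

text \<open>Polarization yields the Cauchy-Schwarz inequality only up to a constant, but without any
  order theory in the algebra.\<close>

lemma norm_ip: "norm (ip M x y) \<le> 6 * norm x * norm y"
proof -
  have 1: "norm (ip M x y) \<le> 6" if xy: "norm x \<le> 1" "norm y \<le> 1" for x y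
  proof -
    have sq: "norm (ip M z z) \<le> r\<^sup>2" if "norm z \<le> r" for z r
      using that by (simp add: norm_square[symmetric] power_mono)
    \<comment> \<open>6 is \<open>2^2 + 1 + 1\<close>. Applied to \<open>i y\<close> this bounds the
      other half of the polarization, and the average of the two halves is again at most 6.\<close>
    have re: "norm (ip M x y' + ip M y' x) \<le> 6" if y': "norm y' \<le> 1" for y'
    proof -
      let ?a = "ip M (x + y') (x + y')" and ?b = "ip M x x" and ?c = "ip M y' y'"
      have "ip M x y' + ip M y' x = ?a - ?b - ?c"
        by (simp add: ip_add_left ip_add_right)
      moreover have "norm (?a - ?b - ?c) \<le> norm ?a + norm ?b + norm ?c"
        using norm_triangle_ineq4[of "?a - ?b" ?c] norm_triangle_ineq4[of ?a ?b] by linarith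
      moreover have "norm (x + y') \<le> 2" using norm_triangle_ineq[of x y'] xy(1) y' by linarith
      ultimately show ?thesis using sq[of "x + y'" 2] sq[OF xy(1)] sq[OF y'] by simp
    qed
    have "norm (\<i> *\<^sub>C (ip M x y - ip M y x)) \<le> 6"
      using re[of "\<i> *\<^sub>C y"] xy(2)
      by (simp add: norm_scaleC ip_scaleC_left ip_scaleC_right scaleC_minus_left scaleC_diff_right)
    then have "norm (ip M x y - ip M y x) \<le> 6" by (simp add: norm_scaleC)
    moreover have "2 *\<^sub>R ip M x y = (ip M x y + ip M y x) + (ip M x y - ip M y x)"
      by (simp add: scaleR_2)
    then have "2 * norm (ip M x y) \<le> norm (ip M x y + ip M y x) + norm (ip M x y - ip M y x)"
      by (metis norm_triangle_ineq norm_scaleR abs_numeral)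
    ultimately show ?thesis using re[OF xy(2)] by linarith
  qed
  show ?thesis
  proof (cases "x = 0 \<or> y = 0")
    case True
    then show ?thesis using ip_scaleR_right[of x 0 y] ip_scaleR_left[of 0 x y] by auto
  next
    case False
    then have "norm (ip M ((1 / norm x) *\<^sub>R x) ((1 / norm y) *\<^sub>R y)) \<le> 6" by (intro 1) auto
    then show ?thesis using False by (simp add: ip_scaleR_left ip_scaleR_right field_simps)
  qed
qed

lemma bounded_bilinear_ip: "bounded_bilinear (ip M)"
  by standard (auto simp: ip_add_left ip_add_right ip_scaleR_left ip_scaleR_right
    intro!: exI[of _ 6] order_trans[OF norm_ip])

lemma bounded_bilinear_ract: "bounded_bilinear (ract M)"
proof
  fix x a and r :: real
  show "ract M (r *\<^sub>R x) a = r *\<^sub>R ract M x a" "ract M x (r *\<^sub>R a) = r *\<^sub>R ract M x a"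
    by (metis ract_scaleC_left ract_scaleC_right scaleC_of_real)+
  show "\<exists>K. \<forall>a b. norm (ract M a b) \<le> norm a * norm b * K"
    by (intro exI[of _ 1]) (simp add: norm_ract)
qed (simp_all add: ract_add_left ract_add_right)

lemma theta_apply: "blinfun_apply (theta M x y) z = ract M x (ip M y z)"
proof -
  have "bounded_linear (\<lambda>z. ract M x (ip M y z))"
    by (intro bounded_linear_compose[OF bounded_bilinear.bounded_linear_right[OF bounded_bilinear_ract]
        bounded_bilinear.bounded_linear_right[OF bounded_bilinear_ip]])
  then show ?thesis by (simp add: theta_def bounded_linear_Blinfun_apply)
qed

lemma adjoint_of_sym: "adjoint_of M k k' \<Longrightarrow> adjoint_of M k' k"
  unfolding adjoint_of_def by (metis star_ip)

lemma adjoint_of_add: "adjoint_of M k k' \<Longrightarrow> adjoint_of M l l' \<Longrightarrow> adjoint_of M (k + l) (k' + l')"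
  by (simp add: adjoint_of_def ip_add_left ip_add_right blinfun.add_left)

lemma adjoint_of_scaleR: "adjoint_of M k k' \<Longrightarrow> adjoint_of M (r *\<^sub>R k) (r *\<^sub>R k')"
  by (simp add: adjoint_of_def ip_scaleR_left ip_scaleR_right blinfun.scaleR_left)

lemma adjoint_of_theta: "adjoint_of M (theta M x y) (theta M y x)"
  by (simp add: adjoint_of_def theta_apply ip_ract_left ip_ract_right star_ip)

lemma norm_adjoint_of:
  assumes "adjoint_of M k k'"
  shows "norm k' \<le> 6 * norm k"
proof (rule norm_blinfun_bound)
  fix x
  have "norm (k' x) * norm (k' x) = norm (ip M (k (k' x)) x)"
    using assms norm_square[of "k' x"] by (simp add: adjoint_of_def power2_eq_square)
  also have "\<dots> \<le> 6 * norm (k (k' x)) * norm x" by (rule norm_ip)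
  also have "\<dots> \<le> 6 * (norm k * norm (k' x)) * norm x"
    by (intro mult_right_mono mult_left_mono norm_blinfun) auto
  finally have "norm (k' x) * norm (k' x) \<le> norm (k' x) * (6 * norm k * norm x)" by (simp add: mult_ac)
  then show "norm (k' x) \<le> 6 * norm k * norm x"
    by (cases "k' x = 0") (simp_all add: mult_le_cancel_left)
qed simp

text \<open>The type of \<open>k\<close> gives only real linearity; an adjoint forces complex
  linearity because inner products separate points.\<close>

lemma adjoint_of_clinear:
  assumes "adjoint_of M k k'"
  shows "clinear (blinfun_apply k)"
proof -
  have "ip M z (k (c *\<^sub>C x)) = ip M z (c *\<^sub>C k x)" for z c x
    using adjoint_of_sym[OF assms] by (metis adjoint_of_def ip_scaleC_right)
  then show ?thesis
    unfolding clinear_def by (auto simp: blinfun.add_right intro: eq_if_ip_eq)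
qed

text \<open>\<open>g = (1 + h^2)^-1\<close>, the counterpart of \<open>selfadjoint_inverse\<close>
  for adjointable operators. The cross terms of the inner product cancel, which makes the Cayley
  transform isometric.\<close>

lemma selfadjoint_operator_inverse:
  assumes h: "adjoint_of M h h"
  obtains g where "adjoint_of M g g" "\<And>v. g v + h (h (g v)) = v" "\<And>v. g v + g (h (h v)) = v"
    "norm g \<le> 1" "\<And>v. norm (h (g v)) \<le> norm v"
proof -
  have cl: "clinear (blinfun_apply h)" by (rule adjoint_of_clinear[OF h])
  have hip: "ip M (h x) y = ip M x (h y)" for x y using h by (simp add: adjoint_of_def)
  have iso: "norm (v + (\<i> * of_real s) *\<^sub>C h v) = norm (v - (\<i> * of_real s) *\<^sub>C h v)" for v s
  proof -
    let ?w = "(\<i> * of_real s) *\<^sub>C h v"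
    have "ip M v ?w + ip M ?w v = 0"
      by (simp add: ip_scaleC_left ip_scaleC_right hip scaleC_minus_left)
    then have "ip M (v + ?w) (v + ?w) = ip M (v - ?w) (v - ?w)"
      by (simp add: ip_add_left ip_add_right ip_diff_left ip_diff_right add_eq_0_iff algebra_simps)
    then have "(norm (v + ?w))\<^sup>2 = (norm (v - ?w))\<^sup>2" by (simp add: norm_square)
    then show ?thesis by simp
  qed
  have b: "norm v \<le> norm (v + h (h v))" "norm (h v) \<le> norm (v + h (h v))" for v
    using cayley_bounds[OF cl, of v] iso[of _ 1] by simp_all
  have "\<exists>v\<in>UNIV. v + h (h v) = m" for m
    by (rule square_resolvent[OF cl blinfun.bounded_linear_right iso]) auto
  then obtain G where G: "\<And>m. G m + h (h (G m)) = m" by metis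
  have inj: "v = w" if "v + h (h v) = w + h (h w)" for v w
    using b(1)[of "v - w"] that by (simp add: blinfun.diff_right algebra_simps)
  have "bounded_linear G"
  proof (rule bounded_linear_intro[where K = 1])
    show "G (x + y) = G x + G y" for x y
    proof (rule inj)
      have "G x + G y + h (h (G x + G y)) = (G x + h (h (G x))) + (G y + h (h (G y)))"
        by (simp add: blinfun.add_right)
      then show "G (x + y) + h (h (G (x + y))) = G x + G y + h (h (G x + G y))" by (simp only: G)
    qed
    show "G (r *\<^sub>R x) = r *\<^sub>R G x" for r x
      by (rule inj) (metis G blinfun.scaleR_right scaleR_add_right)
    show "norm (G x) \<le> norm x * 1" for x using b(1)[of "G x"] G by simp
  qed
  then have ga: "blinfun_apply (Blinfun G) = G" by (rule bounded_linear_Blinfun_apply)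
  show thesis
  proof (rule that[of "Blinfun G"]; (unfold ga)?)
    have "ip M (G x) y = ip M x (G y)" for x y
    proof -
      have "ip M (G x) y = ip M (G x) (G y + h (h (G y)))" using G by simp
      also have "\<dots> = ip M (G x + h (h (G x))) (G y)" by (simp add: ip_add_left ip_add_right hip)
      finally show ?thesis using G by simp
    qed
    then show "adjoint_of M (Blinfun G) (Blinfun G)" by (simp add: adjoint_of_def ga)
    show "G v + h (h (G v)) = v" for v by (rule G)
    show "G v + G (h (h v)) = v" for v
      by (rule inj) (use G[of v] G[of "h (h v)"] in \<open>simp add: blinfun.add_right algebra_simps\<close>)
    show "norm (Blinfun G) \<le> 1"
      by (rule norm_blinfun_bound) (use b(1) G in \<open>simp_all add: ga\<close>, metis)
    show "norm (h (G v)) \<le> norm v" for v using b(2)[of "G v"] G by simp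
  qed
qed

end

section \<open>Toeplitz-covariant representations\<close>

locale exel_rep = cstar_module M for M :: "('a::unital_cstar_algebra, 'm::complex_banach) bimodule" +
  fixes \<alpha> L :: "'a \<Rightarrow> 'a" and \<rho> :: "'a \<Rightarrow> 'b::unital_cstar_algebra" and V :: 'b
  assumes exel: "exel_bimodule \<alpha> L M" and covariant: "toeplitz_covariant \<alpha> L \<rho> V"
begin

abbreviation "\<psi> \<equiv> psi M \<rho> V"

section \<open>The map \<open>\<psi>\<close> on the completed module\<close>

lemma quo_clinear: "clinear (quo M)"
  and quo_dense: "closure (range (quo M)) = UNIV"
  and ract_quo: "ract M (quo M m) a = quo M (m * \<alpha> a)"
  and ip_quo: "ip M (quo M m) (quo M n) = L (star m * n)"
  and lact_quo: "lact M a (quo M b) = quo M (a * b)"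
  using exel unfolding exel_bimodule_def by (elim conjE, fast)+

lemma rho_hom: "star_hom \<rho>"
  and V_mult: "V * \<rho> a = \<rho> (\<alpha> a) * V"
  and star_V_mult: "star V * \<rho> a * V = \<rho> (L a)"
  using covariant unfolding toeplitz_covariant_def by blast+

lemmas rho = star_homD[OF rho_hom]

lemma star_rho_V: "star (\<rho> a * V) * (\<rho> b * V) = \<rho> (L (star a * b))"
  using star_V_mult[of "star a * b"] by (simp add: star_mult rho mult.assoc)

text \<open>Hence \<open>\<rho> a * V\<close> depends on \<open>quo M a\<close> alone; this is the
  bound for the graph of \<open>psi\<close>.\<close>

lemma norm_rho_V: "norm (\<rho> a * V) \<le> norm (quo M a)"
proof -
  have "(norm (\<rho> a * V))\<^sup>2 = norm (\<rho> (ip M (quo M a) (quo M a)))"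
    unfolding ip_quo star_rho_V[symmetric] by (simp only: cstar_identity)
  also have "\<dots> \<le> (norm (quo M a))\<^sup>2" by (simp add: norm_square star_hom_norm_le[OF rho_hom])
  finally show ?thesis by (simp add: power2_le_iff_abs_le)
qed

lemma psi_exists: "\<exists>f. bounded_linear f \<and> clinear f \<and> (\<forall>a. f (quo M a) = \<rho> a * V)"
proof -
  define H where "H = range (\<lambda>a. (quo M a, \<rho> a * V))"
  note q = quo_clinear[unfolded clinear_def]
  have lin: "linear (\<lambda>a. (quo M a, \<rho> a * V))"
    by (rule linearI) (simp_all add: q rho star_hom_scaleR[OF rho_hom] distrib_right
        linear_scale[OF clinear_linear[OF quo_clinear]])
  have H: "subspace H" unfolding H_def using linear_subspace_image[OF lin subspace_UNIV] by simp
  have b: "norm z \<le> 1 * norm x" if "(x, z) \<in> H" for x z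
    using that norm_rho_V by (auto simp: H_def)
  have "fst ` H = range (quo M)" by (force simp: H_def)
  then have "\<exists>z. (x, z) \<in> closure H" for x
    using graph_closure_total[OF H _ b, of x] quo_dense by simp
  then obtain f where f: "\<And>x. (x, f x) \<in> closure H" by metis
  have u: "(x, z) \<in> closure H \<Longrightarrow> f x = z" for x z
    using graph_closure_unique[OF H b f] by blast
  note cH = subspace_closure[OF H]
  have fa: "f (x + y) = f x + f y" for x y
    by (rule u) (use subspace_add[OF cH f f] in simp)
  \<comment> \<open>The closure lemmas concern real subspaces, so complex homogeneity is obtained by
    letting \<open>c\<close> act on both components of the graph.\<close>
  have fc: "f (c *\<^sub>C x) = c *\<^sub>C f x" for c x
  proof (rule u)
    let ?g = "\<lambda>p::'m \<times> 'b. (c *\<^sub>C fst p, c *\<^sub>C snd p)"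
    have g: "bounded_linear ?g"
      by (intro bounded_linear_Pair bounded_linear_compose[OF bounded_linear_scaleC]
          bounded_linear_fst bounded_linear_snd)
    have "?g p \<in> closure H" if "p \<in> closure (span H)" for p
    proof (rule bounded_linear_closure_span[OF g closed_closure cH _ that])
      fix p assume "p \<in> H"
      then obtain a where "p = (quo M a, \<rho> a * V)" by (auto simp: H_def)
      then have "?g p = (quo M (c *\<^sub>C a), \<rho> (c *\<^sub>C a) * V)"
        by (simp add: q rho mult_scaleC_left)
      then show "?g p \<in> closure H" using closure_subset[of H] unfolding H_def by auto
    qed
    then show "(c *\<^sub>C x, c *\<^sub>C f x) \<in> closure H" using f[of x] H by (force simp: span_eq_iff[THEN iffD2])
  qed
  have fl: "clinear f" using fa fc by (simp add: clinear_def)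
  have "bounded_linear f"
    by (rule bounded_linear_intro[where K = 1])
      (use fa linear_scale[OF clinear_linear[OF fl]] graph_closure_bound[OF b f] in simp_all)
  moreover have "f (quo M a) = \<rho> a * V" for a
    by (rule u) (use closure_subset[of H] in \<open>auto simp: H_def\<close>)
  ultimately show ?thesis using fl by blast
qed

lemma psi_props: "bounded_linear \<psi> \<and> clinear \<psi> \<and> (\<forall>a. \<psi> (quo M a) = \<rho> a * V)"
  unfolding psi_def
proof (rule theI'[where P = "\<lambda>f. bounded_linear f \<and> clinear f \<and> (\<forall>a. f (quo M a) = \<rho> a * V)"])
  show "\<exists>!f. bounded_linear f \<and> clinear f \<and> (\<forall>a. f (quo M a) = \<rho> a * V)"
  proof (rule ex_ex1I[OF psi_exists], elim conjE)
    fix f g :: "'m \<Rightarrow> 'b"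
    assume f: "bounded_linear f" "\<forall>a. f (quo M a) = \<rho> a * V"
      and g: "bounded_linear g" "\<forall>a. g (quo M a) = \<rho> a * V"
    have "f x = g x" for x
      by (rule eq_if_eq_on_dense[OF quo_dense])
        (use f g in \<open>auto intro: linear_continuous_on\<close>)
    then show "f = g" ..
  qed
qed

lemma psi_linear: "bounded_linear \<psi>" and psi_quo: "\<psi> (quo M a) = \<rho> a * V"
  using psi_props by blast+

lemma psi_scaleC: "\<psi> (c *\<^sub>C x) = c *\<^sub>C \<psi> x"
  using psi_props unfolding clinear_def by blast

lemmas rho_linear = star_hom_bounded_linear[OF rho_hom]
lemmas psi_cont [continuous_intros] = bounded_linear.continuous_on[OF psi_linear]
lemmas rho_cont [continuous_intros] = bounded_linear.continuous_on[OF rho_linear]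
lemmas star_cont [continuous_intros] = bounded_linear.continuous_on[OF bounded_linear_star]
lemmas ip_cont [continuous_intros] = bounded_bilinear.continuous_on[OF bounded_bilinear_ip]
lemmas ract_cont [continuous_intros] = bounded_bilinear.continuous_on[OF bounded_bilinear_ract]

lemma eq_if_eq_on_quo:
  fixes f g :: "'m \<Rightarrow> 'y::t2_space"
  assumes "continuous_on UNIV f" "continuous_on UNIV g" "\<And>a. f (quo M a) = g (quo M a)"
  shows "f x = g x"
  by (rule eq_if_eq_on_dense[OF quo_dense assms(1,2)]) (use assms(3) in auto)

lemma psi_ip: "star (\<psi> x) * \<psi> y = \<rho> (ip M x y)"
proof -
  have 1: "star (\<psi> (quo M a)) * \<psi> y = \<rho> (ip M (quo M a) y)" for a y
    by (rule eq_if_eq_on_quo[where x = y])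
      (auto intro!: continuous_intros simp: psi_quo star_rho_V ip_quo)
  show ?thesis
    by (rule eq_if_eq_on_quo[where x = x]) (auto intro!: continuous_intros simp: 1)
qed

lemma psi_ract: "\<psi> (ract M x a) = \<psi> x * \<rho> a"
  by (rule eq_if_eq_on_quo[where x = x])
    (auto intro!: continuous_intros simp: psi_quo ract_quo rho mult.assoc V_mult)

lemma psi_lact: "\<psi> (lact M a x) = \<rho> a * \<psi> x"
  by (rule eq_if_eq_on_quo[where x = x])
    (auto intro!: continuous_intros simp: psi_quo lact_quo rho mult.assoc)

lemma norm_psi: "norm (\<psi> x) \<le> norm x"
proof -
  have "(norm (\<psi> x))\<^sup>2 \<le> (norm x)\<^sup>2"
    unfolding cstar_identity[symmetric] psi_ip norm_square by (rule star_hom_norm_le[OF rho_hom])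
  then show ?thesis by (simp add: power2_le_iff_abs_le)
qed

text \<open>The graph of the homomorphism induced by \<open>\<psi>\<close>, restricted to finite-rank operators.\<close>

definition G :: "(('m \<Rightarrow>\<^sub>L 'm) \<times> 'b) set" where
  "G = span {(theta M x y, \<psi> x * star (\<psi> y)) | x y. True}"

section \<open>The homomorphism on compact operators through its graph\<close>

lemma subspace_G: "subspace G"
  by (simp add: G_def)

lemma fst_G: "fst ` G = span {theta M x y | x y. True}"
proof -
  have "fst ` {(theta M x y, \<psi> x * star (\<psi> y)) | x y. True} = {theta M x y | x y. True}"
    by (force simp: image_iff)
  then show ?thesis
    by (simp only: G_def linear_span_image[OF bounded_linear.linear[OF bounded_linear_fst], symmetric])
qed

lemma compacts_eq: "compacts M = closure (fst ` G)"
  by (simp add: compacts_def fst_G)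

lemma theta_G: "(theta M x y, \<psi> x * star (\<psi> y)) \<in> G"
  unfolding G_def by (rule span_base) blast

lemma closure_G_induct:
  assumes "closed X" "subspace X" "\<And>x y. (theta M x y, \<psi> x * star (\<psi> y)) \<in> X" "p \<in> closure G"
  shows "p \<in> X"
proof -
  have "closure G \<subseteq> X" unfolding G_def by (rule closure_span_subset) (use assms in auto)
  then show ?thesis using assms(4) by blast
qed

text \<open>Left multiplication by \<open>z\<close> on the range of \<open>\<psi>\<close> implements
  \<open>k\<close>; this is the bridge between operators and elements of the algebra in all later
  estimates.\<close>

lemma closure_G_act:
  assumes "(k, z) \<in> closure G"
  shows "z * \<psi> m = \<psi> (k m)"
proof -
  let ?f = "\<lambda>p. snd p * \<psi> m - \<psi> (blinfun_apply (fst p) m)"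
  have f: "bounded_linear ?f"
    by (intro bounded_linear_sub bounded_linear_mult_const bounded_linear_snd
        bounded_linear_compose[OF psi_linear] bounded_linear_compose[OF blinfun.bounded_linear_left]
        bounded_linear_fst)
  have "(k, z) \<in> ?f -` {0}"
  proof (rule closure_G_induct[OF _ _ _ assms])
    show "closed (?f -` {0})" "subspace (?f -` {0})"
      by (intro closed_subspace_vimage[OF f]; simp add: subspace_def)+
    show "(theta M x y, \<psi> x * star (\<psi> y)) \<in> ?f -` {0}" for x y
      by (simp add: theta_apply psi_ract mult.assoc psi_ip)
  qed
  then show ?thesis by simp
qed

lemma G_adjoint:
  assumes "(k, z) \<in> G"
  shows "\<exists>k'. adjoint_of M k k' \<and> (k', star z) \<in> G"
proof -
  let ?P = "\<lambda>p. \<exists>k'. adjoint_of M (fst p) k' \<and> (k', star (snd p)) \<in> G"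
  have "?P (k, z)"
  proof (rule span_induct[OF assms[unfolded G_def], where P = ?P])
    show "subspace (Collect ?P)"
    proof (rule subspaceI)
      have "adjoint_of M 0 0" using ip_scaleR_left[of 0] ip_scaleR_right[of _ 0]
        by (simp add: adjoint_of_def)
      then show "0 \<in> Collect ?P" using subspace_0[OF subspace_G] by (auto simp: zero_prod_def)
    next
      fix p q assume "p \<in> Collect ?P" "q \<in> Collect ?P"
      then obtain k l where "adjoint_of M (fst p) k" "(k, star (snd p)) \<in> G"
        "adjoint_of M (fst q) l" "(l, star (snd q)) \<in> G" by blast
      then have "adjoint_of M (fst (p + q)) (k + l)" "(k + l, star (snd (p + q))) \<in> G"
        using adjoint_of_add subspace_add[OF subspace_G] by (simp_all add: star_add) force
      then show "p + q \<in> Collect ?P" by blast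
    next
      fix c p assume "p \<in> Collect ?P"
      then obtain k where "adjoint_of M (fst p) k" "(k, star (snd p)) \<in> G" by blast
      then have "adjoint_of M (fst (c *\<^sub>R p)) (c *\<^sub>R k)" "(c *\<^sub>R k, star (snd (c *\<^sub>R p))) \<in> G"
        using adjoint_of_scaleR subspace_scale[OF subspace_G] by (simp_all add: star_scaleR) force
      then show "c *\<^sub>R p \<in> Collect ?P" by blast
    qed
    fix p assume "p \<in> {(theta M x y, \<psi> x * star (\<psi> y)) |x y. True}"
    then obtain x y where "p = (theta M x y, \<psi> x * star (\<psi> y))" by blast
    then show "?P p" using adjoint_of_theta[of x y] theta_G[of y x] by (auto simp: star_mult star_star)
  qed
  then show ?thesis by simp
qed

text \<open>Composing \<open>theta M x y\<close> with \<open>g\<close> gives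
  \<open>theta M x (g' y)\<close>. Finite-rank operators thus absorb adjointable operators that may
  fail to be compact, such as the resolvent in \<open>G_lift\<close>.\<close>

lemma G_compose_right:
  assumes "(k, z) \<in> G" "adjoint_of M g g'"
  shows "\<exists>z'. (k o\<^sub>L g, z') \<in> G"
proof -
  have "k o\<^sub>L g \<in> fst ` G"
  proof -
    let ?P = "\<lambda>k. k o\<^sub>L g \<in> fst ` G"
    have "k \<in> span {theta M x y | x y. True}" using assms(1) fst_G by force
    then show ?thesis
    proof (rule span_induct[where P = ?P])
      have "subspace ((\<lambda>k. k o\<^sub>L g) -` (fst ` G))"
        by (rule linear_subspace_vimage[OF bounded_linear.linear[OF
                bounded_bilinear.bounded_linear_left[OF bounded_bilinear_blinfun_compose]]])
          (simp add: fst_G)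
      then show "subspace (Collect ?P)" by (simp add: vimage_def)
      fix l assume "l \<in> {theta M x y |x y. True}"
      then obtain x y where l: "l = theta M x y" by blast
      have "l o\<^sub>L g = theta M x (g' y)"
        using adjoint_of_sym[OF assms(2)]
        by (intro blinfun_eqI) (simp add: l theta_apply adjoint_of_def)
      then show "?P l" using theta_G[of x "g' y"] by force
    qed
  qed
  then show ?thesis by force
qed

text \<open>\<open>D\<close> may depend on how \<open>z\<close> is written as a finite sum, but one
  \<open>D\<close> serves all \<open>l\<close> and \<open>w\<close>. \<open>G_bound\<close> takes
  for \<open>w\<close> a high power of \<open>z * star z\<close>, where a fixed factor is
  harmless.\<close>

lemma G_growth:
  assumes "(k, z) \<in> G"
  shows "\<exists>D\<ge>0. \<forall>l w. (\<forall>m. w * \<psi> m = \<psi> (blinfun_apply l m)) \<longrightarrow> norm (w * z) \<le> D * norm l"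
proof -
  let ?Q = "\<lambda>D (p :: ('m \<Rightarrow>\<^sub>L 'm) \<times> 'b). \<forall>l w. (\<forall>m. w * \<psi> m = \<psi> (blinfun_apply l m)) \<longrightarrow> norm (w * snd p) \<le> D * norm l"
  let ?P = "\<lambda>p. \<exists>D\<ge>0. ?Q D p"
  have "?P (k, z)"
  proof (rule span_induct[OF assms[unfolded G_def], where P = ?P])
    show "subspace (Collect ?P)"
    proof (rule subspaceI)
      show "0 \<in> Collect ?P" by (auto intro: exI[of _ 0])
    next
      fix p q assume "p \<in> Collect ?P" "q \<in> Collect ?P"
      then obtain D E where D: "D \<ge> 0" "?Q D p" and E: "E \<ge> 0" "?Q E q" by blast
      have "?Q (D + E) (p + q)"
      proof (intro allI impI)
        fix l w assume lw: "\<forall>m. w * \<psi> m = \<psi> (blinfun_apply l m)"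
        have "norm (w * snd (p + q)) \<le> norm (w * snd p) + norm (w * snd q)"
          by (simp add: distrib_left norm_triangle_ineq)
        also have "\<dots> \<le> D * norm l + E * norm l" using D E lw by (intro add_mono) blast+
        finally show "norm (w * snd (p + q)) \<le> (D + E) * norm l" by (simp add: distrib_right)
      qed
      then show "p + q \<in> Collect ?P" using D(1) E(1) add_nonneg_nonneg by blast
    next
      fix c p assume "p \<in> Collect ?P"
      then obtain D where D: "D \<ge> 0" "?Q D p" by blast
      have "?Q (\<bar>c\<bar> * D) (c *\<^sub>R p)" using D(2) by (simp add: mult.assoc mult_left_mono)
      then show "c *\<^sub>R p \<in> Collect ?P" using mult_nonneg_nonneg[OF abs_ge_zero D(1)] by blast
    qed
    fix p assume "p \<in> {(theta M x y, \<psi> x * star (\<psi> y)) |x y. True}"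
    then obtain x y where p: "p = (theta M x y, \<psi> x * star (\<psi> y))" by blast
    have "?Q (norm x * norm y) p"
    proof (intro allI impI)
      fix l w assume "\<forall>m. w * \<psi> m = \<psi> (blinfun_apply l m)"
      then have "w * snd p = \<psi> (l x) * star (\<psi> y)" by (simp add: p mult.assoc[symmetric])
      then have "norm (w * snd p) \<le> norm (\<psi> (l x)) * norm (\<psi> y)" by (metis norm_mult_ineq norm_star)
      also have "\<dots> \<le> (norm l * norm x) * norm y"
        by (intro mult_mono order_trans[OF norm_psi] norm_blinfun norm_psi) auto
      finally show "norm (w * snd p) \<le> norm x * norm y * norm l" by (simp add: mult_ac)
    qed
    then show "?P p" by (meson mult_nonneg_nonneg norm_ge_zero)
  qed
  then show ?thesis by simp
qed

text \<open>The operator norm dominates because \<open>(zz\<^sup>*)\<^sup>n z\<close> grows no faster than \<open>(kk\<^sup>*)\<^sup>n\<close>.\<close>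

lemma G_bound:
  assumes kz: "(k, z) \<in> G"
  shows "norm z \<le> 3 * norm k"
proof -
  obtain k' where k': "adjoint_of M k k'" "(k', star z) \<in> G" using G_adjoint[OF kz] by blast
  obtain D where D: "D \<ge> 0" "\<And>l w. (\<And>m. w * \<psi> m = \<psi> (blinfun_apply l m)) \<Longrightarrow> norm (w * z) \<le> D * norm l"
    using G_growth[OF kz] by blast
  let ?w = "z * star z"
  have act: "?w * \<psi> m = \<psi> (k (k' m))" for m
    using closure_G_act[of k z] closure_G_act[of k' "star z"] kz k'(2) closure_subset[of G]
    by (metis mult.assoc subsetD)
  have "(norm z)\<^sup>2 \<le> 6 * (norm k)\<^sup>2 + e" if e: "e > 0" for e
  proof -
    \<comment> \<open>The summand \<open>e\<close> keeps \<open>b\<close> positive even for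
      \<open>k = 0\<close>, as \<open>b\<close> is a divisor below.\<close>
    define b where "b = 6 * (norm k)\<^sup>2 + e"
    have b: "b > 0" using e by (simp add: b_def add_nonneg_pos)
    have nb: "norm (k o\<^sub>L k') \<le> b"
    proof -
      have "norm (k o\<^sub>L k') \<le> norm k * norm k'" by (rule norm_blinfun_compose)
      also have "\<dots> \<le> norm k * (6 * norm k)" by (intro mult_left_mono norm_adjoint_of[OF k'(1)]) auto
      finally show ?thesis using e by (simp add: b_def power2_eq_square)
    qed
    have pw: "\<exists>l. (\<forall>m. ?w ^ n * \<psi> m = \<psi> (blinfun_apply l m)) \<and> norm l \<le> b ^ n" for n
    proof (induction n)
      case 0
      show ?case by (intro exI[of _ id_blinfun]) (simp add: norm_blinfun_id_le)
    next
      case (Suc n)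
      then obtain l where l: "\<And>m. ?w ^ n * \<psi> m = \<psi> (blinfun_apply l m)" "norm l \<le> b ^ n" by blast
      have "norm ((k o\<^sub>L k') o\<^sub>L l) \<le> b * b ^ n"
        using b by (intro order_trans[OF norm_blinfun_compose] mult_mono nb l) auto
      moreover have "?w ^ Suc n * \<psi> m = \<psi> (((k o\<^sub>L k') o\<^sub>L l) m)" for m
        using l(1)[of m] act[of "l m"] by (simp add: mult.assoc)
      ultimately show ?case by (metis power_Suc)
    qed
    have "(norm (star z))\<^sup>2 \<le> b"
    proof (rule le_if_power_two_power_le[where A = 0 and B = "D * norm z / b"])
      fix n
      let ?N = "2 ^ n :: nat"
      obtain l where l: "\<And>m. ?w ^ (?N - 1) * \<psi> m = \<psi> (blinfun_apply l m)" "norm l \<le> b ^ (?N - 1)"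
        using pw by blast
      \<comment> \<open>\<open>?w ^ ?N\<close> is regrouped as
        \<open>(?w ^ (?N - 1) * z) * star z\<close>, since the growth bound applies to products
        ending in \<open>z\<close>.\<close>
      have N: "?N = Suc (?N - 1)" by simp
      have "((norm (star z))\<^sup>2) ^ ?N = norm (?w ^ ?N)"
        using norm_power_two_power_star_mult[of "star z" n] by (simp add: star_star)
      also have "?w ^ ?N = ?w ^ (?N - 1) * ?w"
        by (subst N) (simp only: power_Suc2)
      also have "\<dots> = ?w ^ (?N - 1) * z * star z" by (simp add: mult.assoc)
      also have "norm \<dots> \<le> norm (?w ^ (?N - 1) * z) * norm (star z)" by (rule norm_mult_ineq)
      also have "\<dots> \<le> D * b ^ (?N - 1) * norm (star z)"
        by (rule mult_right_mono[OF order_trans[OF D(2)[OF l(1)] mult_left_mono[OF l(2) D(1)]] norm_ge_zero])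
      also have "\<dots> = D * b ^ (?N - 1) * norm z" by simp
      also have "\<dots> = D * norm z / b * b ^ ?N" using b by (subst (2) N) (simp only: power_Suc, simp)
      finally show "((norm (star z))\<^sup>2) ^ ?N \<le> (0 * 2 ^ n + D * norm z / b) * b ^ ?N" by simp
    qed (use b in auto)
    then show ?thesis by (simp add: b_def)
  qed
  then have "(norm z)\<^sup>2 \<le> 6 * (norm k)\<^sup>2" by (rule field_le_epsilon)
  also have "\<dots> \<le> (3 * norm k)\<^sup>2" by (simp add: power_mult_distrib)
  finally show ?thesis by (rule power2_le_imp_le) simp
qed

lemma closure_G_unique: "(k, z) \<in> closure G \<Longrightarrow> (k, z') \<in> closure G \<Longrightarrow> z = z'"
  by (rule graph_closure_unique[OF subspace_G, of 3]) (simp_all add: G_bound)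

lemma closure_G_bound: "(k, z) \<in> closure G \<Longrightarrow> norm z \<le> 3 * norm k"
  by (rule graph_closure_bound[of G]) (simp_all add: G_bound)

lemmas closed_subspace_G = closed_closure[of G] subspace_closure[OF subspace_G]

lemma compacts_total: "k \<in> compacts M \<Longrightarrow> \<exists>z. (k, z) \<in> closure G"
  unfolding compacts_eq by (rule graph_closure_total[OF subspace_G, of 3]) (simp_all add: G_bound)

lemma fst_closure_G: "(k, z) \<in> closure G \<Longrightarrow> k \<in> compacts M"
proof -
  assume "(k, z) \<in> closure G"
  then have "fst (k, z) \<in> compacts M"
    unfolding G_def compacts_def
    by (rule bounded_linear_closure_span[OF bounded_linear_fst closed_closure subspace_closure[OF subspace_span], rotated])
      (auto intro!: subsetD[OF closure_subset] span_base; blast)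
  then show ?thesis by simp
qed

lemma closure_G_scaleC:
  assumes "(k, z) \<in> closure G" "\<forall>x. blinfun_apply l x = c *\<^sub>C blinfun_apply k x"
  shows "(l, c *\<^sub>C z) \<in> closure G"
proof -
  define s :: "'m \<Rightarrow>\<^sub>L 'm" where "s = Blinfun (\<lambda>x. c *\<^sub>C x)"
  have s: "s x = c *\<^sub>C x" for x unfolding s_def by (simp add: bounded_linear_Blinfun_apply bounded_linear_scaleC)
  let ?f = "\<lambda>p :: ('m \<Rightarrow>\<^sub>L 'm) \<times> 'b. (s o\<^sub>L fst p, c *\<^sub>C snd p)"
  have f: "bounded_linear ?f"
    by (rule bounded_linear_Pair,
        rule bounded_linear_compose[OF bounded_bilinear.bounded_linear_right[OF bounded_bilinear_blinfun_compose] bounded_linear_fst],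
        rule bounded_linear_compose[OF bounded_linear_scaleC bounded_linear_snd])
  have "?f (k, z) \<in> closure G"
  proof (rule bounded_linear_closure_span[OF f closed_subspace_G _ assms(1)[unfolded G_def]])
    fix p assume "p \<in> {(theta M x y, \<psi> x * star (\<psi> y)) |x y. True}"
    then obtain x y where p: "p = (theta M x y, \<psi> x * star (\<psi> y))" by blast
    have "s o\<^sub>L theta M x y = theta M (c *\<^sub>C x) y"
      by (rule blinfun_eqI) (simp add: s theta_apply ract_scaleC_left)
    then have "?f p = (theta M (c *\<^sub>C x) y, \<psi> (c *\<^sub>C x) * star (\<psi> y))"
      by (simp add: p psi_scaleC mult_scaleC_left)
    then show "?f p \<in> closure G" using theta_G closure_subset by force
  qed
  moreover have "s o\<^sub>L k = l" by (rule blinfun_eqI) (simp add: s assms(2))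
  ultimately show ?thesis by simp
qed

lemma closure_G_mult:
  assumes "(k, z) \<in> closure G" "(l, w) \<in> closure G"
  shows "(k o\<^sub>L l, z * w) \<in> closure G"
proof -
  let ?b = "\<lambda>(p :: ('m \<Rightarrow>\<^sub>L 'm) \<times> 'b) (q :: ('m \<Rightarrow>\<^sub>L 'm) \<times> 'b). (fst p o\<^sub>L fst q, snd p * snd q)"
  have "?b (k, z) (l, w) \<in> closure G"
  proof (rule bounded_bilinear_closure_span[OF _ _ closed_subspace_G _ assms[unfolded G_def], where b = ?b])
    show "bounded_linear (\<lambda>p. ?b p q)" for q
      by (rule bounded_linear_Pair,
        rule bounded_linear_compose[OF bounded_bilinear.bounded_linear_left[OF bounded_bilinear_blinfun_compose] bounded_linear_fst],
        rule bounded_linear_mult_const[OF bounded_linear_snd])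
    show "bounded_linear (?b p)" for p
      by (rule bounded_linear_Pair,
        rule bounded_linear_compose[OF bounded_bilinear.bounded_linear_right[OF bounded_bilinear_blinfun_compose] bounded_linear_fst],
        rule bounded_linear_const_mult[OF bounded_linear_snd])
    fix p q assume "p \<in> {(theta M x y, \<psi> x * star (\<psi> y)) |x y. True}"
      "q \<in> {(theta M x y, \<psi> x * star (\<psi> y)) |x y. True}"
    then obtain x y u v where p: "p = (theta M x y, \<psi> x * star (\<psi> y))"
      and q: "q = (theta M u v, \<psi> u * star (\<psi> v))" by blast
    have "theta M x y o\<^sub>L theta M u v = theta M (ract M x (ip M y u)) v"
      by (rule blinfun_eqI) (simp add: theta_apply ip_ract_right ract_mult)
    moreover have "\<psi> x * star (\<psi> y) * (\<psi> u * star (\<psi> v)) = \<psi> (ract M x (ip M y u)) * star (\<psi> v)"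
      unfolding psi_ract psi_ip[symmetric] by (simp add: mult.assoc)
    ultimately show "?b p q \<in> closure G" using theta_G closure_subset by (force simp: p q)
  qed
  then show ?thesis by simp
qed

lemma closure_G_adjoint:
  assumes "(k, z) \<in> closure G" "adjoint_of M k l"
  shows "(l, star z) \<in> closure G"
proof -
  obtain P where P: "\<And>n. P n \<in> G" "P \<longlonglongrightarrow> (k, z)" using assms(1) unfolding closure_sequential by blast
  have "\<forall>n. \<exists>k'. adjoint_of M (fst (P n)) k' \<and> (k', star (snd (P n))) \<in> G"
    using P(1) G_adjoint by simp
  then obtain K where K: "\<And>n. adjoint_of M (fst (P n)) (K n)" "\<And>n. (K n, star (snd (P n))) \<in> G" by metis
  \<comment> \<open>Taking adjoints is bounded with constant 6, so the adjoints of the approximants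
    converge to \<open>l\<close>.\<close>
  have "norm (K n - l) \<le> 6 * norm (fst (P n) - k)" for n
  proof (rule norm_adjoint_of)
    show "adjoint_of M (fst (P n) - k) (K n - l)"
      using K(1)[of n] assms(2)
      by (simp add: adjoint_of_def blinfun.diff_left ip_diff_left ip_diff_right)
  qed
  then have 1: "\<forall>\<^sub>F n in sequentially. norm (K n - l) \<le> 6 * norm (fst (P n) - k)" by simp
  have "(\<lambda>n. 6 * norm (fst (P n) - k)) \<longlonglongrightarrow> 6 * norm (fst (k, z) - k)"
    by (intro tendsto_intros P(2))
  then have "(\<lambda>n. 6 * norm (fst (P n) - k)) \<longlonglongrightarrow> 0" by simp
  with 1 have "(\<lambda>n. K n - l) \<longlonglongrightarrow> 0" by (rule Lim_null_comparison)
  then have "K \<longlonglongrightarrow> l" by (simp add: LIM_zero_iff)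
  moreover have "(\<lambda>n. star (snd (P n))) \<longlonglongrightarrow> star (snd (k, z))"
    by (intro bounded_linear.tendsto[OF bounded_linear_star] tendsto_intros P(2))
  ultimately have "(\<lambda>n. (K n, star (snd (P n)))) \<longlonglongrightarrow> (l, star z)" by (auto intro: tendsto_Pair)
  then show ?thesis unfolding closure_sequential
    using K(2) by (intro exI[of _ "\<lambda>n. (K n, star (snd (P n)))"]) simp
qed

lemma induced_hom_exists: "\<exists>\<kappa>. is_induced_hom M \<psi> \<kappa>"
proof -
  define \<kappa> where "\<kappa> k = (SOME z. (k, z) \<in> closure G)" for k
  have \<kappa>: "(k, \<kappa> k) \<in> closure G" if "k \<in> compacts M" for k
    unfolding \<kappa>_def by (rule someI_ex) (rule compacts_total[OF that])
  have u: "\<kappa> k = z" if "(k, z) \<in> closure G" for k z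
    using closure_G_unique[OF \<kappa>[OF fst_closure_G[OF that]] that] .
  have "is_induced_hom M \<psi> \<kappa>"
    unfolding is_induced_hom_def
  proof (intro conjI ballI allI impI)
    show "continuous_on (compacts M) \<kappa>"
    proof (rule continuous_onI)
      fix k e assume k: "k \<in> compacts M" and e: "(e::real) > 0"
      have "dist (\<kappa> l) (\<kappa> k) \<le> 3 * dist l k" if "l \<in> compacts M" for l
        using closure_G_bound[of "l - k" "\<kappa> l - \<kappa> k"] subspace_diff[OF closed_subspace_G(2) \<kappa>[OF that] \<kappa>[OF k]]
        by (simp add: dist_norm)
      then show "\<exists>d>0. \<forall>l\<in>compacts M. dist l k < d \<longrightarrow> dist (\<kappa> l) (\<kappa> k) \<le> e"
        using e by (intro exI[of _ "e / 3"]) force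
    qed
    fix k l assume k: "k \<in> compacts M" and l: "l \<in> compacts M"
    show "\<kappa> (k + l) = \<kappa> k + \<kappa> l"
      by (rule u) (use subspace_add[OF closed_subspace_G(2) \<kappa>[OF k] \<kappa>[OF l]] in simp)
    show "\<kappa> (k o\<^sub>L l) = \<kappa> k * \<kappa> l" by (rule u) (rule closure_G_mult[OF \<kappa>[OF k] \<kappa>[OF l]])
    show "\<kappa> l = c *\<^sub>C \<kappa> k" if "\<forall>x. blinfun_apply l x = c *\<^sub>C blinfun_apply k x" for c
      by (rule u) (rule closure_G_scaleC[OF \<kappa>[OF k] that])
    show "\<kappa> l = star (\<kappa> k)" if "adjoint_of M k l"
      by (rule u) (rule closure_G_adjoint[OF \<kappa>[OF k] that])
  next
    show "\<kappa> (theta M x y) = \<psi> x * star (\<psi> y)" for x y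
      by (rule u) (use theta_G closure_subset in blast)
  qed
  then show ?thesis by blast
qed

text \<open>Real linearity, continuity and the values on \<open>theta M x y\<close> determine the
  map on \<open>compacts M\<close>, so whatever \<open>SOME\<close> picks has the closed graph as
  its values.\<close>

lemma induced_hom_eq:
  assumes "(k, z) \<in> closure G"
  shows "induced_hom M \<psi> k = z"
proof -
  let ?k = "induced_hom M \<psi>"
  have ind: "is_induced_hom M \<psi> ?k" unfolding induced_hom_def by (rule someI_ex[OF induced_hom_exists])
  then have cont: "continuous_on (compacts M) ?k" and theta: "\<And>x y. ?k (theta M x y) = \<psi> x * star (\<psi> y)"
    and add: "\<And>k l. k \<in> compacts M \<Longrightarrow> l \<in> compacts M \<Longrightarrow> ?k (k + l) = ?k k + ?k l"
    and scl: "\<And>c k l. k \<in> compacts M \<Longrightarrow> l \<in> compacts M \<Longrightarrow>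
      (\<And>x. blinfun_apply l x = c *\<^sub>C blinfun_apply k x) \<Longrightarrow> ?k l = c *\<^sub>C ?k k"
    unfolding is_induced_hom_def by blast+
  have sK: "subspace (compacts M)" by (simp add: compacts_def subspace_closure)
  have scR: "?k (c *\<^sub>R l) = c *\<^sub>R ?k l" if "l \<in> compacts M" for c l
    using scl[OF that subspace_scale[OF sK that], of c "complex_of_real c"]
    by (simp add: blinfun.scaleR_left scaleC_of_real)
  let ?X = "{p. fst p \<in> compacts M \<and> ?k (fst p) = snd p}"
  have sX: "subspace ?X"
  proof (rule subspaceI)
    show "0 \<in> ?X" using subspace_0[OF sK] scR[of 0 0] by simp
  qed (use add scR sK in \<open>auto intro: subspace_add subspace_scale\<close>)
  have "(k, z) \<in> ?X"
  proof -
    have "span {(theta M x y, \<psi> x * star (\<psi> y)) | x y. True} \<subseteq> ?X"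
      using sX theta_G closure_subset[of G]
      by (intro span_minimal) (auto simp: theta intro!: fst_closure_G[OF subsetD[OF closure_subset theta_G]])
    then have G: "G \<subseteq> ?X" by (simp add: G_def)
    obtain P where P: "\<And>n. P n \<in> G" "P \<longlonglongrightarrow> (k, z)" using assms unfolding closure_sequential by blast
    have k: "k \<in> compacts M" by (rule fst_closure_G[OF assms])
    have 1: "(\<lambda>n. fst (P n)) \<longlonglongrightarrow> k" "(\<lambda>n. snd (P n)) \<longlonglongrightarrow> z"
      using tendsto_fst[OF P(2)] tendsto_snd[OF P(2)] by simp_all
    have PK: "fst (P n) \<in> compacts M" "?k (fst (P n)) = snd (P n)" for n
      using subsetD[OF G P(1)[of n]] by simp_all
    have "(\<lambda>n. ?k (fst (P n))) \<longlonglongrightarrow> ?k k"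
      by (rule continuous_on_tendsto_compose[OF cont 1(1) k]) (simp add: PK(1))
    moreover note PK(2)
    ultimately have "?k k = z" using 1(2) LIMSEQ_unique by auto
    then show ?thesis using k by simp
  qed
  then show ?thesis by simp
qed

text \<open>With \<open>h = k' k\<close> and \<open>g = (1 + h^2)^-1\<close>, the operator
  \<open>k g\<close> has norm at most 3 (from \<open>6 \<le> 9\<close>) however large
  \<open>k\<close> is, while the second component hardly moves. This is the approximate lift behind
  the closed range of the induced homomorphism.\<close>

lemma G_lift:
  assumes kz: "(k, z) \<in> G" and nz: "norm z \<le> 1/2"
  shows "\<exists>k' z'. (k', z') \<in> G \<and> norm k' \<le> 3 \<and> norm (z - z') \<le> 1/30"
proof -
  obtain k' where k': "adjoint_of M k k'" "(k', star z) \<in> G" using G_adjoint[OF kz] by blast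
  note GG = subsetD[OF closure_subset[of G]]
  define h where "h = k' o\<^sub>L k"
  have h: "adjoint_of M h h" using k'(1) adjoint_of_sym[OF k'(1)] by (simp add: h_def adjoint_of_def)
  have hz: "(h, star z * z) \<in> closure G" unfolding h_def by (intro closure_G_mult GG kz k')
  have hz2: "(h o\<^sub>L h, (star z * z) * (star z * z)) \<in> closure G" by (intro closure_G_mult hz)
  obtain g where g: "adjoint_of M g g" "\<And>v. g v + h (h (g v)) = v" "\<And>v. g v + g (h (h v)) = v"
    "norm g \<le> 1" "\<And>v. norm (h (g v)) \<le> norm v"
    using selfadjoint_operator_inverse[OF h] by blast
  obtain z' where z': "(k o\<^sub>L g, z') \<in> G" using G_compose_right[OF kz g(1)] by blast
  have "norm (k o\<^sub>L g) \<le> 3"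
  proof (rule norm_blinfun_bound)
    fix m
    have gm: "norm (g m) \<le> norm m" using order_trans[OF norm_blinfun mult_right_mono[OF g(4)]] by simp
    have "(norm (k (g m)))\<^sup>2 = norm (ip M (g m) (h (g m)))"
      using k'(1) by (simp add: norm_square h_def adjoint_of_def)
    also have "\<dots> \<le> 6 * norm (g m) * norm (h (g m))" by (rule norm_ip)
    also have "\<dots> \<le> 6 * norm m * norm m" using gm g(5)[of m] by (intro mult_mono) auto
    also have "\<dots> \<le> (3 * norm m)\<^sup>2" by (simp add: power_mult_distrib power2_eq_square)
    finally have "norm (k (g m)) \<le> 3 * norm m" by (rule power2_le_imp_le) simp
    then show "norm ((k o\<^sub>L g) m) \<le> 3 * norm m" by simp
  qed simp
  moreover have "norm (z - z') \<le> 1/30"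
  proof -
    have "k - (k o\<^sub>L g) = (k o\<^sub>L g) o\<^sub>L (h o\<^sub>L h)"
    proof (rule blinfun_eqI)
      fix v
      have "k v = k (g v + g (h (h v)))" by (simp only: g(3))
      then show "(k - (k o\<^sub>L g)) v = ((k o\<^sub>L g) o\<^sub>L (h o\<^sub>L h)) v"
        by (simp add: blinfun.diff_left blinfun.add_right)
    qed
    then have "((k o\<^sub>L g) o\<^sub>L (h o\<^sub>L h), z - z') \<in> closure G"
      using GG[OF subspace_diff[OF subspace_G kz z']] by simp
    then have "z - z' = z' * ((star z * z) * (star z * z))"
      using closure_G_mult[OF GG[OF z'] hz2] by (rule closure_G_unique)
    also have "norm \<dots> \<le> norm z' * ((norm z)\<^sup>2 * (norm z)\<^sup>2)"
      by (intro order_trans[OF norm_mult_ineq] mult_left_mono order_trans[OF norm_mult_ineq])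
        (simp_all add: cstar_identity)
    also have "\<dots> \<le> norm z' * (1/16)"
    proof -
      have "(norm z)\<^sup>2 \<le> (1/2)\<^sup>2" using nz by (intro power_mono) auto
      then have "(norm z)\<^sup>2 * (norm z)\<^sup>2 \<le> (1/2)\<^sup>2 * (1/2)\<^sup>2" by (intro mult_mono) auto
      then show ?thesis by (intro mult_left_mono) (simp_all add: power2_eq_square)
    qed
    \<comment> \<open>For \<open>d = norm (z - z')\<close> this reads
      \<open>d \<le> (1/2 + d) / 16\<close>, whence 1/30.\<close>
    also have "norm z' \<le> norm z + norm (z - z')" by (metis norm_triangle_sub norm_minus_commute)
    finally show ?thesis using nz by simp
  qed
  ultimately show ?thesis using z' by blast
qed

text \<open>Approximate lifts along \<open>snd\<close> of bounded norm, iterated, become exact ones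
  for limits: the homomorphism on \<open>compacts M\<close> has closed range.\<close>

lemma closure_snd_G:
  assumes "z \<in> closure (snd ` G)"
  shows "\<exists>k. (k, z) \<in> closure G"
proof -
  let ?Z = "closure (snd ` G)"
  have sG: "subspace (snd ` G)"
    by (rule linear_subspace_image[OF bounded_linear.linear[OF bounded_linear_snd] subspace_G])
  have "\<exists>x\<in>G. snd x \<in> ?Z \<and> norm x \<le> 30 \<and> norm (y - snd x) \<le> 1/2" if y: "y \<in> ?Z" "norm y \<le> 1" for y
  proof -
    obtain z where z: "z \<in> snd ` G" "dist z y < 1/4"
      using y(1) unfolding closure_approachable by (meson zero_less_divide_1_iff zero_less_numeral)
    then obtain k where kz: "(k, z) \<in> G" "dist z y < 1/4" by auto
    have nz: "norm z \<le> 5/4" using kz(2) y(2) norm_triangle_sub[of z y] by (simp add: dist_norm)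
    \<comment> \<open>2/5 turns the bound 5/4 into the 1/2 that \<open>G_lift\<close> requires.
      Scaling back by 5/2 gives norm \<open>5/2 * 12 = 30\<close> and error
      \<open>1/4 + 5/2 * 1/30 = 1/3\<close>.\<close>
    have "((2/5) *\<^sub>R k, (2/5) *\<^sub>R z) \<in> G" using subspace_scale[OF subspace_G kz(1), of "2/5"] by simp
    moreover have "norm ((2/5) *\<^sub>R z) \<le> 1/2" using nz by simp
    ultimately obtain k' z' where 1: "(k', z') \<in> G" "norm k' \<le> 3" "norm ((2/5) *\<^sub>R z - z') \<le> 1/30"
      using G_lift by blast
    have "norm z' \<le> 9" using G_bound[OF 1(1)] 1(2) by simp
    then have n: "norm (k', z') \<le> 12" using norm_Pair_le[of k' z'] 1(2) by linarith
    let ?x = "(5/2) *\<^sub>R (k', z')"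
    have x: "?x \<in> G" by (rule subspace_scale[OF subspace_G 1(1)])
    have "z - (5/2) *\<^sub>R z' = (5/2) *\<^sub>R ((2/5) *\<^sub>R z - z')" by (simp add: scaleR_diff_right)
    then have "norm (z - (5/2) *\<^sub>R z') \<le> 1/12" using 1(3) by simp
    then have "norm (y - snd ?x) \<le> 1/2"
      using kz(2) norm_triangle_ineq[of "y - z" "z - (5/2) *\<^sub>R z'"] by (simp add: dist_norm norm_minus_commute)
    moreover have "norm ?x \<le> 30" using n by (simp only: norm_scaleR)
    moreover have "snd ?x \<in> ?Z" by (intro subsetD[OF closure_subset] imageI x)
    ultimately show ?thesis using x by blast
  qed
  from lift_iterate[OF bounded_linear_snd subspace_G subspace_closure[OF sG], of norm 1 30 z, OF _ _ _ _ this assms]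
  obtain x where "x \<in> closure G" "norm (z - snd x) = 0" by (auto simp: norm_triangle_ineq)
  then show ?thesis by (cases x) auto
qed

section \<open>Rank-one elements and the range of the induced homomorphism\<close>

definition rank_one :: "'b set" where
  "rank_one = {\<rho> b * V * star V * \<rho> c | b c. True}"

lemma psi_psi_rank_one: "\<psi> x * star (\<psi> y) \<in> closure (span rank_one)"
proof -
  have 0: "\<psi> (quo M a) * star (\<psi> (quo M b)) \<in> closure (span rank_one)" for a b
  proof -
    have "\<psi> (quo M a) * star (\<psi> (quo M b)) = \<rho> a * V * star V * \<rho> (star b)"
      by (simp add: psi_quo star_mult rho mult.assoc)
    then have "\<psi> (quo M a) * star (\<psi> (quo M b)) \<in> rank_one" unfolding rank_one_def by blast
    then show ?thesis by (intro subsetD[OF closure_subset] span_base)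
  qed
  have cl: "x \<in> X" if "closed X" "range (quo M) \<subseteq> X" for x X
    using closure_minimal[OF that(2,1)] quo_dense by auto
  have 1: "\<psi> x * star (\<psi> (quo M b)) \<in> closure (span rank_one)" for b
    by (rule vimageD, rule cl, rule closed_vimage[OF closed_closure])
      (use 0 in \<open>auto intro!: continuous_intros\<close>)
  show ?thesis
    by (rule vimageD[where f = "\<lambda>y. \<psi> x * star (\<psi> y)"], rule cl, rule closed_vimage[OF closed_closure])
      (use 1 in \<open>auto intro!: continuous_intros\<close>)
qed

lemma snd_closure_G: "(k, z) \<in> closure G \<Longrightarrow> z \<in> closure (span rank_one)"
proof -
  assume "(k, z) \<in> closure G"
  then have "snd (k, z) \<in> closure (span rank_one)"
    unfolding G_def
    by (rule bounded_linear_closure_span[OF bounded_linear_snd closed_closure subspace_closure[OF subspace_span], rotated])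
      (auto simp: psi_psi_rank_one)
  then show ?thesis by simp
qed

lemma rank_one_snd_G: "closure (span rank_one) \<subseteq> closure (snd ` G)"
proof (rule closure_span_subset)
  have "subspace (snd ` G)"
    by (rule linear_subspace_image[OF bounded_linear.linear[OF bounded_linear_snd] subspace_G])
  then show "subspace (closure (snd ` G))" by (rule subspace_closure)
  show "rank_one \<subseteq> closure (snd ` G)"
  proof
    fix w assume "w \<in> rank_one"
    then obtain b c where w: "w = \<rho> b * V * star V * \<rho> c" unfolding rank_one_def by blast
    have "w = \<psi> (quo M b) * star (\<psi> (quo M (star c)))"
      by (simp add: w psi_quo star_mult rho star_star mult.assoc)
    then have "w \<in> snd ` G" using theta_G by force
    then show "w \<in> closure (snd ` G)" by (rule subsetD[OF closure_subset])
  qed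
qed simp

text \<open>By closed range, limits of sums of rank-one elements are values of the induced
  homomorphism and not merely limits of values. This is what makes hypothesis (2)
  applicable.\<close>

lemma closure_rank_one_subset: "closure (span rank_one) \<subseteq> induced_hom M \<psi> ` compacts M"
proof
  fix z assume "z \<in> closure (span rank_one)"
  then obtain k where k: "(k, z) \<in> closure G" using rank_one_snd_G closure_snd_G by blast
  show "z \<in> induced_hom M \<psi> ` compacts M"
    using induced_hom_eq[OF k] fst_closure_G[OF k] by blast
qed

text \<open>For \<open>(i\<^sub>A, S)\<close> this \<open>z\<close> is the second entry of a
  redundancy. It is the image of \<open>lact M a\<close> under the induced homomorphism, and
  \<open>closure_G_act\<close> compares the two actions.\<close>

lemma compact_lact_rank_one:
  assumes "lact M a \<in> compacts M"
  shows "\<exists>z\<in>closure (span rank_one). \<forall>b. \<rho> a * \<rho> b * V = z * \<rho> b * V"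
proof -
  obtain z where z: "(lact M a, z) \<in> closure G" using compacts_total[OF assms] by blast
  have "\<rho> a * \<rho> b * V = z * \<rho> b * V" for b
    using closure_G_act[OF z, of "quo M b"] by (simp add: psi_lact psi_quo mult.assoc)
  then show ?thesis using snd_closure_G[OF z] by blast
qed

end

section \<open>Words and the grading\<close>

locale toeplitz_rep =
  fixes \<alpha> L :: "'a::unital_cstar_algebra \<Rightarrow> 'a" and j :: "'a \<Rightarrow> 'c::unital_cstar_algebra" and T :: 'c
  assumes alpha_hom: "star_hom \<alpha>" and covariant: "toeplitz_covariant \<alpha> L j T"
begin

lemma j_hom: "star_hom j" and j_one [simp]: "j 1 = 1"
  and T_j: "T * j a = j (\<alpha> a) * T" and star_T_j_T: "star T * j a * T = j (L a)"
  using covariant unfolding toeplitz_covariant_def by blast+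

lemmas j = star_homD[OF j_hom]

lemma j_star_T: "j a * star T = star T * j (\<alpha> a)"
proof -
  have "star (T * j (star a)) = star (j (\<alpha> (star a)) * T)" by (simp only: T_j)
  then show ?thesis by (simp add: star_mult j[symmetric] star_homD(4)[OF alpha_hom] star_star)
qed

lemma T_power_j: "T ^ k * j a = j ((\<alpha> ^^ k) a) * T ^ k"
proof (induction k)
  case (Suc k)
  have "T ^ Suc k * j a = T * (T ^ k * j a)" by (simp add: mult.assoc)
  also have "\<dots> = T * j ((\<alpha> ^^ k) a) * T ^ k" by (simp add: Suc mult.assoc)
  finally show ?case by (simp add: T_j mult.assoc)
qed simp

lemma j_star_T_power: "j a * star T ^ k = star T ^ k * j ((\<alpha> ^^ k) a)"
proof (induction k)
  case (Suc k)
  have "j a * star T ^ Suc k = j a * star T ^ k * star T"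
    by (simp only: power_Suc2 mult.assoc)
  also have "\<dots> = star T ^ k * (j ((\<alpha> ^^ k) a) * star T)" by (simp add: Suc mult.assoc)
  also have "\<dots> = star T ^ k * star T * j ((\<alpha> ^^ Suc k) a)" by (simp add: j_star_T mult.assoc)
  finally show ?case by (simp only: power_Suc2)
qed simp

lemma star_T_power_j_T_power: "star T ^ k * j a * T ^ k = j ((L ^^ k) a)"
proof (induction k)
  case (Suc k)
  have "star T ^ Suc k * j a * T ^ Suc k = star T * (star T ^ k * j a * T ^ k) * T"
    by (simp only: power_Suc[of "star T"] power_Suc2[of T] mult.assoc)
  then show ?case by (simp add: Suc star_T_j_T)
qed simp

section \<open>Words and their multiplication\<close>

definition word :: "'a \<Rightarrow> nat \<Rightarrow> nat \<Rightarrow> 'a \<Rightarrow> 'c" where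
  "word a k l b = j a * T ^ k * star T ^ l * j b"

lemma star_word: "star (word a k l b) = word (star b) l k (star a)"
  by (simp add: word_def star_mult star_power star_star j mult.assoc)

lemma j_word: "j a = word a 0 0 1"
  by (simp add: word_def)

text \<open>In the inner factor \<open>star T ^ l * j (b * c) * T ^ p\<close>, \<open>L\<close>
  absorbs the smaller of the two exponents and the remaining power moves outwards through
  \<open>\<alpha>\<close>. Degrees add. For two words of degree 0 the larger exponent survives,
  which makes \<open>core 1 m\<close> an ideal in \<open>core 0 m\<close>.\<close>

lemma word_mult:
  obtains x k' l' y where "word a k l b * word c p q d = word x k' l' y"
    "int k' - int l' = (int k - int l) + (int p - int q)"
    "k = l \<Longrightarrow> p = q \<Longrightarrow> k' = max k p \<and> l' = max k p"
proof (cases "p \<le> l")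
  case True
  have "word a k l b * word c p q d =
      j a * T ^ k * star T ^ (l - p) * (star T ^ p * j (b * c) * T ^ p) * star T ^ q * j d"
    using True power_add[of "star T" "l - p" p] by (simp add: word_def j mult.assoc)
  also have "\<dots> = j a * T ^ k * star T ^ (l - p) * (j ((L ^^ p) (b * c)) * star T ^ q) * j d"
    unfolding star_T_power_j_T_power by (simp add: mult.assoc)
  also have "\<dots> = word a k (l - p + q) ((\<alpha> ^^ q) ((L ^^ p) (b * c)) * d)"
    unfolding j_star_T_power by (simp add: word_def j power_add mult.assoc)
  finally show thesis by (rule that) (use True in auto)
next
  case False
  then have p: "p = l + (p - l)" by simp
  have "T ^ p = T ^ l * T ^ (p - l)" by (subst p) (rule power_add)
  then have "word a k l b * word c p q d =
      j a * T ^ k * (star T ^ l * j (b * c) * T ^ l) * T ^ (p - l) * star T ^ q * j d"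
    by (simp add: word_def j mult.assoc)
  also have "\<dots> = j a * (T ^ k * j ((L ^^ l) (b * c))) * T ^ (p - l) * star T ^ q * j d"
    unfolding star_T_power_j_T_power by (simp add: mult.assoc)
  also have "\<dots> = word (a * (\<alpha> ^^ k) ((L ^^ l) (b * c))) (k + (p - l)) q d"
    unfolding T_power_j by (simp add: word_def j power_add mult.assoc)
  finally show thesis by (rule that) (use False in auto)
qed

definition words :: "'c set" where
  "words = {word a k l b | a k l b. True}"

lemma closure_span_words_if_generated:
  assumes "cstar_generated (insert T (range j)) = UNIV"
  shows "closure (span words) = UNIV"
proof -
  let ?D = "closure (span words)"
  have sD: "subspace ?D" by (rule subspace_closure) simp
  have w: "word a k l b \<in> ?D" for a k l b
    unfolding words_def by (intro subsetD[OF closure_subset] span_base) blast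
  have "cstar_subalgebra ?D"
    unfolding cstar_subalgebra_def
  proof (intro conjI ballI allI)
    show "0 \<in> ?D" by (rule subspace_0[OF sD])
  next
    fix x y assume x: "x \<in> ?D" and y: "y \<in> ?D"
    show "x + y \<in> ?D" by (rule subspace_add[OF sD x y])
    show "x * y \<in> ?D"
    proof (rule bounded_bilinear_closure_span[OF bounded_linear_mult_left bounded_linear_mult_right _ sD _ x y])
      fix u v assume "u \<in> words" "v \<in> words"
      then obtain a k l b c p q d where "u = word a k l b" "v = word c p q d" unfolding words_def by blast
      then show "u * v \<in> ?D" using w by (metis word_mult)
    qed simp
  next
    fix c x assume x: "x \<in> ?D"
    show "c *\<^sub>C x \<in> ?D"
    proof (rule bounded_linear_closure_span[OF bounded_linear_scaleC _ sD _ x])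
      fix u assume "u \<in> words"
      then obtain a k l b where u: "u = word a k l b" unfolding words_def by blast
      have "c *\<^sub>C u = word (c *\<^sub>C a) k l b" by (simp add: u word_def j mult_scaleC_left)
      then show "c *\<^sub>C u \<in> ?D" using w by metis
    qed simp
  next
    fix x assume x: "x \<in> ?D"
    show "star x \<in> ?D"
      by (rule bounded_linear_closure_span[OF bounded_linear_star _ sD _ x])
        (use w in \<open>auto simp: words_def star_word\<close>)
  qed simp
  moreover have "insert T (range j) \<subseteq> ?D"
  proof -
    have "T = word 1 1 0 1" by (simp add: word_def)
    then show ?thesis using w by (metis insert_subset image_subsetI j_word)
  qed
  ultimately have "cstar_generated (insert T (range j)) \<subseteq> ?D"
    unfolding cstar_generated_def by blast
  then show ?thesis using assms by blast
qed

text \<open>The degree is the weight under the gauge action. The span is left unclosed so that an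
  element of \<open>Gr 0\<close> is a finite sum and lies in some \<open>core 0 m\<close>.\<close>

definition Gr :: "int \<Rightarrow> 'c set" where
  "Gr n = span {word a k l b | a k l b. int k - int l = n}"

definition level :: "nat \<Rightarrow> nat \<Rightarrow> 'c set" where
  "level i m = {word a k k b | a k b. i \<le> k \<and> k \<le> m}"

text \<open>\<open>core 0 m\<close> is the \<open>m\<close>-th stage of the filtration of the fixed-point algebra of the gauge
  action, and \<open>core 1 m\<close> is an ideal in it.\<close>

definition core :: "nat \<Rightarrow> nat \<Rightarrow> 'c set" where
  "core i m = closure (span (level i m))"

lemma closed_core: "closed (core i m)" and subspace_core: "subspace (core i m)"
  by (simp_all add: core_def subspace_closure)

lemma level_mult:
  assumes "u \<in> level i m" "v \<in> level i' m"
  shows "u * v \<in> level (max i i') m"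
proof -
  obtain a k b c p d where u: "u = word a k k b" "i \<le> k" "k \<le> m" and v: "v = word c p p d" "i' \<le> p" "p \<le> m"
    using assms unfolding level_def by blast
  obtain x k' l' y where w: "word a k k b * word c p p d = word x k' l' y" "k' = max k p \<and> l' = max k p"
    using word_mult[of a k k b c p p d] by metis
  have "u * v = word x (max k p) (max k p) y" using u v w by simp
  moreover have "max i i' \<le> max k p" "max k p \<le> m" using u v by auto
  ultimately show ?thesis unfolding level_def by blast
qed

lemma level_subset_core: "level i m \<subseteq> core i m"
  unfolding core_def using span_superset closure_subset by blast

lemma core_mult:
  assumes "x \<in> core i m" "y \<in> core i' m"
  shows "x * y \<in> core (max i i') m"
proof (rule bounded_bilinear_closure_span[OF bounded_linear_mult_left bounded_linear_mult_right
      closed_core subspace_core _ assms[unfolded core_def]])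
  show "u * v \<in> core (max i i') m" if "u \<in> level i m" "v \<in> level i' m" for u v
    using level_mult[OF that] level_subset_core by blast
qed

lemma core_star:
  assumes "x \<in> core i m"
  shows "star x \<in> core i m"
proof (rule bounded_linear_closure_span[OF bounded_linear_star closed_core subspace_core _ assms[unfolded core_def]])
  fix u assume "u \<in> level i m"
  then have "star u \<in> level i m" unfolding level_def by (force simp: star_word)
  then show "star u \<in> core i m" using level_subset_core by blast
qed

lemma core_mono: "i' \<le> i \<Longrightarrow> m \<le> m' \<Longrightarrow> core i m \<subseteq> core i' m'"
  unfolding core_def level_def
  by (intro closure_mono span_mono subsetI) (blast intro: order_trans)

lemma j_core: "j a \<in> core 0 m"
proof -
  have "word a 0 0 1 \<in> level 0 m" unfolding level_def by blast
  then show ?thesis using level_subset_core by (auto simp: j_word)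
qed

text \<open>One \<open>T\<close> and one \<open>star T\<close> are absorbed on each side by
  \<open>star T * j x * T = j (L x)\<close>, so a positive exponent drops by one; exponent 0 leads
  back to the range of \<open>j\<close>. This is the descent in
  \<open>tau_core_injective\<close>.\<close>

lemma compress_core:
  assumes "x \<in> core 0 (Suc m)"
  shows "star T * j b * x * j c * T \<in> core 0 m"
proof -
  have "bounded_linear (\<lambda>x. star T * j b * x * j c * T)"
    by (intro bounded_linear_mult_const bounded_linear_const_mult bounded_linear_ident)
  then show ?thesis
  proof (rule bounded_linear_closure_span[OF _ closed_core subspace_core _ assms[unfolded core_def]])
    fix u assume "u \<in> level 0 (Suc m)"
    then obtain a k d where u: "u = word a k k d" "k \<le> Suc m" unfolding level_def by blast
    show "star T * j b * u * j c * T \<in> core 0 m"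
    proof (cases k)
      case 0
      have "star T * j b * u * j c * T = star T * j (b * a * d * c) * T"
        by (simp add: u 0 word_def j mult.assoc)
      then show ?thesis by (simp add: star_T_j_T j_core)
    next
      case (Suc n)
      have "star T * j b * u * j c * T =
          (star T * j (b * a) * T) * T ^ n * star T ^ n * (star T * j (d * c) * T)"
        unfolding u word_def Suc power_Suc[of T] power_Suc2[of "star T"] by (simp add: j mult.assoc)
      then have "star T * j b * u * j c * T = word (L (b * a)) n n (L (d * c))"
        by (simp add: star_T_j_T word_def)
      moreover have "n \<le> m" using u Suc by simp
      ultimately have "star T * j b * u * j c * T \<in> level 0 m" unfolding level_def by blast
      then show ?thesis using level_subset_core by blast
    qed
  qed
qed

text \<open>Words of degree 0 and positive exponent end in \<open>star T * j b\<close> and begin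
  with \<open>j c * T\<close>, up to outer factors, so a compression of \<open>x\<close> appears
  inside \<open>u * x * v\<close>.\<close>

lemma compress_zero:
  assumes x: "\<And>b c. star T * j b * x * j c * T = 0" and u: "u \<in> core 1 m" and v: "v \<in> core 1 m"
  shows "u * x * v = 0"
proof -
  have "u * x * v \<in> {0}"
  proof (rule bounded_bilinear_closure_span[where b = "\<lambda>u v. u * x * v", OF _ _ _ _ _ u[unfolded core_def] v[unfolded core_def]])
    show "bounded_linear (\<lambda>u. u * x * v)" for v
      by (intro bounded_linear_mult_const bounded_linear_ident)
    show "bounded_linear (\<lambda>v. u * x * v)" for u by (rule bounded_linear_mult_right)
    fix u v assume "u \<in> level 1 m" "v \<in> level 1 m"
    then obtain a k b c p d where "u = word a k k b" "1 \<le> k" "v = word c p p d" "1 \<le> p"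
      unfolding level_def by blast
    then obtain n q where u: "u = word a (Suc n) (Suc n) b" and v: "v = word c (Suc q) (Suc q) d"
      by (metis One_nat_def Suc_le_D)
    have "u * x * v = j a * T ^ Suc n * star T ^ n * (star T * j b * x * j c * T) * T ^ q * star T ^ Suc q * j d"
      unfolding u v word_def power_Suc2[of "star T" n] power_Suc[of T q] by (simp only: mult.assoc)
    then show "u * x * v \<in> {0}" by (simp add: x)
  qed (auto simp: subspace_def)
  then show ?thesis by simp
qed

section \<open>Homogeneous components and bands\<close>

lemma Gr_star:
  assumes "x \<in> Gr n"
  shows "star x \<in> Gr (- n)"
proof -
  have "star ` {word a k l b | a k l b. int k - int l = n} \<subseteq> {word a k l b | a k l b. int k - int l = - n}"
    by (force simp: star_word)
  then have "span (star ` {word a k l b | a k l b. int k - int l = n}) \<subseteq> Gr (- n)"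
    unfolding Gr_def by (rule span_mono)
  then show ?thesis
    using assms unfolding Gr_def linear_span_image[OF bounded_linear.linear[OF bounded_linear_star]] by blast
qed

lemma span_mult:
  assumes "\<And>u v. u \<in> A \<Longrightarrow> v \<in> B \<Longrightarrow> u * v \<in> (C::'c set)" "x \<in> span A" "y \<in> span B"
  shows "x * y \<in> span C"
  using assms(2)
proof (rule span_induct[where P = "\<lambda>x. x * y \<in> span C"])
  show "subspace {x. x * y \<in> span C}"
    by (auto simp: subspace_def distrib_right span_add span_scale span_zero)
  fix u assume u: "u \<in> A"
  show "u * y \<in> span C"
    using assms(3)
  proof (rule span_induct[where P = "\<lambda>y. u * y \<in> span C"])
    show "subspace {y. u * y \<in> span C}"
      by (auto simp: subspace_def distrib_left span_add span_scale span_zero)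
    show "u * v \<in> span C" if "v \<in> B" for v using assms(1)[OF u that] by (rule span_base)
  qed
qed

lemma Gr_mult: "x \<in> Gr n \<Longrightarrow> y \<in> Gr n' \<Longrightarrow> x * y \<in> Gr (n + n')"
  unfolding Gr_def
proof (erule span_mult[rotated], assumption)
  fix u v assume "u \<in> {word a k l b | a k l b. int k - int l = n}" "v \<in> {word a k l b | a k l b. int k - int l = n'}"
  then obtain a k l b c p q d where "u = word a k l b" "int k - int l = n" "v = word c p q d" "int p - int q = n'"
    by blast
  then show "u * v \<in> {word a k l b | a k l b. int k - int l = n + n'}"
    using word_mult[of a k l b c p q d] by (smt (verit) mem_Collect_eq)
qed

lemma Gr_0_core:
  assumes "x \<in> Gr 0"
  shows "\<exists>m. x \<in> core 0 m"
  using assms unfolding Gr_def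
proof (rule span_induct[where P = "\<lambda>x. \<exists>m. x \<in> core 0 m"])
  show "subspace {x. \<exists>m. x \<in> core 0 m}"
  proof (rule subspaceI)
    show "0 \<in> {x. \<exists>m. x \<in> core 0 m}" using subspace_0[OF subspace_core] by blast
    fix x y assume "x \<in> {x. \<exists>m. x \<in> core 0 m}" "y \<in> {x. \<exists>m. x \<in> core 0 m}"
    then obtain m n where "x \<in> core 0 m" "y \<in> core 0 n" by blast
    then have "x \<in> core 0 (max m n)" "y \<in> core 0 (max m n)"
      using core_mono[of 0 0 m "max m n"] core_mono[of 0 0 n "max m n"] by auto
    then show "x + y \<in> {x. \<exists>m. x \<in> core 0 m}" using subspace_add[OF subspace_core] by blast
  next
    fix c x assume "x \<in> {x. \<exists>m. x \<in> core 0 m}"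
    then show "c *\<^sub>R x \<in> {x. \<exists>m. x \<in> core 0 m}" using subspace_scale[OF subspace_core] by blast
  qed
  fix x assume "x \<in> {word a k l b | a k l b. int k - int l = 0}"
  then obtain a k b where "x = word a k k b" by auto
  then have "x \<in> level 0 k" unfolding level_def by blast
  then show "\<exists>m. x \<in> core 0 m" using level_subset_core by blast
qed

text \<open>Bounding degrees rather than exponents controls the number of homogeneous components,
  hence the constant in \<open>norm_band_le_aux\<close>; the bound grows only additively under
  products.\<close>

definition band :: "nat \<Rightarrow> 'c set" where
  "band N = span {word a k l b | a k l b. \<bar>int k - int l\<bar> \<le> int N}"

lemma band_mult: "x \<in> band N \<Longrightarrow> y \<in> band N' \<Longrightarrow> x * y \<in> band (N + N')"
  unfolding band_def
proof (erule span_mult[rotated], assumption)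
  fix u v assume "u \<in> {word a k l b | a k l b. \<bar>int k - int l\<bar> \<le> int N}"
    "v \<in> {word a k l b | a k l b. \<bar>int k - int l\<bar> \<le> int N'}"
  then obtain a k l b c p q d where "u = word a k l b" "\<bar>int k - int l\<bar> \<le> int N"
    "v = word c p q d" "\<bar>int p - int q\<bar> \<le> int N'" by blast
  then show "u * v \<in> {word a k l b | a k l b. \<bar>int k - int l\<bar> \<le> int (N + N')}"
    using word_mult[of a k l b c p q d] by (smt (verit) mem_Collect_eq of_nat_add)
qed

lemma band_star:
  assumes "x \<in> band N"
  shows "star x \<in> band N"
proof -
  have "star ` {word a k l b | a k l b. \<bar>int k - int l\<bar> \<le> int N} \<subseteq> {word a k l b | a k l b. \<bar>int k - int l\<bar> \<le> int N}"
    by (force simp: star_word)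
  then have "span (star ` {word a k l b | a k l b. \<bar>int k - int l\<bar> \<le> int N}) \<subseteq> band N"
    unfolding band_def by (rule span_mono)
  then show ?thesis
    using assms unfolding band_def linear_span_image[OF bounded_linear.linear[OF bounded_linear_star]] by blast
qed

lemma band_decompose:
  assumes "x \<in> band N"
  shows "\<exists>f. (\<forall>n. f n \<in> Gr n) \<and> x = (\<Sum>n\<in>{- int N..int N}. f n)"
  using assms unfolding band_def
proof (rule span_induct[where P = "\<lambda>x. \<exists>f. (\<forall>n. f n \<in> Gr n) \<and> x = (\<Sum>n\<in>{- int N..int N}. f n)"])
  let ?P = "\<lambda>x. \<exists>f. (\<forall>n. f n \<in> Gr n) \<and> x = (\<Sum>n\<in>{- int N..int N}. f n)"
  have sG: "subspace (Gr n)" for n by (simp add: Gr_def)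
  show "subspace {x. ?P x}"
  proof (rule subspaceI)
    show "0 \<in> {x. ?P x}" by (auto intro!: exI[of _ "\<lambda>_. 0"] subspace_0[OF sG])
    fix x y assume "x \<in> {x. ?P x}" "y \<in> {x. ?P x}"
    then obtain f g where "\<forall>n. f n \<in> Gr n" "x = (\<Sum>n\<in>{- int N..int N}. f n)"
      "\<forall>n. g n \<in> Gr n" "y = (\<Sum>n\<in>{- int N..int N}. g n)" by blast
    then show "x + y \<in> {x. ?P x}"
      by (auto intro!: exI[of _ "\<lambda>n. f n + g n"] subspace_add[OF sG] simp: sum.distrib)
  next
    fix c x assume "x \<in> {x. ?P x}"
    then obtain f where "\<forall>n. f n \<in> Gr n" "x = (\<Sum>n\<in>{- int N..int N}. f n)" by blast
    then show "c *\<^sub>R x \<in> {x. ?P x}"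
      by (auto intro!: exI[of _ "\<lambda>n. c *\<^sub>R f n"] subspace_scale[OF sG] simp: scaleR_sum_right)
  qed
  fix x assume "x \<in> {word a k l b | a k l b. \<bar>int k - int l\<bar> \<le> int N}"
  then obtain a k l b where x: "x = word a k l b" "\<bar>int k - int l\<bar> \<le> int N" by blast
  let ?n = "int k - int l"
  have "x \<in> Gr ?n" unfolding Gr_def x by (rule span_base) blast
  moreover have "x = (\<Sum>n\<in>{- int N..int N}. if n = ?n then x else 0)"
    using x(2) by (subst sum.delta) auto
  ultimately show "?P x"
    by (intro exI[of _ "\<lambda>n. if n = ?n then x else 0"]) (auto intro: subspace_0[OF sG])
qed

lemma words_band:
  assumes "x \<in> span words"
  shows "\<exists>N. x \<in> band N"
proof -
  have mono: "x \<in> band N \<Longrightarrow> N \<le> N' \<Longrightarrow> x \<in> band N'" for x N N'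
  proof -
    assume x: "x \<in> band N" and N: "N \<le> N'"
    have "{word a k l b | a k l b. \<bar>int k - int l\<bar> \<le> int N} \<subseteq> {word a k l b | a k l b. \<bar>int k - int l\<bar> \<le> int N'}"
    proof
      fix u assume "u \<in> {word a k l b | a k l b. \<bar>int k - int l\<bar> \<le> int N}"
      then obtain a k l b where "u = word a k l b" "\<bar>int k - int l\<bar> \<le> int N" by blast
      moreover from this have "\<bar>int k - int l\<bar> \<le> int N'" using N by linarith
      ultimately show "u \<in> {word a k l b | a k l b. \<bar>int k - int l\<bar> \<le> int N'}" by blast
    qed
    then show "x \<in> band N'"
      unfolding band_def by (rule subsetD[OF span_mono]) (use x in \<open>simp only: band_def\<close>)
  qed
  show ?thesis
    using assms
  proof (rule span_induct[where P = "\<lambda>x. \<exists>N. x \<in> band N"])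
    have sB: "subspace (band N)" for N by (simp add: band_def)
    show "subspace {x. \<exists>N. x \<in> band N}"
    proof (rule subspaceI)
      fix x y assume "x \<in> {x. \<exists>N. x \<in> band N}" "y \<in> {x. \<exists>N. x \<in> band N}"
      then obtain N N' where "x \<in> band N" "y \<in> band N'" by blast
      then have "x \<in> band (N + N')" "y \<in> band (N + N')" using mono by (meson le_add1 le_add2)+
      then show "x + y \<in> {x. \<exists>N. x \<in> band N}" using subspace_add[OF sB] by blast
    qed (use subspace_0[OF sB] subspace_scale[OF sB] in blast)+
    fix x assume "x \<in> words"
    then obtain a k l b where x: "x = word a k l b" unfolding words_def by blast
    have "x \<in> band (k + l)" unfolding band_def x by (rule span_base) force
    then show "\<exists>N. x \<in> band N" by blast
  qed
qed

end

section \<open>Injectivity on the core\<close>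

locale faithful_on_coefficients = toeplitz_rep \<alpha> L j T
  for \<alpha> L :: "'a::unital_cstar_algebra \<Rightarrow> 'a" and j :: "'a \<Rightarrow> 'c::unital_cstar_algebra" and T :: 'c +
  fixes \<tau> :: "'c \<Rightarrow> 'b::unital_cstar_algebra"
  assumes tau_hom: "star_hom \<tau>" and tau_one: "\<tau> 1 = 1"
    and tau_j: "\<And>a. \<tau> (j a) = 0 \<Longrightarrow> j a = 0"
    and tau_core_1: "\<And>a. \<tau> (j a) \<in> closure (\<tau> ` core 1 1) \<Longrightarrow> j a \<in> core 1 1"
begin

lemmas tau = star_homD[OF tau_hom]
lemmas norm_tau = star_hom_norm_le[OF tau_hom]
lemmas tau_diff = star_hom_diff[OF tau_hom]
lemmas tau_linear = star_hom_bounded_linear[OF tau_hom]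

lemma tau_j_hom: "star_hom (\<lambda>a. \<tau> (j a))"
  by (simp add: star_hom_on_def tau j)

text \<open>A lower bound on the range of \<open>j\<close> passes to its closure, whereas
  injectivity alone would not; the bound comes from \<open>star_hom_lift\<close>.\<close>

lemma core_0_0:
  assumes "x \<in> core 0 0" "\<tau> x = 0"
  shows "x = 0"
proof -
  have b: "norm (j a) \<le> 4 * norm (\<tau> (j a))" for a
  proof -
    obtain a' where a': "\<tau> (j a') = \<tau> (j a)" "norm a' \<le> 4 * norm (\<tau> (j a))"
      using star_hom_lift[OF tau_j_hom, of UNIV a] by auto
    have "j (a - a') = 0" by (rule tau_j) (simp add: star_hom_diff[OF j_hom] tau_diff a')
    then have "j a = j a'" by (simp add: star_hom_diff[OF j_hom])
    then show ?thesis using star_hom_norm_le[OF j_hom, of a'] a'(2) by simp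
  qed
  have sj: "subspace (range j)"
    using linear_subspace_image[OF star_hom_linear[OF j_hom] subspace_UNIV] .
  have "level 0 0 \<subseteq> range j" by (auto simp: level_def word_def j(3)[symmetric])
  then have "span (level 0 0) \<subseteq> range j" using sj by (rule span_minimal)
  then have "core 0 0 \<subseteq> closure (range j)" unfolding core_def by (rule closure_mono)
  also have "\<dots> \<subseteq> {x. norm x \<le> 4 * norm (\<tau> x)}"
    by (intro closure_minimal closed_Collect_le continuous_intros linear_continuous_on tau_linear)
      (use b in auto)
  finally show ?thesis using assms by auto
qed

text \<open>Words in \<open>y\<close> may have any exponent from 1 to \<open>m\<close>, yet a unit
  from \<open>core 1 1\<close> suffices: each word is \<open>u * s\<close> with
  \<open>s = star T * j b\<close>, and \<open>star s * s\<close> lies in \<open>core 1 1\<close>. A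
  resolvent built from it makes \<open>s\<close> small.\<close>

lemma approximate_unit:
  assumes y: "y \<in> span (level 1 m)" and e: "e > 0"
  obtains f where "f \<in> core 1 1" "norm (1 - f) \<le> 1" "norm (y * (1 - f)) < e"
proof -
  define E where "E = {c. norm c \<le> 1 \<and> 1 - c \<in> core 1 1}"
  have c11: "x * y \<in> core 1 1" if "x \<in> core 1 1" "y \<in> core 1 1" for x y
    using core_mult[OF that] by simp
  have E_mult: "c * d \<in> E" if "c \<in> E" "d \<in> E" for c d
  proof -
    have cd: "1 - c \<in> core 1 1" "1 - d \<in> core 1 1" using that unfolding E_def by blast+
    have "1 - c * d = (1 - c) + (1 - d) - (1 - c) * (1 - d)" by (simp add: algebra_simps)
    also have "\<dots> \<in> core 1 1" by (intro subspace_diff subspace_add subspace_core c11 cd)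
    finally have "1 - c * d \<in> core 1 1" .
    moreover have "norm (c * d) \<le> 1"
      using that by (intro order_trans[OF norm_mult_ineq] mult_le_one) (auto simp: E_def)
    ultimately show ?thesis by (simp add: E_def)
  qed
  have E_1: "1 \<in> E" using norm_one_le subspace_0[OF subspace_core] by (simp add: E_def)
  \<comment> \<open>The preceding factor \<open>c\<close> lets the summands of \<open>y\<close> be
    made small one after another: later factors have norm at most 1 and do not spoil earlier
    estimates.\<close>
  let ?P = "\<lambda>y. \<forall>c\<in>E. \<forall>e>0. \<exists>d\<in>E. norm (y * c * d) < e"
  have "?P y"
    using y
  proof (rule span_induct[where P = ?P])
    show "subspace (Collect ?P)"
    proof (rule subspaceI)
      show "0 \<in> Collect ?P" using E_1 by auto
    next
      fix x y assume x: "x \<in> Collect ?P" and y: "y \<in> Collect ?P"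
      have "\<exists>d\<in>E. norm ((x + y) * c * d) < e" if c: "c \<in> E" and e: "e > 0" for c e
      proof -
        obtain d where d: "d \<in> E" "norm (x * c * d) < e / 2" using x c e half_gt_zero by blast
        obtain d' where d': "d' \<in> E" "norm (y * (c * d) * d') < e / 2"
          using y E_mult[OF c d(1)] e half_gt_zero by blast
        have "norm (x * c * d * d') \<le> norm (x * c * d) * norm d'" by (rule norm_mult_ineq)
        also have "\<dots> \<le> norm (x * c * d) * 1" using d'(1) by (intro mult_left_mono) (auto simp: E_def)
        finally have "norm (x * c * d * d') < e / 2" using d(2) by simp
        moreover have "(x + y) * c * (d * d') = x * c * d * d' + y * (c * d) * d'"
          by (simp add: algebra_simps)
        ultimately have "norm ((x + y) * c * (d * d')) < e"
          using d'(2) norm_triangle_ineq[of "x * c * d * d'" "y * (c * d) * d'"] by simp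
        then show ?thesis using E_mult[OF d(1) d'(1)] by blast
      qed
      then show "x + y \<in> Collect ?P" by blast
    next
      fix r x assume x: "x \<in> Collect ?P"
      have "\<exists>d\<in>E. norm ((r *\<^sub>R x) * c * d) < e" if c: "c \<in> E" and e: "e > 0" for c e
      proof -
        have "e / (\<bar>r\<bar> + 1) > 0" using e by (intro divide_pos_pos) auto
        then obtain d where d: "d \<in> E" "norm (x * c * d) < e / (\<bar>r\<bar> + 1)" using x c by blast
        have "\<bar>r\<bar> * norm (x * c * d) \<le> (\<bar>r\<bar> + 1) * norm (x * c * d)" by (intro mult_right_mono) auto
        also have "\<dots> < e" using d(2) by (simp add: pos_less_divide_eq mult.commute)
        finally show ?thesis using d(1) by (intro bexI[of _ d]) simp_all
      qed
      then show "r *\<^sub>R x \<in> Collect ?P" by blast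
    qed
    fix y assume "y \<in> level 1 m"
    then obtain a k b where "y = word a k k b" "1 \<le> k" unfolding level_def by blast
    then obtain n where n: "y = word a (Suc n) (Suc n) b" by (metis One_nat_def Suc_le_D)
    define u s where "u = j a * T ^ Suc n * star T ^ n" and "s = star T * j b"
    have us: "y = u * s" unfolding n u_def s_def word_def power_Suc2[of "star T" n] by (simp only: mult.assoc)
    show "?P y"
    proof (intro ballI allI impI)
      fix c and e :: real assume c: "c \<in> E" and e: "e > 0"
      define r where "r = e / (2 * (norm u + 1))"
      have r: "r > 0" unfolding r_def using e by (intro divide_pos_pos) (auto intro: add_nonneg_pos)
      define h where "h = star (s * c) * (s * c)"
      have h: "star h = h" by (simp add: h_def star_mult star_star)
      have hC: "h \<in> core 1 1"
      proof -
        let ?z = "star s * s" and ?f = "1 - c"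
        have "?z = word (star b) 1 1 b" by (simp add: s_def word_def star_mult star_star j mult.assoc)
        then have "?z \<in> level 1 1" unfolding level_def by auto
        then have z: "?z \<in> core 1 1" using level_subset_core by blast
        have f: "?f \<in> core 1 1" "star ?f \<in> core 1 1" using c core_star by (auto simp: E_def)
        have "h = ?z - ?z * ?f - star ?f * ?z + star ?f * (?z * ?f)"
          by (simp add: h_def star_mult star_diff algebra_simps)
        also have "\<dots> \<in> core 1 1"
          by (intro subspace_add subspace_diff subspace_core c11 z f)
        finally show ?thesis .
      qed
      \<comment> \<open>Rescaling turns \<open>norm (?H * d) \<le> 1\<close> into
        \<open>norm (h * d) \<le> r^2\<close>, which bounds \<open>s * c * d\<close> by
        \<open>r\<close>.\<close>
      let ?H = "(1 / r\<^sup>2) *\<^sub>R h"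
      obtain d where d: "star d = d" "1 - d \<in> core 1 1" "norm d \<le> 1" "norm (?H * d) \<le> 1"
        using selfadjoint_inverse[of ?H "core 1 1"] h hC closed_core subspace_core c11
        by (metis star_scaleR subspace_scale)
      have hd: "norm (h * d) \<le> r\<^sup>2" using d(4) r by (simp add: field_simps)
      have "(norm (s * c * d))\<^sup>2 = norm (star (s * c * d) * (s * c * d))" by (simp only: cstar_identity)
      also have "star (s * c * d) * (s * c * d) = d * (h * d)" by (simp add: star_mult d(1) h_def mult.assoc)
      also have "norm \<dots> \<le> norm d * norm (h * d)" by (rule norm_mult_ineq)
      also have "\<dots> \<le> 1 * r\<^sup>2" using d hd by (intro mult_mono) auto
      finally have "(norm (s * c * d))\<^sup>2 \<le> r\<^sup>2" by simp
      then have scd: "norm (s * c * d) \<le> r" by (rule power2_le_imp_le) (use r in simp)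
      have "norm (y * c * d) \<le> norm u * norm (s * c * d)"
        using norm_mult_ineq[of u "s * c * d"] by (simp add: us mult.assoc)
      also have "\<dots> \<le> (norm u + 1) * r" using scd r by (intro mult_mono) auto
      also have "\<dots> = e / 2" using norm_ge_zero[of u] by (simp add: r_def field_simps add_nonneg_eq_0_iff)
      also have "\<dots> < e" using e by simp
      finally show "\<exists>d\<in>E. norm (y * c * d) < e" using d by (auto simp: E_def)
    qed
  qed
  then obtain d where d: "d \<in> E" "norm (y * 1 * d) < e" using E_1 e by blast
  show thesis by (rule that[of "1 - d"]) (use d in \<open>auto simp: E_def\<close>)
qed

lemma tau_j_closure_core:
  assumes "\<tau> (j a) \<in> closure (\<tau> ` core 1 m)"
  shows "j a \<in> core 1 1"
proof (rule tau_core_1)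
  show "\<tau> (j a) \<in> closure (\<tau> ` core 1 1)"
    unfolding closure_approachable
  proof (intro allI impI)
    fix e :: real assume e: "e > 0"
    obtain y where y: "y \<in> core 1 m" "dist (\<tau> y) (\<tau> (j a)) < e / 3"
      using assms e unfolding closure_approachable by (metis (no_types, lifting) divide_pos_pos imageE zero_less_numeral)
    obtain y' where y': "y' \<in> span (level 1 m)" "dist y' y < e / 3"
      using y(1) e unfolding core_def closure_approachable by (metis divide_pos_pos zero_less_numeral)
    obtain f where f: "f \<in> core 1 1" "norm (1 - f) \<le> 1" "norm (y' * (1 - f)) < e / 3"
      using approximate_unit[OF y'(1), of "e / 3"] e by auto
    have "\<tau> (j a - y') = (\<tau> (j a) - \<tau> y) + \<tau> (y - y')" by (simp add: tau_diff)
    then have "norm (\<tau> (j a - y')) \<le> norm (\<tau> (j a) - \<tau> y) + norm (\<tau> (y - y'))"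
      by (simp only: norm_triangle_ineq)
    also have "\<dots> < e / 3 + e / 3"
      using y(2) y'(2) norm_tau[of "y - y'"] by (simp add: dist_norm norm_minus_commute)
    finally have 1: "norm (\<tau> (j a - y')) < 2 * e / 3" by simp
    \<comment> \<open>\<open>j a - y'\<close> has small image and \<open>1 - f\<close> nearly
      annihilates \<open>y'\<close>, so \<open>j a * f\<close>, which lies in
      \<open>core 1 1\<close>, is a good substitute for \<open>j a\<close>.\<close>
    have "\<tau> (j a) - \<tau> (j a * f) = \<tau> ((j a - y') * (1 - f)) + \<tau> (y' * (1 - f))"
      unfolding tau_diff[symmetric] tau(1)[symmetric] by (simp add: algebra_simps)
    then have "norm (\<tau> (j a) - \<tau> (j a * f)) \<le>
        norm (\<tau> ((j a - y') * (1 - f))) + norm (\<tau> (y' * (1 - f)))" by (metis norm_triangle_ineq)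
    also have "\<dots> \<le> norm (\<tau> (j a - y')) * norm (\<tau> (1 - f)) + norm (y' * (1 - f))"
      unfolding tau(3)[of "j a - y'"] by (intro add_mono norm_mult_ineq norm_tau)
    also have "\<dots> \<le> norm (\<tau> (j a - y')) * 1 + norm (y' * (1 - f))"
      using order_trans[OF norm_tau f(2)] by (intro add_mono mult_left_mono) auto
    also have "\<dots> < e" using 1 f(3) by simp
    finally have "dist (\<tau> (j a * f)) (\<tau> (j a)) < e" by (simp add: dist_norm norm_minus_commute)
    moreover have "j a * f \<in> core 1 1" using core_mult[OF j_core f(1)] by simp
    ultimately show "\<exists>y\<in>\<tau> ` core 1 1. dist y (\<tau> (j a)) < e" by blast
  qed
qed

text \<open>Approximants of \<open>x\<close> are \<open>j a + y\<close> with \<open>y\<close> in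
  \<open>core 1 m\<close>. From \<open>\<tau> x = 0\<close> the image of \<open>j a\<close> is
  merely near that of \<open>core 1 m\<close>, which does not yet place \<open>j a\<close> anywhere.
  A correction \<open>a'\<close> of norm at most \<open>4 * p a\<close> makes the distance exactly
  0, and \<open>tau_j_closure_core\<close> applies to \<open>a - a'\<close>.\<close>

lemma tau_ker_core_1:
  assumes x: "x \<in> core 0 m" "\<tau> x = 0" and m: "m \<ge> 1"
  shows "x \<in> core 1 m"
proof -
  let ?S = "\<tau> ` core 1 m"
  define p where "p = (\<lambda>a. infdist (\<tau> (j a)) ?S)"
  have S: "subspace ?S"
    using linear_subspace_image[OF star_hom_linear[OF tau_hom] subspace_core] .
  have S_ne: "?S \<noteq> {}" using subspace_0[OF S] by blast
  have cm: "y * z \<in> core 1 m" "j a * y \<in> core 1 m" "y * j a \<in> core 1 m"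
    if "y \<in> core 1 m" "z \<in> core 1 m" for y z a
    using core_mult[OF that] core_mult[OF j_core that(1)] core_mult[OF that(1) j_core] by simp_all
  have lift: "\<exists>a'. p (a - a') = 0 \<and> norm a' \<le> 4 * p a" for a
  proof -
    have "\<exists>a'\<in>UNIV. p (a - a') = 0 \<and> norm a' \<le> 4 * p a"
    proof (rule cstar_lift[where K = 1])
      show "p (a + b) \<le> p a + p b" for a b unfolding p_def j tau by (rule infdist_add_le[OF S])
      show "p (c *\<^sub>R a) = \<bar>c\<bar> * p a" for c a
        unfolding p_def star_hom_scaleR[OF j_hom] star_hom_scaleR[OF tau_hom] by (rule infdist_scaleR[OF S])
      show "p (a * b) \<le> p a * p b" for a b
        unfolding p_def j tau
        by (rule infdist_mult_le[OF S]) (use cm in \<open>auto simp: tau(3)[symmetric]\<close>)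
      show "p (star a) = p a" for a
        unfolding p_def j tau
        by (rule infdist_star[OF _ S_ne]) (use core_star in \<open>auto simp: tau(4)[symmetric]\<close>)
      show "p a \<le> 1 * norm a" for a
        using infdist_le[OF subspace_0[OF S], of "\<tau> (j a)"] star_hom_norm_le[OF tau_j_hom, of a]
        by (simp add: p_def)
    qed auto
    then show ?thesis by blast
  qed
  have "x \<in> closure (core 1 m)"
    unfolding closure_approachable
  proof (intro allI impI)
    fix e :: real assume e: "e > 0"
    \<comment> \<open>The final error is below \<open>e / 6\<close> from \<open>u\<close> plus
      \<open>4 * (e / 6)\<close> from \<open>a'\<close>.\<close>
    obtain u where u: "u \<in> span (level 0 m)" "dist u x < e / 6"
      using x(1) e unfolding core_def closure_approachable by (metis divide_pos_pos zero_less_numeral)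
    have "\<exists>a. \<exists>y\<in>core 1 m. u = j a + y"
      using u(1)
    proof (rule span_induct[where P = "\<lambda>u. \<exists>a. \<exists>y\<in>core 1 m. u = j a + y"])
      show "subspace {u. \<exists>a. \<exists>y\<in>core 1 m. u = j a + y}"
      proof (rule subspaceI)
        show "0 \<in> {u. \<exists>a. \<exists>y\<in>core 1 m. u = j a + y}"
          using star_hom_zero[OF j_hom] subspace_0[OF subspace_core] by force
        fix u v assume "u \<in> {u. \<exists>a. \<exists>y\<in>core 1 m. u = j a + y}" "v \<in> {u. \<exists>a. \<exists>y\<in>core 1 m. u = j a + y}"
        then obtain a b y z where "y \<in> core 1 m" "u = j a + y" "z \<in> core 1 m" "v = j b + z" by blast
        then have "u + v = j (a + b) + (y + z)" "y + z \<in> core 1 m"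
          by (auto simp: j intro: subspace_add subspace_core)
        then show "u + v \<in> {u. \<exists>a. \<exists>y\<in>core 1 m. u = j a + y}" by blast
      next
        fix c u assume "u \<in> {u. \<exists>a. \<exists>y\<in>core 1 m. u = j a + y}"
        then obtain a y where "y \<in> core 1 m" "u = j a + y" by blast
        then have "c *\<^sub>R u = j (c *\<^sub>R a) + c *\<^sub>R y" "c *\<^sub>R y \<in> core 1 m"
          by (auto simp: star_hom_scaleR[OF j_hom] scaleR_add_right intro: subspace_scale subspace_core)
        then show "c *\<^sub>R u \<in> {u. \<exists>a. \<exists>y\<in>core 1 m. u = j a + y}" by blast
      qed
      fix u assume "u \<in> level 0 m"
      then obtain a k b where u: "u = word a k k b" "k \<le> m" unfolding level_def by blast
      show "\<exists>a. \<exists>y\<in>core 1 m. u = j a + y"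
      proof (cases "k = 0")
        case True
        then have "u = j (a * b) + 0" by (simp add: u word_def j)
        then show ?thesis using subspace_0[OF subspace_core] by blast
      next
        case False
        then have "u \<in> level 1 m" using u unfolding level_def by force
        then have "u \<in> core 1 m" using level_subset_core by blast
        moreover have "u = j 0 + u" by (simp add: star_hom_zero[OF j_hom])
        ultimately show ?thesis by blast
      qed
    qed
    then obtain a y where y: "y \<in> core 1 m" "u = j a + y" by blast
    obtain a' where a': "p (a - a') = 0" "norm a' \<le> 4 * p a" using lift by blast
    have "p a \<le> dist (\<tau> (j a)) (\<tau> (- y))"
      unfolding p_def by (intro infdist_le imageI subspace_neg subspace_core y)
    also have "\<dots> = norm (\<tau> (u - x))"
      using x(2) y(2) by (simp add: dist_norm tau_diff[symmetric]) (simp add: tau_diff)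
    also have "\<dots> < e / 6" using norm_tau[of "u - x"] u(2) by (simp add: dist_norm)
    finally have pa: "p a < e / 6" .
    have "\<tau> (j (a - a')) \<in> closure ?S"
      using a'(1) in_closure_iff_infdist_zero[OF S_ne] by (simp add: p_def)
    then have "j (a - a') \<in> core 1 m"
      using tau_j_closure_core core_mono[OF order.refl m] by blast
    then have "j (a - a') + y \<in> core 1 m" using y by (intro subspace_add subspace_core)
    moreover have "dist (j (a - a') + y) x < e"
    proof -
      have "j (a - a') + y - x = (u - x) - j a'" by (simp add: y star_hom_diff[OF j_hom])
      then have "norm (j (a - a') + y - x) \<le> norm (u - x) + norm (j a')" by (metis norm_triangle_ineq4)
      also have "norm (j a') \<le> norm a'" by (rule star_hom_norm_le[OF j_hom])
      finally show ?thesis using u(2) a'(2) pa e by (simp add: dist_norm)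
    qed
    ultimately show "\<exists>y\<in>core 1 m. dist y x < e" by blast
  qed
  then show ?thesis using closed_core by simp
qed

lemma tau_core_injective: "x \<in> core 0 m \<Longrightarrow> \<tau> x = 0 \<Longrightarrow> x = 0"
proof (induction m arbitrary: x)
  case 0
  then show ?case using core_0_0 by blast
next
  case (Suc m)
  have z: "star T * j b * x * j c * T = 0" for b c
    by (rule Suc.IH[OF compress_core[OF Suc.prems(1)]]) (simp add: tau Suc.prems(2))
  have "star x \<in> core 1 (Suc m)"
    using tau_ker_core_1[OF Suc.prems] core_star by simp
  \<comment> \<open>Both outer factors of \<open>compress_zero\<close> are \<open>star x\<close>.
    Multiplied by \<open>x\<close>, the identity says that the self-adjoint
    \<open>star x * x\<close> has square 0.\<close>
  then have "star x * x * star x = 0" using compress_zero[OF z] by blast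
  then have "star (star x * x) * (star x * x) = 0"
    by (simp add: star_mult star_star mult.assoc[symmetric])
  then show ?case by (simp add: star_mult_self_eq_zero)
qed

text \<open>Injectivity gives the lower bound with constant 4 through a lift inside
  \<open>core 0 m\<close>; powers remove the 4.\<close>

lemma norm_core_le:
  assumes "x \<in> core 0 m"
  shows "norm x \<le> norm (\<tau> x)"
proof (rule star_hom_norm_le_if_bounded_below[OF tau_hom _ _ _ assms])
  show cm: "x * y \<in> core 0 m" if "x \<in> core 0 m" "y \<in> core 0 m" for x y using core_mult[OF that] by simp
  show cs: "star x \<in> core 0 m" if "x \<in> core 0 m" for x using core_star[OF that] .
  show "norm x \<le> 4 * norm (\<tau> x)" if x: "x \<in> core 0 m" for x
  proof -
    obtain x' where x': "x' \<in> core 0 m" "\<tau> x' = \<tau> x" "norm x' \<le> 4 * norm (\<tau> x)"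
      using star_hom_lift[OF tau_hom closed_core subspace_core cm cs x] by blast
    have "x - x' = 0"
      by (rule tau_core_injective) (use x x' subspace_core in \<open>auto simp: tau_diff intro: subspace_diff\<close>)
    then show ?thesis using x'(3) by simp
  qed
qed

text \<open>\<open>star x * x\<close> has degree 0, so the C*-identity reduces the claim to some
  core.\<close>

lemma norm_Gr_le:
  assumes "x \<in> Gr n"
  shows "norm x \<le> norm (\<tau> x)"
proof -
  have "star x * x \<in> Gr 0" using Gr_mult[OF Gr_star[OF assms] assms] by simp
  then obtain m where "star x * x \<in> core 0 m" using Gr_0_core by blast
  then have "norm (star x * x) \<le> norm (\<tau> (star x * x))" by (rule norm_core_le)
  then have "(norm x)\<^sup>2 \<le> (norm (\<tau> x))\<^sup>2" by (simp add: tau cstar_identity)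
  then show ?thesis by (simp add: power2_le_iff_abs_le)
qed

end

section \<open>The gauge action\<close>

text \<open>Orthogonality of characters of the cyclic group of order \<open>K\<close>; by the
  assumption, \<open>K\<close> divides \<open>d\<close> only if \<open>d = 0\<close>.\<close>

lemma sum_roots_of_unity:
  assumes "\<bar>d\<bar> < int K"
  shows "(\<Sum>r<K. cis (of_int d * (2 * pi * real r / real K))) = (if d = 0 then of_nat K else 0)"
proof (cases "d = 0")
  case False
  have K: "K > 0" using assms by linarith
  let ?x = "cis (of_int d * (2 * pi / real K))"
  have "cis (of_int d * (2 * pi * real r / real K)) = ?x ^ r" for r
    by (simp add: Complex.DeMoivre mult_ac)
  moreover have "?x \<noteq> 1"
  proof
    assume "?x = 1"
    then have "cos (of_int d * (2 * pi / real K)) = 1" by (metis cis.sel(1) one_complex.sel(1))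
    then obtain n :: int where "of_int d * (2 * pi / real K) = of_int n * 2 * pi"
      unfolding cos_one_2pi_int by blast
    then have "of_int d = of_int n * real K" using K by (simp add: field_simps)
    then have "d = n * int K" by (metis of_int_eq_iff of_int_mult of_int_of_nat_eq)
    then have "\<bar>n\<bar> * int K < 1 * int K" using assms by (simp add: abs_mult)
    then have "n = 0" by (simp only: mult_less_cancel_right) auto
    then show False using \<open>d = n * int K\<close> False by simp
  qed
  moreover have "?x ^ K = 1"
    using K cis_multiple_2pi[of "of_int d"] by (simp add: Complex.DeMoivre mult_ac)
  ultimately show ?thesis using False by (simp add: geometric_sum)
qed simp

text \<open>The action \<beta> enters as \<open>tau_gauge\<close>: gauge automorphisms preserve the
  fibres of \<open>\<tau>\<close> and so descend to its range.\<close>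

locale gauge_invariant = faithful_on_coefficients \<alpha> L j T \<tau>
  for \<alpha> L :: "'a::unital_cstar_algebra \<Rightarrow> 'a" and j :: "'a \<Rightarrow> 'c::unital_cstar_algebra" and T :: 'c
    and \<tau> :: "'c \<Rightarrow> 'b::unital_cstar_algebra" +
  fixes \<delta> :: "complex \<Rightarrow> 'c \<Rightarrow> 'c"
  assumes gauge: "gauge_action j T \<delta>"
    and tau_gauge: "\<And>z x y. z \<in> sphere 0 1 \<Longrightarrow> \<tau> x = \<tau> y \<Longrightarrow> \<tau> (\<delta> z x) = \<tau> (\<delta> z y)"
    and dense: "closure (span words) = UNIV"
begin

lemma delta_hom: "z \<in> sphere 0 1 \<Longrightarrow> star_hom (\<delta> z)"
  and delta_j: "z \<in> sphere 0 1 \<Longrightarrow> \<delta> z (j a) = j a"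
  and delta_T: "z \<in> sphere 0 1 \<Longrightarrow> \<delta> z T = z *\<^sub>C T"
  using gauge unfolding gauge_action_def circle_action_def by blast+

text \<open>By \<open>tau_gauge\<close>, \<open>x\<close> may be replaced by a lift of
  \<open>\<tau> x\<close> of norm at most \<open>4 * norm (\<tau> x)\<close>.\<close>

lemma norm_tau_delta:
  assumes z: "z \<in> sphere 0 1"
  shows "norm (\<tau> (\<delta> z x)) \<le> 4 * norm (\<tau> x)"
proof -
  obtain x' where x': "\<tau> x' = \<tau> x" "norm x' \<le> 4 * norm (\<tau> x)"
    using star_hom_lift[OF tau_hom, of UNIV x] by auto
  have "norm (\<tau> (\<delta> z x)) = norm (\<tau> (\<delta> z x'))" using tau_gauge[OF z] x'(1) by metis
  also have "\<dots> \<le> norm x'" by (rule order_trans[OF norm_tau star_hom_norm_le[OF delta_hom[OF z]]])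
  finally show ?thesis using x'(2) by simp
qed

lemma delta_Gr:
  assumes "x \<in> Gr n"
  shows "\<delta> (cis t) x = cis (of_int n * t) *\<^sub>C x"
  using assms unfolding Gr_def
proof (rule span_induct[where P = "\<lambda>x. \<delta> (cis t) x = cis (of_int n * t) *\<^sub>C x"])
  have z: "cis t \<in> sphere 0 1" by simp
  note d = star_homD[OF delta_hom[OF z]]
  show "subspace {x. \<delta> (cis t) x = cis (of_int n * t) *\<^sub>C x}"
    by (simp add: subspace_def d star_hom_zero[OF delta_hom[OF z]] star_hom_scaleR[OF delta_hom[OF z]]
        scaleC_add_right scaleC_scaleR_commute)
  fix x assume "x \<in> {word a k l b | a k l b. int k - int l = n}"
  then obtain a k l b where x: "x = word a k l b" "n = int k - int l" by blast
  have d1: "\<delta> (cis t) 1 = 1" using delta_j[OF z, of 1] by simp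
  have "\<delta> (cis t) x = (cis t ^ k * cnj (cis t) ^ l) *\<^sub>C x"
    by (simp add: x word_def d star_hom_power[OF delta_hom[OF z] d1] delta_j[OF z] delta_T[OF z] star_scaleC
        scaleC_power mult_scaleC_left mult_scaleC_right scaleC_scaleC mult.commute)
  also have "cis t ^ k * cnj (cis t) ^ l = cis (of_int n * t)"
    by (simp add: x cis_cnj Complex.DeMoivre cis_mult algebra_simps)
  finally show "\<delta> (cis t) x = cis (of_int n * t) *\<^sub>C x" .
qed

text \<open>Averaging over roots of unity recovers the components of \<open>c\<close>.\<close>

lemma norm_component_le:
  assumes f: "\<And>n. f n \<in> Gr n" and c: "c = (\<Sum>n\<in>{- int N..int N}. f n)" and n: "n \<in> {- int N..int N}"
  shows "norm (f n) \<le> 4 * norm (\<tau> c)"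
proof -
  \<comment> \<open>Degrees in the band differ by at most \<open>2 * N\<close>, so
    \<open>2 * N + 1\<close> roots of unity separate them.\<close>
  define K where "K = 2 * N + 1"
  define t where "t r = 2 * pi * real r / real K" for r :: nat
  have z: "cis (t r) \<in> sphere 0 1" for r by simp
  have lin: "linear (\<delta> (cis (t r)))" for r by (rule star_hom_linear[OF delta_hom[OF z]])
  have "(\<Sum>r<K. cis (of_int (- n) * t r) *\<^sub>C \<delta> (cis (t r)) c) =
      (\<Sum>r<K. \<Sum>n'\<in>{- int N..int N}. cis (of_int (n' - n) * t r) *\<^sub>C f n')"
    by (simp add: c linear_sum[OF lin] delta_Gr[OF f] scaleC_sum_right scaleC_scaleC cis_mult algebra_simps)
  also have "\<dots> = (\<Sum>n'\<in>{- int N..int N}. (\<Sum>r<K. cis (of_int (n' - n) * t r)) *\<^sub>C f n')"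
    by (subst sum.swap) (simp add: scaleC_sum_left)
  also have "\<dots> = (\<Sum>n'\<in>{- int N..int N}. if n' = n then of_nat K *\<^sub>C f n else 0)"
  proof (rule sum.cong[OF refl])
    fix n' assume "n' \<in> {- int N..int N}"
    then have "\<bar>n' - n\<bar> < int K" using n by (auto simp: K_def)
    from sum_roots_of_unity[OF this]
    show "(\<Sum>r<K. cis (of_int (n' - n) * t r)) *\<^sub>C f n' = (if n' = n then of_nat K *\<^sub>C f n else 0)"
      by (simp add: t_def)
  qed
  also have "\<dots> = of_nat K *\<^sub>C f n" using n by (simp add: sum.delta)
  finally have *: "of_nat K *\<^sub>C f n = (\<Sum>r<K. cis (of_int (- n) * t r) *\<^sub>C \<delta> (cis (t r)) c)" by simp
  have "real K * norm (\<tau> (f n)) = norm (\<tau> (of_nat K *\<^sub>C f n))" by (simp add: tau norm_scaleC)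
  also have "\<dots> = norm (\<Sum>r<K. cis (of_int (- n) * t r) *\<^sub>C \<tau> (\<delta> (cis (t r)) c))"
    unfolding * by (simp add: linear_sum[OF star_hom_linear[OF tau_hom]] tau)
  also have "\<dots> \<le> (\<Sum>r<K. norm (cis (of_int (- n) * t r) *\<^sub>C \<tau> (\<delta> (cis (t r)) c)))" by (rule norm_sum)
  also have "\<dots> \<le> (\<Sum>r<K. 4 * norm (\<tau> c))"
    by (rule sum_mono) (simp add: norm_scaleC norm_tau_delta[OF z])
  finally have "real K * norm (\<tau> (f n)) \<le> real K * (4 * norm (\<tau> c))" by simp
  then have "norm (\<tau> (f n)) \<le> 4 * norm (\<tau> c)" by (simp add: K_def mult_le_cancel_left)
  then show ?thesis using norm_Gr_le[OF f[of n]] by simp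
qed

text \<open>There are \<open>2 N + 1\<close> components, each bounded with constant 4.\<close>

lemma norm_band_le_aux:
  assumes "c \<in> band N"
  shows "norm c \<le> (8 * real N + 4) * norm (\<tau> c)"
proof -
  obtain f where f: "\<And>n. f n \<in> Gr n" "c = (\<Sum>n\<in>{- int N..int N}. f n)"
    using band_decompose[OF assms] by blast
  have "norm c \<le> (\<Sum>n\<in>{- int N..int N}. norm (f n))" unfolding f(2) by (rule norm_sum)
  also have "\<dots> \<le> (\<Sum>n\<in>{- int N..int N}. 4 * norm (\<tau> c))"
    using norm_component_le[OF f] by (rule sum_mono)
  also have "\<dots> = (8 * real N + 4) * norm (\<tau> c)" by (simp add: algebra_simps)
  finally show ?thesis .
qed

text \<open>\<open>(star c * c) ^ (2 ^ n)\<close> has degrees up to \<open>2 * N * 2 ^ n\<close>, so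
  its constant is \<open>16 * N * 2 ^ n + 4\<close>: linear in the exponent, as
  \<open>le_if_power_two_power_le\<close> permits.\<close>

lemma norm_band_le:
  assumes c: "c \<in> band N"
  shows "norm c \<le> norm (\<tau> c)"
proof -
  have pw: "(star c * c) ^ (2 ^ n) \<in> band (2 * N * 2 ^ n) \<and>
      \<tau> ((star c * c) ^ (2 ^ n)) = (star (\<tau> c) * \<tau> c) ^ (2 ^ n)" for n
  proof (induction n)
    case 0
    show ?case using band_mult[OF band_star[OF c] c] by (simp add: tau mult_2)
  next
    case (Suc n)
    have "2 * N * 2 ^ Suc n = 2 * N * 2 ^ n + 2 * N * 2 ^ n" by simp
    then show ?case
      using Suc band_mult[of "(star c * c) ^ (2 ^ n)" _ "(star c * c) ^ (2 ^ n)"]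
      by (simp only: power_Suc mult_2[of "2 ^ n"] power_add tau(3))
  qed
  have "(norm c)\<^sup>2 \<le> (norm (\<tau> c))\<^sup>2"
  proof (rule le_if_power_two_power_le[where A = "16 * real N" and B = 4])
    fix n
    have "norm ((star c * c) ^ (2 ^ n)) \<le>
        (8 * real (2 * N * 2 ^ n) + 4) * norm ((star (\<tau> c) * \<tau> c) ^ (2 ^ n))"
      using norm_band_le_aux pw[of n] by metis
    then show "((norm c)\<^sup>2) ^ (2 ^ n) \<le> (16 * real N * 2 ^ n + 4) * ((norm (\<tau> c))\<^sup>2) ^ (2 ^ n)"
      by (simp add: norm_power_two_power_star_mult mult.assoc)
  qed auto
  then show ?thesis by (simp add: power2_le_iff_abs_le)
qed

lemma tau_injective: "inj \<tau>"
proof -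
  have "closed {x. norm x \<le> norm (\<tau> x)}"
    by (intro closed_Collect_le continuous_intros linear_continuous_on tau_linear)
  then have "closure (span words) \<subseteq> {x. norm x \<le> norm (\<tau> x)}"
    using words_band norm_band_le by (intro closure_minimal) auto
  then have "norm (x - y) \<le> norm (\<tau> (x - y))" for x y using dense by auto
  then show ?thesis by (intro injI) (simp add: tau_diff, metis norm_le_zero_iff norm_zero right_minus_eq)
qed

end

theorem theorem5p1:
  fixes \<alpha> L :: "'a::unital_cstar_algebra \<Rightarrow> 'a"
    and M :: "('a, 'm::complex_banach) bimodule"
    and i\<^sub>A :: "'a \<Rightarrow> 't::unital_cstar_algebra" and S :: 't
    and Q :: "'t \<Rightarrow> 'c::unital_cstar_algebra"
    and j\<^sub>A :: "'a \<Rightarrow> 'c" and T :: 'c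
    and \<delta> :: "complex \<Rightarrow> 'c \<Rightarrow> 'c"
    and \<rho> :: "'a \<Rightarrow> 'b::unital_cstar_algebra" and V :: 'b
    and \<tau> :: "'c \<Rightarrow> 'b"
  assumes "star_hom \<alpha>"
    and "transfer_operator \<alpha> L"
    and "exel_bimodule \<alpha> L M"
    and "crossed_product \<alpha> L i\<^sub>A S Q"
    and "j\<^sub>A = Q \<circ> i\<^sub>A" and "T = Q S"
    and "gauge_action j\<^sub>A T \<delta>"
    and "covariant_representation \<alpha> L M \<rho> V"
    and "star_hom \<tau>" and "\<tau> \<circ> j\<^sub>A = \<rho>" and "\<tau> T = V"
    and "\<forall>a. \<rho> a = 0 \<longrightarrow> j\<^sub>A a = 0"
    and "\<forall>a. \<rho> a \<in> induced_hom M (psi M \<rho> V) ` compacts M \<longrightarrow> j\<^sub>A a \<in> j\<^sub>A ` K_alpha \<alpha> M"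
    and "\<exists>\<beta>. circle_action (range \<tau>) \<beta> \<and>
           (\<forall>z\<in>sphere 0 1. \<beta> z \<circ> \<tau> = \<tau> \<circ> \<delta> z)"
  shows "inj \<tau>"
proof -
  have iS: "toeplitz_covariant \<alpha> L i\<^sub>A S" and gen: "cstar_generated (insert S (range i\<^sub>A)) = UNIV"
    and Q: "star_hom Q" "surj Q" and Q_ker: "{x. Q x = 0} = redundancy_ideal \<alpha> i\<^sub>A S"
    using assms(4) unfolding crossed_product_def toeplitz_algebra_def cstar_quotient_map_def by blast+
  note q = star_homD[OF Q(1)]
  have Q1: "Q 1 = 1"
    using Q(2) q(3) by (metis mult_1_left mult_1_right surj_def)
  have jT: "toeplitz_covariant \<alpha> L j\<^sub>A T"
    using iS Q1 unfolding toeplitz_covariant_def assms(5,6)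
    by (simp add: star_hom_on_def q) (metis q(3,4))
  have \<rho>V: "toeplitz_covariant \<alpha> L \<rho> V"
    using assms(8) by (simp add: covariant_representation_def)
  have \<tau>j: "\<tau> (j\<^sub>A a) = \<rho> a" for a using assms(10) by auto
  have hilbert: "hilbert_module M" using assms(3) by (simp add: exel_bimodule_def)
  interpret i: toeplitz_rep \<alpha> L i\<^sub>A S by unfold_locales (rule assms(1) iS)+
  interpret j: toeplitz_rep \<alpha> L j\<^sub>A T by unfold_locales (rule assms(1) jT)+
  \<comment> \<open>The induced homomorphism is needed twice: for \<open>(i\<^sub>A, S)\<close> it
    produces redundancies, for \<open>(\<rho>, V)\<close> it describes the range in hypothesis
    (2).\<close>
  interpret ri: exel_rep M \<alpha> L i\<^sub>A S by unfold_locales (rule hilbert assms(3) iS)+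
  interpret r: exel_rep M \<alpha> L \<rho> V by unfold_locales (rule hilbert assms(3) \<rho>V)+
  have QW: "Q (i.word a k l b) = j.word a k l b" for a k l b
    unfolding i.word_def j.word_def by (simp add: q assms(5,6) star_hom_power[OF Q(1) Q1])
  have core: "closure (span ri.rank_one) \<subseteq> Q -` j.core 1 1"
  proof
    fix x assume "x \<in> closure (span ri.rank_one)"
    then have "Q x \<in> j.core 1 1"
    proof (rule bounded_linear_closure_span[OF star_hom_bounded_linear[OF Q(1)] j.closed_core j.subspace_core, rotated])
      fix u assume "u \<in> ri.rank_one"
      then obtain b c where "u = i.word b 1 1 c" unfolding ri.rank_one_def i.word_def by auto
      then have "Q u \<in> j.level 1 1" unfolding j.level_def by (auto simp: QW)
      then show "Q u \<in> j.core 1 1" using j.level_subset_core by blast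
    qed
    then show "x \<in> Q -` j.core 1 1" by simp
  qed
  \<comment> \<open>The compact operator \<open>lact M a\<close> gives a redundancy
    \<open>(i\<^sub>A a, z)\<close>; the quotient identifies its entries, so
    \<open>j\<^sub>A a = Q z\<close>.\<close>
  have K: "j\<^sub>A a \<in> j.core 1 1" if a: "a \<in> K_alpha \<alpha> M" for a
  proof -
    obtain z where z: "z \<in> closure (span ri.rank_one)" "\<forall>b. i\<^sub>A a * i\<^sub>A b * S = z * i\<^sub>A b * S"
      using ri.compact_lact_rank_one[of a] a unfolding K_alpha_def J_ideal_def by blast
    then have "redundancy i\<^sub>A S a z" unfolding redundancy_def ri.rank_one_def by blast
    then have "i\<^sub>A a - z \<in> redundancy_ideal \<alpha> i\<^sub>A S"
      using a unfolding redundancy_ideal_def ideal_generated_def K_alpha_def by blast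
    then have "Q (i\<^sub>A a - z) = 0" using Q_ker by blast
    then have "j\<^sub>A a = Q z" by (simp add: assms(5) star_hom_diff[OF Q(1)])
    then show ?thesis using z(1) core by auto
  qed
  have rank_one: "\<tau> ` j.core 1 1 \<subseteq> closure (span r.rank_one)"
  proof
    fix y assume "y \<in> \<tau> ` j.core 1 1"
    then obtain x where x: "x \<in> j.core 1 1" "y = \<tau> x" by blast
    have "\<tau> x \<in> closure (span r.rank_one)"
    proof (rule bounded_linear_closure_span[OF star_hom_bounded_linear[OF assms(9)] closed_closure
          subspace_closure[OF subspace_span] _ x(1)[unfolded j.core_def]])
      fix u assume "u \<in> j.level 1 1"
      then obtain b k c where "u = j.word b k k c" "k = 1" unfolding j.level_def by force
      then have "\<tau> u \<in> r.rank_one"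
        by (auto simp: r.rank_one_def j.word_def star_homD[OF assms(9)] \<tau>j assms(11))
      then show "\<tau> u \<in> closure (span r.rank_one)" by (intro subsetD[OF closure_subset] span_base)
    qed
    then show "y \<in> closure (span r.rank_one)" using x(2) by simp
  qed
  obtain \<beta> where \<beta>: "\<And>z x. z \<in> sphere 0 1 \<Longrightarrow> \<beta> z (\<tau> x) = \<tau> (\<delta> z x)"
    using assms(14) by (metis comp_apply)
  have dense: "closure (span j.words) = UNIV"
  proof -
    have "Q x \<in> closure (span j.words)" for x
    proof (rule bounded_linear_closure_span[OF star_hom_bounded_linear[OF Q(1)] closed_closure
          subspace_closure[OF subspace_span]])
      show "x \<in> closure (span i.words)" using i.closure_span_words_if_generated[OF gen] by simp
      fix u assume "u \<in> i.words"
      then obtain a k l b where "u = i.word a k l b" unfolding i.words_def by blast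
      then have "Q u \<in> j.words" unfolding j.words_def using QW by blast
      then show "Q u \<in> closure (span j.words)" by (intro subsetD[OF closure_subset] span_base)
    qed
    then show ?thesis using Q(2) by (metis UNIV_eq_I surj_def)
  qed
  interpret gauge_invariant \<alpha> L j\<^sub>A T \<tau> \<delta>
  proof unfold_locales
    show "star_hom \<tau>" by fact
    show "\<tau> 1 = 1" using \<tau>j[of 1] \<rho>V by (simp add: toeplitz_covariant_def)
    show "j\<^sub>A a = 0" if "\<tau> (j\<^sub>A a) = 0" for a using that assms(12) by (simp add: \<tau>j)
    show "j\<^sub>A a \<in> j.core 1 1" if "\<tau> (j\<^sub>A a) \<in> closure (\<tau> ` j.core 1 1)" for a
    proof -
      \<comment> \<open>The closure costs nothing, because the range in hypothesis (2) contains the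
        whole closed span of rank-one elements.\<close>
      have "closure (\<tau> ` j.core 1 1) \<subseteq> closure (span r.rank_one)"
        using rank_one by (intro closure_minimal) auto
      then have "\<rho> a \<in> induced_hom M (psi M \<rho> V) ` compacts M"
        using that r.closure_rank_one_subset by (auto simp: \<tau>j)
      then obtain a' where "a' \<in> K_alpha \<alpha> M" "j\<^sub>A a = j\<^sub>A a'" using assms(13) by blast
      then show ?thesis using K by simp
    qed
    show "gauge_action j\<^sub>A T \<delta>" by fact
    show "\<tau> (\<delta> z x) = \<tau> (\<delta> z y)" if "z \<in> sphere 0 1" "\<tau> x = \<tau> y" for z x y
      using \<beta>[OF that(1)] that(2) by metis
    show "closure (span j.words) = UNIV" by (rule dense)
  qed
  show ?thesis by (rule tau_injective)
qed

end
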